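(* Consider the problem $\partial_t u = Au + f(u)$, $u|_{\partial\Omega}=b$, $u(0)=u_0$, with exact solution $u(t)$, where $b$ is time-invariant. Let $A_0$ denote the linear differential operator $A$ endowed with homogeneous Dirichlet boundary conditions. Assume that $A_0$ generates an analytic semigroup on the Banach space $X$ (with norm $\|\cdot\|$), that $f$ is twice differentiable, and that $u(0)$ is sufficiently smooth. Let $u_n$ be the numerical approximation at time $t_n=n\tau$ obtained by Strang splitting with the second order TDBC correction (defined in the context) with step size $\tau>0$, started from the exact initial value. Then the scheme is second order convergent, i.e. $$ \| u_{n}-u(t_{n}) \| \leq C\tau^{2}(1+|\log\tau|) $$ for all $t_n=n\tau\leq T$, with $C$ independent of $\tau$ and $n$.
   Context: Setting. $X$ is a Banach space of functions on a domain $\Omega$, with norm $\|\cdot\|$. $A$ is a linear differential operator with smooth coefficients. $\partial\Omega$ denotes the part of the boundary of $\Omega$ on which Dirichlet conditions are imposed. The Dirichlet data $b$ do not depend on time. $A_0$ is the operator $A$ endowed with homogeneous Dirichlet boundary conditions on $\partial\Omega$. (Prototypical example: $\Omega\subset\mathbb{R}^d$ bounded with smooth boundary, $X=L^2(\Omega)$, $A=\Delta$, and $A_0$ the Laplacian with domain $H^2(\Omega)\cap H^1_0(\Omega)$.) The function $f$ is a nonlinear, non-stiff reaction on $X$, depending on $u$ but not on its derivatives, so that $f(u)|_{\partial\Omega}=f(b)$ whenever $u|_{\partial\Omega}=b$. The problem is considered on a finite time interval $[0,T]$. Standing assumptions. $f$ is sufficiently smooth in a neighborhood of the exact solution, and one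 works in a framework of smooth data and smooth solutions. As $A$ is a differential operator with smooth coefficients, its application to the (spatially smooth) functions that occur, such as the exact solution $u(t)$ and functions obtained from it through $f$ and $A$, is well defined and bounded. In contrast, applying $A_0$ to a function requires that function to satisfy in addition homogeneous Dirichlet boundary conditions. Scheme (Strang splitting with the second order TDBC correction). For step size $\tau$: - $\varphi^f_t(w_0)=w(t)$ is the solution at time $t$ of $\partial_t w = f(w)$, $w(0)=w_0$ (no boundary conditions). - $\varphi^A_\tau(v_0)=v(\tau)$, where $v$ is the exact solution on $[0,\tau]$ of $\partial_s v = Av$, $v(0)=v_0$, with the modified time-dependent boundary condition $$v(s)|_{\partial\Omega} = \overline{V}(s) = b+\left(\tfrac{\tau}{2}-s\right)f(b), \qquad 0\le s\le\tau.$$ This inhomogeneous boundary value problem is understood by homogenization: for a spatially smooth function $\rho(s)=\rho_0+s\rho_1$ with the prescribed boundary values, $v-\rho$ is the (mild) solution of $(v-\rho)'=A_0(v-\rho)+A\rho-\rho'$. - $S_\tau = \varphi^f_{\tau/2}\circ\varphi^A_\tau\circ\varphi^f_{\tau/2}$, and the numerical approximations are $u_{n+1}=S_\tau(u_n)$, with the numerical initial value equal to the exact initial value $u(0)$ (so the initial error is zero).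
   Formalization: As the flow of f may blow up for coarse steps, existence of u_n and the bound are asserted for all sufficiently small τ; for arbitrary τ>0 the bound is asserted for existing iterates with ‖u_n‖ ≤ R, with C depending on R but not on τ or n. *)

theory Defs
  imports "HOL-Analysis.Analysis"
begin

text \<open>Throughout, \<open>'d\<close> is the ambient Euclidean space of the domain \<open>\<Omega>\<close>, \<open>'v\<close> is the space in which
  the functions on \<open>\<Omega>\<close> take their values (\<open>real\<close> or \<open>complex\<close> for a scalar equation), and the
  Banach space \<open>X\<close> is the type \<open>'x\<close>.\<close>


subsection \<open>Smooth functions and differential operators\<close>

text \<open>The space $C^k(\overline\Omega)$: every partial derivative of order at most \<open>k\<close> exists in the
  open set \<open>\<Omega>\<close> and extends continuously to the closure.  The witness \<open>h\<close> is that extension.\<close>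

primrec Ck_closure :: "nat \<Rightarrow> 'd::euclidean_space set \<Rightarrow> ('d \<Rightarrow> 'b::real_normed_vector) \<Rightarrow> bool" where
  "Ck_closure 0 \<Omega> w \<longleftrightarrow> continuous_on (closure \<Omega>) w"
| "Ck_closure (Suc k) \<Omega> w \<longleftrightarrow>
     continuous_on (closure \<Omega>) w \<and>
     (\<forall>x\<in>\<Omega>. w differentiable (at x)) \<and>
     (\<forall>i\<in>Basis. \<exists>h. Ck_closure k \<Omega> h \<and> (\<forall>x\<in>\<Omega>. h x = frechet_derivative w (at x) i))"

primrec partial_deriv :: "'d::euclidean_space list \<Rightarrow> ('d \<Rightarrow> 'b::real_normed_vector) \<Rightarrow> 'd \<Rightarrow> 'b" where
  "partial_deriv [] w = w"
| "partial_deriv (i # is) w = (\<lambda>x. frechet_derivative (partial_deriv is w) (at x) i)"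

text \<open>Multi-indices are lists of basis vectors.  The coefficients are endomorphisms of \<open>'v\<close>, so that
  systems are included; a scalar coefficient is a multiple of the identity.\<close>

definition linear_diff_operator ::
    "nat \<Rightarrow> 'd::euclidean_space set \<Rightarrow> (('d \<Rightarrow> 'v::euclidean_space) \<Rightarrow> 'd \<Rightarrow> 'v) \<Rightarrow> bool" where
  "linear_diff_operator m \<Omega> A \<longleftrightarrow>
     (\<exists>(I :: 'd list set) (a :: 'd list \<Rightarrow> 'd \<Rightarrow> 'v \<Rightarrow>\<^sub>L 'v).
        finite I \<and>
        (\<forall>is\<in>I. set is \<subseteq> Basis \<and> length is \<le> m \<and> (\<forall>k. Ck_closure k \<Omega> (a is))) \<and>
        (\<forall>w. Ck_closure m \<Omega> w \<longrightarrow>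
           (\<forall>x\<in>\<Omega>. A w x = (\<Sum>is\<in>I. blinfun_apply (a is x) (partial_deriv is w x)))))"


subsection \<open>Banach spaces of functions\<close>

definition fun_subspace :: "('d \<Rightarrow> 'v::real_vector) set \<Rightarrow> bool" where
  "fun_subspace W \<longleftrightarrow>
     (\<lambda>x. 0) \<in> W \<and>
     (\<forall>w\<in>W. \<forall>z\<in>W. (\<lambda>x. w x + z x) \<in> W) \<and>
     (\<forall>c. \<forall>w\<in>W. (\<lambda>x. c *\<^sub>R w x) \<in> W)"

text \<open>The elements of \<open>'x\<close> are the functions in \<open>\<F>\<close>, identified when they agree almost everywhere in
  \<open>\<Omega>\<close>; \<open>q w\<close> is the element of \<open>'x\<close> represented by \<open>w\<close>.  Examples are $L^p(\Omega)$,
  $C(\overline\Omega)$, and Sobolev spaces.\<close>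

definition banach_function_space ::
    "'d::euclidean_space set \<Rightarrow> ('d \<Rightarrow> 'v::euclidean_space) set \<Rightarrow> (('d \<Rightarrow> 'v) \<Rightarrow> 'x::banach) \<Rightarrow> bool" where
  "banach_function_space \<Omega> \<F> q \<longleftrightarrow>
     fun_subspace \<F> \<and>
     (\<forall>w\<in>\<F>. \<forall>z. (\<forall>x\<in>\<Omega>. z x = w x) \<longrightarrow> z \<in> \<F>) \<and>
     (\<forall>w\<in>\<F>. \<forall>z\<in>\<F>. q (\<lambda>x. w x + z x) = q w + q z) \<and>
     (\<forall>c. \<forall>w\<in>\<F>. q (\<lambda>x. c *\<^sub>R w x) = c *\<^sub>R q w) \<and>
     (\<forall>w\<in>\<F>. \<forall>z\<in>\<F>. q w = q z \<longleftrightarrow> negligible {x\<in>\<Omega>. w x \<noteq> z x}) \<and>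
     q ` \<F> = UNIV"

text \<open>A class \<open>W\<close> of spatially smooth functions on which \<open>A\<close> acts with values in \<open>X\<close>.  It is a
  parameter, rather than all of $C^m(\overline\Omega)$, because homogeneous linear conditions may be
  imposed on the part of the boundary that carries no Dirichlet condition, and because for a space such
  as $W^{k,p}(\Omega)$ more than \<open>m\<close> derivatives are needed.\<close>

definition smooth_class ::
    "nat \<Rightarrow> 'd::euclidean_space set \<Rightarrow> ('d \<Rightarrow> 'v::euclidean_space) set \<Rightarrow>
     (('d \<Rightarrow> 'v) \<Rightarrow> 'd \<Rightarrow> 'v) \<Rightarrow> ('d \<Rightarrow> 'v) set \<Rightarrow> bool" where
  "smooth_class m \<Omega> \<F> A W \<longleftrightarrow>
     fun_subspace W \<and> (\<forall>w\<in>W. Ck_closure m \<Omega> w \<and> w \<in> \<F> \<and> A w \<in> \<F>)"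


subsection \<open>Analytic semigroups\<close>

text \<open>Analytic semigroups live on complex spaces, so the real space \<open>'x\<close> is complexified to \<open>'x \<times> 'x\<close>,
  where \<open>(x, y)\<close> stands for $x + iy$ and \<open>mult_i\<close> is multiplication by $i$.  The product norm is
  equivalent to the usual norms of the complexification, which is all that matters below.  A complex
  Banach space is covered as well, by regarding it as a real one.\<close>

lift_definition mult_i :: "('x::real_normed_vector \<times> 'x) \<Rightarrow>\<^sub>L ('x \<times> 'x)" is "\<lambda>p. (- snd p, fst p)"
  by (intro bounded_linear_Pair bounded_linear_minus bounded_linear_fst bounded_linear_snd)

definition complex_sector :: "real \<Rightarrow> complex set" where
  "complex_sector \<delta> = {z. z \<noteq> 0 \<and> \<bar>Arg z\<bar> < \<delta>}"

text \<open>The derivative condition is complex differentiability: the increment \<open>h\<close> acts on the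
  operator \<open>D\<close> as the complex scalar \<open>h\<close>.\<close>

definition analytic_semigroup ::
    "real \<Rightarrow> (complex \<Rightarrow> ('x::real_normed_vector \<times> 'x) \<Rightarrow>\<^sub>L ('x \<times> 'x)) \<Rightarrow> bool" where
  "analytic_semigroup \<delta> S \<longleftrightarrow>
     0 < \<delta> \<and> \<delta> \<le> pi / 2 \<and>
     (\<forall>z \<in> insert 0 (complex_sector \<delta>). S z o\<^sub>L mult_i = mult_i o\<^sub>L S z) \<and>
     S 0 = id_blinfun \<and>
     (\<forall>z \<in> complex_sector \<delta>. \<forall>w \<in> complex_sector \<delta>. S (z + w) = S z o\<^sub>L S w) \<and>
     (\<forall>z \<in> complex_sector \<delta>. \<exists>D.
        (S has_derivative (\<lambda>h. Re h *\<^sub>R D + Im h *\<^sub>R (mult_i o\<^sub>L D))) (at z)) \<and>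
     (\<forall>\<delta>'. 0 < \<delta>' \<and> \<delta>' < \<delta> \<longrightarrow>
        (\<forall>p. ((\<lambda>z. blinfun_apply (S z) p) \<longlongrightarrow> p) (at 0 within complex_sector \<delta>')))"

text \<open>The operator \<open>A0\<close> with domain \<open>D0\<close> is the infinitesimal generator of \<open>E\<close>, where \<open>E t\<close> is
  $e^{tA_0}$, and the complexification of \<open>E\<close> is the restriction to $[0,\infty)$ of an analytic
  semigroup.\<close>

definition generates_analytic_semigroup ::
    "'x::banach set \<Rightarrow> ('x \<Rightarrow> 'x) \<Rightarrow> (real \<Rightarrow> 'x \<Rightarrow>\<^sub>L 'x) \<Rightarrow> bool" where
  "generates_analytic_semigroup D0 A0 E \<longleftrightarrow>
     (\<exists>\<delta> S. analytic_semigroup \<delta> S \<and>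
        (\<forall>t\<ge>0. \<forall>x y. blinfun_apply (S (complex_of_real t)) (x, y) = (blinfun_apply (E t) x, blinfun_apply (E t) y))) \<and>
     (\<forall>x y. (x \<in> D0 \<and> A0 x = y) \<longleftrightarrow>
        ((\<lambda>t. (1 / t) *\<^sub>R (blinfun_apply (E t) x - x)) \<longlongrightarrow> y) (at_right 0))"

definition dirichlet_realization ::
    "'d set \<Rightarrow> (('d \<Rightarrow> 'v::euclidean_space) \<Rightarrow> 'x::banach) \<Rightarrow> ('d \<Rightarrow> 'v) set \<Rightarrow>
     (('d \<Rightarrow> 'v) \<Rightarrow> 'd \<Rightarrow> 'v) \<Rightarrow> 'x set \<Rightarrow> ('x \<Rightarrow> 'x) \<Rightarrow> bool" where
  "dirichlet_realization \<Gamma> q W A D0 A0 \<longleftrightarrow>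
     (\<forall>w\<in>W. (q w \<in> D0 \<longleftrightarrow> (\<forall>x\<in>\<Gamma>. w x = 0)) \<and> (q w \<in> D0 \<longrightarrow> A0 (q w) = q (A w)))"


subsection \<open>The reaction\<close>

text \<open>The reaction \<open>f\<close> on \<open>X\<close> acts pointwise through \<open>g\<close>; hence \<open>f(u)\<close> equals \<open>g x (b x)\<close> at every
  boundary point \<open>x\<close> where \<open>u\<close> equals \<open>b x\<close>.  The open set \<open>U\<close> is the region of \<open>X\<close> in which \<open>f\<close> is
  considered.\<close>

definition pointwise_reaction ::
    "('d \<Rightarrow> 'v::euclidean_space) set \<Rightarrow> (('d \<Rightarrow> 'v) \<Rightarrow> 'x::banach) \<Rightarrow> ('d \<Rightarrow> 'v \<Rightarrow> 'v) \<Rightarrow>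
     'x set \<Rightarrow> ('x \<Rightarrow> 'x) \<Rightarrow> bool" where
  "pointwise_reaction \<F> q g U f \<longleftrightarrow>
     (\<forall>w\<in>\<F>. q w \<in> U \<longrightarrow> (\<lambda>x. g x (w x)) \<in> \<F> \<and> f (q w) = q (\<lambda>x. g x (w x)))"

definition C2_on :: "'x::real_normed_vector set \<Rightarrow> ('x \<Rightarrow> 'x) \<Rightarrow> bool" where
  "C2_on U f \<longleftrightarrow>
     (\<exists>(f' :: 'x \<Rightarrow> 'x \<Rightarrow>\<^sub>L 'x) (f'' :: 'x \<Rightarrow> 'x \<Rightarrow>\<^sub>L ('x \<Rightarrow>\<^sub>L 'x)).
        (\<forall>x\<in>U. (f has_derivative blinfun_apply (f' x)) (at x) \<and>
               (f' has_derivative blinfun_apply (f'' x)) (at x)) \<and>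
        continuous_on U f'')"


subsection \<open>The exact solution\<close>

definition exact_solution ::
    "'d set \<Rightarrow> 'd set \<Rightarrow> (('d::euclidean_space \<Rightarrow> 'v::euclidean_space) \<Rightarrow> 'x::banach) \<Rightarrow> ('d \<Rightarrow> 'v) set \<Rightarrow>
     (('d \<Rightarrow> 'v) \<Rightarrow> 'd \<Rightarrow> 'v) \<Rightarrow> ('x \<Rightarrow> 'x) \<Rightarrow> ('d \<Rightarrow> 'v) \<Rightarrow> ('d \<Rightarrow> 'v) \<Rightarrow> real \<Rightarrow>
     (real \<Rightarrow> 'd \<Rightarrow> 'v) \<Rightarrow> bool" where
  "exact_solution \<Omega> \<Gamma> q W A f b u0 T u \<longleftrightarrow>
     (\<forall>x\<in>closure \<Omega>. u 0 x = u0 x) \<and>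
     (\<forall>t\<in>{0..T}.
        u t \<in> W \<and> (\<forall>x\<in>\<Gamma>. u t x = b x) \<and>
        ((\<lambda>s. q (u s)) has_vector_derivative q (A (u t)) + f (q (u t))) (at t within {0..T}))"

definition C3_curve :: "real \<Rightarrow> (real \<Rightarrow> 'x::real_normed_vector) \<Rightarrow> bool" where
  "C3_curve T c \<longleftrightarrow>
     (\<exists>c1 c2 c3.
        (\<forall>t\<in>{0..T}. (c has_vector_derivative c1 t) (at t within {0..T}) \<and>
                     (c1 has_vector_derivative c2 t) (at t within {0..T}) \<and>
                     (c2 has_vector_derivative c3 t) (at t within {0..T})) \<and>
        continuous_on {0..T} c3)"


subsection \<open>Strang splitting with the second order TDBC correction\<close>

text \<open>The flows are relations, because the flow of \<open>f\<close> need not exist for all times.\<close>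

definition flow_f :: "'x::banach set \<Rightarrow> ('x \<Rightarrow> 'x) \<Rightarrow> real \<Rightarrow> 'x \<Rightarrow> 'x \<Rightarrow> bool" where
  "flow_f U f t w0 w1 \<longleftrightarrow>
     (\<exists>w. w 0 = w0 \<and> w t = w1 \<and>
        (\<forall>s\<in>{0..t}. w s \<in> U \<and> (w has_vector_derivative f (w s)) (at s within {0..t})))"

definition mild_solution_at ::
    "(real \<Rightarrow> 'x::banach \<Rightarrow>\<^sub>L 'x) \<Rightarrow> (real \<Rightarrow> 'x) \<Rightarrow> 'x \<Rightarrow> real \<Rightarrow> 'x" where
  "mild_solution_at E r y0 t =
     blinfun_apply (E t) y0 + integral {0..t} (\<lambda>s. blinfun_apply (E (t - s)) (r s))"

text \<open>The value at time \<open>\<tau>\<close> of the solution of $\partial_s v = Av$ with the corrected boundary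
  condition, by homogenization with $\rho(s) = \rho_0 + s\rho_1$; here $A\rho-\rho'$ is the
  inhomogeneity.  The value does not depend on the choice of \<open>\<rho>\<close>.\<close>

definition flow_A ::
    "'d set \<Rightarrow> (('d \<Rightarrow> 'v::euclidean_space) \<Rightarrow> 'x::banach) \<Rightarrow> ('d \<Rightarrow> 'v) set \<Rightarrow>
     (('d \<Rightarrow> 'v) \<Rightarrow> 'd \<Rightarrow> 'v) \<Rightarrow> (real \<Rightarrow> 'x \<Rightarrow>\<^sub>L 'x) \<Rightarrow> ('d \<Rightarrow> 'v \<Rightarrow> 'v) \<Rightarrow> ('d \<Rightarrow> 'v) \<Rightarrow>
     real \<Rightarrow> 'x \<Rightarrow> 'x \<Rightarrow> bool" where
  "flow_A \<Gamma> q W A E g b \<tau> v0 v1 \<longleftrightarrow>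
     (\<exists>\<rho>0\<in>W. \<exists>\<rho>1\<in>W.
        (\<forall>s\<in>{0..\<tau>}. \<forall>x\<in>\<Gamma>. \<rho>0 x + s *\<^sub>R \<rho>1 x = b x + (\<tau> / 2 - s) *\<^sub>R g x (b x)) \<and>
        v1 = (q \<rho>0 + \<tau> *\<^sub>R q \<rho>1) +
             mild_solution_at E (\<lambda>s. (q (A \<rho>0) + s *\<^sub>R q (A \<rho>1)) - q \<rho>1) (v0 - q \<rho>0) \<tau>)"

definition strang_step ::
    "'d set \<Rightarrow> (('d \<Rightarrow> 'v::euclidean_space) \<Rightarrow> 'x::banach) \<Rightarrow> ('d \<Rightarrow> 'v) set \<Rightarrow>
     (('d \<Rightarrow> 'v) \<Rightarrow> 'd \<Rightarrow> 'v) \<Rightarrow> (real \<Rightarrow> 'x \<Rightarrow>\<^sub>L 'x) \<Rightarrow> ('d \<Rightarrow> 'v \<Rightarrow> 'v) \<Rightarrow> 'x set \<Rightarrow> ('x \<Rightarrow> 'x) \<Rightarrow>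
     ('d \<Rightarrow> 'v) \<Rightarrow> real \<Rightarrow> 'x \<Rightarrow> 'x \<Rightarrow> bool" where
  "strang_step \<Gamma> q W A E g U f b \<tau> v v' \<longleftrightarrow>
     (\<exists>w1 w2. flow_f U f (\<tau> / 2) v w1 \<and> flow_A \<Gamma> q W A E g b \<tau> w1 w2 \<and> flow_f U f (\<tau> / 2) w2 v')"

definition numerical_solution ::
    "'d set \<Rightarrow> (('d \<Rightarrow> 'v::euclidean_space) \<Rightarrow> 'x::banach) \<Rightarrow> ('d \<Rightarrow> 'v) set \<Rightarrow>
     (('d \<Rightarrow> 'v) \<Rightarrow> 'd \<Rightarrow> 'v) \<Rightarrow> (real \<Rightarrow> 'x \<Rightarrow>\<^sub>L 'x) \<Rightarrow> ('d \<Rightarrow> 'v \<Rightarrow> 'v) \<Rightarrow> 'x set \<Rightarrow> ('x \<Rightarrow> 'x) \<Rightarrow>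
     ('d \<Rightarrow> 'v) \<Rightarrow> ('d \<Rightarrow> 'v) \<Rightarrow> real \<Rightarrow> nat \<Rightarrow> (nat \<Rightarrow> 'x) \<Rightarrow> bool" where
  "numerical_solution \<Gamma> q W A E g U f b u0 \<tau> n un \<longleftrightarrow>
     un 0 = q u0 \<and> (\<forall>k<n. strang_step \<Gamma> q W A E g U f b \<tau> (un k) (un (Suc k)))"

end

theory Submission
  imports Defs
begin

text \<open>Homogenizing both the exact flow and the parabolic substep with the exact solution at the beginning
  of the step, the terms that are not of order \<open>\<tau>\<^sup>3\<close> in the local error all have the form
  \<open>(E s - 1) x\<close> with \<open>0 \<le> s \<le> \<tau>\<close> and \<open>x\<close> bounded, with weights of order \<open>\<tau>\<^sup>2\<close>: the boundary correction
  cancels everything else.  The analyticity of the semigroup gives \<open>E \<sigma> (E s - 1) = O(s / \<sigma>)\<close>, so such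
  a defect, propagated over a time \<open>\<sigma> \<ge> \<tau>\<close>, is of size \<open>\<tau>\<^sup>3 / \<sigma>\<close>.  Summation over the steps yields
  \<open>\<tau>\<^sup>2 (1 + \<bar>ln \<tau>\<bar>)\<close>, and a discrete Gronwall argument absorbs the Lipschitz perturbations.  The same
  bound keeps the numerical solution in the neighbourhood of the trajectory in which \<open>f\<close> is regular,
  which in turn gives the solvability of every step.\<close>


subsection \<open>Operator-valued analytic functions\<close>

text \<open>The obstacle is order reduction. To leading order, the first half step of the reaction
  moves the boundary value from \<open>b\<close> to \<open>b + (\<tau>/2) f(b)\<close>; with fixed
  boundary data, \<open>E \<tau> - 1\<close> would act on a function of size \<open>\<tau>\<close>
  outside the domain of \<open>A0\<close>. The corrected data start at the moved value and end at
  \<open>b - (\<tau>/2) f(b)\<close>, which the second half step undoes. The function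
  \<open>u(t) + (\<tau>/2 - s) f(u(t))\<close> has exactly these boundary values, because
  \<open>f\<close> acts pointwise and \<open>b\<close> is constant in time. Relative to it,
  \<open>E \<tau>\<close> acts on a quantity of size \<open>\<tau>\<^sup>2\<close>. The next term,
  \<open>(\<tau>\<^sup>2/8) f'(u) f(u)\<close>, has no reason to vanish on the boundary, so
  \<open>E \<tau> - 1\<close> gains no power on it: plain summation of local errors would yield
  order one only, and parabolic smoothing has to recover the rest. The definition of analyticity
  contains neither bounds on \<open>S\<close> nor continuity of its derivative; the Baire and Cauchy
  arguments extract the smoothing estimate from it.\<close>

lemma uniform_boundedness_sequence:
  fixes T :: "nat \<Rightarrow> 'a::banach \<Rightarrow>\<^sub>L 'b::real_normed_vector"
  assumes "\<And>x. \<exists>k. \<forall>n. norm (T n x) \<le> k"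
  shows "\<exists>K. \<forall>n. norm (T n) \<le> K"
proof -
  \<comment> \<open>Baire's argument: the closed sets \<open>C k\<close> exhaust the space, so one
    of them contains a ball. A vector of length \<open>e\<close> is a difference of two points of
    that ball, whence the factor 2.\<close>
  define C where "C k = {x. \<forall>n. norm (T n x) \<le> real k}" for k
  have closed: "closed (C k)" for k
  proof -
    have "C k = (\<Inter>n. {x. norm (T n x) \<le> real k})" by (auto simp: C_def)
    moreover have "closed {x. norm (T n x) \<le> real k}" for n
      by (intro closed_Collect_le continuous_intros)
    ultimately show ?thesis by auto
  qed
  have "(\<Union>k. C k) = UNIV"
    by (auto simp: C_def) (meson assms order_trans real_arch_simple)
  then have "interior (\<Union>(range C)) \<noteq> {}" by simp
  moreover have "Met_TC.mcomplete TYPE('a)"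
    by (simp add: complete_UNIV)
  ultimately obtain k where "interior (C k) \<noteq> {}"
    using Met_TC.metric_Baire_category_alt[of "range C"] closed
    by (auto simp: mtopology_is_euclidean)
  then obtain x0 e where e: "0 < e" "cball x0 e \<subseteq> C k"
    by (meson ex_in_conv mem_interior_cball)
  have "norm (T n) \<le> 2 * real k / e" for n
  proof (rule norm_blinfun_bound)
    show "0 \<le> 2 * real k / e" using e by simp
    fix x
    show "norm (T n x) \<le> 2 * real k / e * norm x"
    proof (cases "x = 0")
      case False
      define y where "y = (e / norm x) *\<^sub>R x"
      have "norm y = e" using False e by (simp add: y_def)
      then have "x0 + y \<in> C k" "x0 \<in> C k" using e by (auto simp: dist_norm subset_eq)
      then have "norm (T n (x0 + y)) \<le> k" "norm (T n x0) \<le> k" by (auto simp: C_def)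
      moreover have "T n y = T n (x0 + y) - T n x0" by (simp add: blinfun.bilinear_simps)
      ultimately have "norm (T n y) \<le> 2 * k"
        using norm_triangle_ineq4[of "T n (x0 + y)" "T n x0"] by simp
      then show ?thesis using False e by (simp add: y_def blinfun.bilinear_simps field_simps)
    qed simp
  qed
  then show ?thesis by blast
qed

text \<open>Complex multiplication on the Banach space is given by \<open>j\<close>.  The integral \<open>G \<rho>\<close> of
  $e^{-i\theta}F(z_0+\rho e^{i\theta})$ over a period satisfies \<open>G' = G / \<rho>\<close>, because the angular
  derivative integrates to zero.  So \<open>G\<close> is linear in \<open>\<rho>\<close>, and its slope at \<open>0\<close> is \<open>2 * pi * D z0\<close>.\<close>

lemma vector_cauchy_estimate:
  fixes F D :: "complex \<Rightarrow> 'y::banach" and j :: "'y \<Rightarrow> 'y"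
  assumes j: "bounded_linear j" "\<And>y. j (j y) = - y" "\<And>y. norm (j y) \<le> c * norm y"
    and r: "0 < r" and "0 \<le> c"
    and der: "\<And>z. z \<in> cball z0 r \<Longrightarrow>
        (F has_derivative (\<lambda>h. Re h *\<^sub>R D z + Im h *\<^sub>R j (D z))) (at z)"
    and contD: "continuous_on (cball z0 r) D"
    and bound: "\<And>z. z \<in> cball z0 r \<Longrightarrow> norm (F z) \<le> B"
  shows "norm (D z0) \<le> (1 + c) * B / r"
proof -
  interpret j: bounded_linear j by fact
  define e where "e \<rho> \<theta> = z0 + of_real \<rho> * cis \<theta>" for \<rho> \<theta>
  \<comment> \<open>\<open>cos \<theta> - sin \<theta> * j\<close> is the rotation by minus
    \<open>\<theta>\<close>, with \<open>j\<close> in the role of i. It undoes the direction of the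
    ray, so that the radial derivative of \<open>\<Phi>\<close> is \<open>D\<close> itself.\<close>
  define \<Phi> where "\<Phi> \<rho> \<theta> = cos \<theta> *\<^sub>R F (e \<rho> \<theta>) - sin \<theta> *\<^sub>R j (F (e \<rho> \<theta>))" for \<rho> \<theta>
  define G where "G \<rho> = integral {0..2*pi} (\<Phi> \<rho>)" for \<rho>
  define P where "P \<rho> = integral {0..2*pi} (\<lambda>\<theta>. D (e \<rho> \<theta>))" for \<rho>
  have e_in: "e \<rho> \<theta> \<in> cball z0 r" if "\<rho> \<in> {0..r}" for \<rho> \<theta>
    using that by (auto simp: e_def dist_norm norm_mult)
  have e_cont [continuous_intros]: "continuous_on S (\<lambda>x. e (f x) (g x))"
    if "continuous_on S f" "continuous_on S g" for S :: "'w::topological_space set" and f g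
    unfolding e_def by (intro continuous_intros that)
  have contF: "continuous_on (cball z0 r) F"
    using der by (meson has_derivative_continuous continuous_at_imp_continuous_on)
  have cont\<Phi>: "continuous_on {0..2*pi} (\<Phi> \<rho>)" if "\<rho> \<in> {0..r}" for \<rho>
    unfolding \<Phi>_def using that e_in
    by (intro continuous_intros j.continuous_on continuous_on_compose2[OF contF]) auto
  have contD': "continuous_on {0..2*pi} (\<lambda>\<theta>. D (e \<rho> \<theta>))" if "\<rho> \<in> {0..r}" for \<rho>
    using that e_in by (intro continuous_intros continuous_on_compose2[OF contD]) auto
  have dF_\<rho>: "((\<lambda>\<rho>. F (e \<rho> \<theta>)) has_vector_derivative
      cos \<theta> *\<^sub>R D (e \<rho> \<theta>) + sin \<theta> *\<^sub>R j (D (e \<rho> \<theta>))) (at \<rho> within {0..r})"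
    if "\<rho> \<in> {0..r}" for \<rho> \<theta>
  proof -
    have "((\<lambda>\<rho>. e \<rho> \<theta>) has_derivative (\<lambda>h. of_real h * cis \<theta>)) (at \<rho> within {0..r})"
      unfolding e_def by (auto intro!: derivative_eq_intros)
    from has_derivative_compose[OF this der[OF e_in[OF that]]]
    show ?thesis
      by (simp add: has_vector_derivative_def scaleR_add_right)
  qed
  have dF_\<theta>: "((\<lambda>\<theta>. F (e \<rho> \<theta>)) has_vector_derivative
      \<rho> *\<^sub>R (- sin \<theta> *\<^sub>R D (e \<rho> \<theta>) + cos \<theta> *\<^sub>R j (D (e \<rho> \<theta>)))) (at \<theta> within S)"
    if "\<rho> \<in> {0..r}" for \<rho> \<theta> S
  proof -
    have "((\<lambda>\<theta>. e \<rho> \<theta>) has_derivative (\<lambda>h. of_real \<rho> * (of_real h * Complex (- sin \<theta>) (cos \<theta>))))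
        (at \<theta> within S)"
      unfolding e_def cis.code Complex_eq
      by (auto intro!: derivative_eq_intros simp: algebra_simps)
    from has_derivative_compose[OF this der[OF e_in[OF that]]]
    show ?thesis
      by (simp add: has_vector_derivative_def algebra_simps)
  qed
  have "((\<lambda>\<rho>. integral (cbox 0 (2*pi)) (\<Phi> \<rho>)) has_vector_derivative
          integral (cbox 0 (2*pi)) (\<lambda>\<theta>. D (e \<rho> \<theta>))) (at \<rho> within {0..r})"
    if \<rho>: "\<rho> \<in> {0..r}" for \<rho>
  proof (rule leibniz_rule_vector_derivative[where U = "{0..r}"])
    show "((\<lambda>\<rho>. \<Phi> \<rho> \<theta>) has_vector_derivative D (e \<rho>' \<theta>)) (at \<rho>' within {0..r})"
      if "\<rho>' \<in> {0..r}" for \<rho>' \<theta>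
    proof -
      have "((\<lambda>\<rho>. \<Phi> \<rho> \<theta>) has_vector_derivative
          cos \<theta> *\<^sub>R (cos \<theta> *\<^sub>R D (e \<rho>' \<theta>) + sin \<theta> *\<^sub>R j (D (e \<rho>' \<theta>)))
          - sin \<theta> *\<^sub>R j (cos \<theta> *\<^sub>R D (e \<rho>' \<theta>) + sin \<theta> *\<^sub>R j (D (e \<rho>' \<theta>)))) (at \<rho>' within {0..r})"
        unfolding \<Phi>_def
        by (intro has_vector_derivative_diff bounded_linear.has_vector_derivative[OF bounded_linear_scaleR_right]
            dF_\<rho>[OF that] j.has_vector_derivative)
      moreover have "cos \<theta> *\<^sub>R (cos \<theta> *\<^sub>R d + sin \<theta> *\<^sub>R j d)
          - sin \<theta> *\<^sub>R j (cos \<theta> *\<^sub>R d + sin \<theta> *\<^sub>R j d) = (sin \<theta> ^ 2 + cos \<theta> ^ 2) *\<^sub>R d" for d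
        unfolding scaleR_add_left
        by (simp add: j.add j.scaleR j(2) algebra_simps power2_eq_square)
      ultimately show ?thesis by simp
    qed
    show "\<Phi> \<rho>' integrable_on cbox 0 (2 * pi)" if "\<rho>' \<in> {0..r}" for \<rho>'
      using cont\<Phi>[OF that] by (simp add: integrable_continuous_real)
    show "continuous_on ({0..r} \<times> cbox 0 (2 * pi)) (\<lambda>(\<rho>, \<theta>). D (e \<rho> \<theta>))"
      unfolding split_beta using e_in
      by (intro continuous_intros continuous_on_compose2[OF contD]) auto
  qed (use \<rho> in auto)
  then have dG: "(G has_vector_derivative P \<rho>) (at \<rho> within {0..r})" if "\<rho> \<in> {0..r}" for \<rho>
    using that by (simp add: G_def[abs_def] P_def)
  have GP: "G \<rho> = \<rho> *\<^sub>R P \<rho>" if \<rho>: "\<rho> \<in> {0..r}" for \<rho>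
  proof -
    have "((\<lambda>\<theta>. \<rho> *\<^sub>R j (D (e \<rho> \<theta>)) - j (\<Phi> \<rho> \<theta>)) has_integral \<Phi> \<rho> (2*pi) - \<Phi> \<rho> 0) {0..2*pi}"
    proof (rule fundamental_theorem_of_calculus)
      fix \<theta> assume "\<theta> \<in> {0..2*pi}"
      have "(\<Phi> \<rho> has_vector_derivative
          (cos \<theta> *\<^sub>R (\<rho> *\<^sub>R (- sin \<theta> *\<^sub>R D (e \<rho> \<theta>) + cos \<theta> *\<^sub>R j (D (e \<rho> \<theta>)))) + (- sin \<theta>) *\<^sub>R F (e \<rho> \<theta>))
          - (sin \<theta> *\<^sub>R j (\<rho> *\<^sub>R (- sin \<theta> *\<^sub>R D (e \<rho> \<theta>) + cos \<theta> *\<^sub>R j (D (e \<rho> \<theta>)))) + cos \<theta> *\<^sub>R j (F (e \<rho> \<theta>))))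
          (at \<theta> within {0..2*pi})"
        unfolding \<Phi>_def
        by (intro has_vector_derivative_diff has_vector_derivative_scaleR dF_\<theta>[OF \<rho>] j.has_vector_derivative)
          (auto intro!: derivative_eq_intros)
      moreover have "(cos \<theta> *\<^sub>R (\<rho> *\<^sub>R (- sin \<theta> *\<^sub>R d + cos \<theta> *\<^sub>R j d)) + (- sin \<theta>) *\<^sub>R x)
          - (sin \<theta> *\<^sub>R j (\<rho> *\<^sub>R (- sin \<theta> *\<^sub>R d + cos \<theta> *\<^sub>R j d)) + cos \<theta> *\<^sub>R j x)
          = ((sin \<theta> ^ 2 + cos \<theta> ^ 2) * \<rho>) *\<^sub>R j d - j (cos \<theta> *\<^sub>R x - sin \<theta> *\<^sub>R j x)" for d x
        unfolding distrib_right scaleR_add_left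
        by (simp add: j.add j.scaleR j.neg j.diff j(2) algebra_simps power2_eq_square)
      ultimately show "(\<Phi> \<rho> has_vector_derivative \<rho> *\<^sub>R j (D (e \<rho> \<theta>)) - j (\<Phi> \<rho> \<theta>))
          (at \<theta> within {0..2*pi})"
        by (simp add: \<Phi>_def)
    qed simp
    moreover have "\<Phi> \<rho> (2*pi) - \<Phi> \<rho> 0 = 0" by (simp add: \<Phi>_def e_def)
    moreover have "((\<lambda>\<theta>. \<rho> *\<^sub>R j (D (e \<rho> \<theta>)) - j (\<Phi> \<rho> \<theta>)) has_integral \<rho> *\<^sub>R j (P \<rho>) - j (G \<rho>)) {0..2*pi}"
      unfolding P_def G_def
      using cont\<Phi>[OF \<rho>] contD'[OF \<rho>]
      by (intro has_integral_diff has_integral_cmul has_integral_linear[OF _ j(1), unfolded o_def]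
          integrable_integral integrable_continuous_real)
    ultimately have "\<rho> *\<^sub>R j (P \<rho>) - j (G \<rho>) = 0" by (metis has_integral_unique)
    then have "j (j (\<rho> *\<^sub>R P \<rho> - G \<rho>)) = 0" by (simp add: j.diff j.scaleR j.zero)
    then show ?thesis by (simp add: j(2))
  qed
  define y where "y = (1 / r) *\<^sub>R G r"
  obtain k where "\<And>\<rho>. \<rho> \<in> {0<..r} \<Longrightarrow> (1 / \<rho>) *\<^sub>R G \<rho> = k"
  proof (rule has_vector_derivative_zero_constant)
    fix \<rho> assume \<rho>: "\<rho> \<in> {0<..r}"
    have "(G has_vector_derivative P \<rho>) (at \<rho> within {0<..r})"
      using \<rho> by (intro has_vector_derivative_within_subset[OF dG]) auto
    then have "((\<lambda>\<rho>. (1 / \<rho>) *\<^sub>R G \<rho>) has_vector_derivative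
        (1 / \<rho>) *\<^sub>R P \<rho> + (- 1 / \<rho>\<^sup>2) *\<^sub>R G \<rho>) (at \<rho> within {0<..r})"
      using \<rho> by (intro has_vector_derivative_scaleR)
        (auto intro!: derivative_eq_intros simp: power2_eq_square)
    then show "((\<lambda>\<rho>. (1 / \<rho>) *\<^sub>R G \<rho>) has_vector_derivative 0) (at \<rho> within {0<..r})"
      using \<rho> by (simp add: GP power2_eq_square)
  qed auto
  then have const: "(1 / \<rho>) *\<^sub>R G \<rho> = y" if "\<rho> \<in> {0<..r}" for \<rho>
    using that r unfolding y_def by (metis greaterThanAtMost_iff order_refl)
  have G: "G \<rho> = \<rho> *\<^sub>R y" if "\<rho> \<in> {0..r}" for \<rho>
    using const[of \<rho>] GP[of \<rho>] that by (cases "\<rho> = 0") auto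
  \<comment> \<open>The slope of \<open>G\<close> at the centre is computed twice: linearity gives
    \<open>y\<close>, and \<open>dG\<close> gives \<open>P 0\<close>, the integral of the constant
    \<open>D z0\<close>.\<close>
  have "((\<lambda>\<rho>. \<rho> *\<^sub>R y) has_vector_derivative y) (at 0 within {0..r})"
    by (auto intro!: derivative_eq_intros)
  then have "(G has_vector_derivative y) (at 0 within {0..r})"
    by (rule has_vector_derivative_transform[rotated 2]) (use r G in auto)
  then have "P 0 = y"
    using dG[of 0] r vector_derivative_unique_within[of 0 "{0..r}"]
    by (simp add: trivial_limit_within islimpt_Icc)
  moreover have "norm (P 0) = 2 * pi * norm (D z0)" by (simp add: P_def e_def)
  \<comment> \<open>The norm need not be invariant under rotations, so the cosine and sine parts are
    bounded separately; this is the origin of \<open>1 + c\<close>.\<close>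
  moreover have "norm (G r) \<le> ((1 + c) * B) * (2 * pi - 0)"
    unfolding G_def
  proof (rule integral_bound)
    show "continuous_on {0..2 * pi} (\<Phi> r)" using cont\<Phi>[of r] r by simp
    fix \<theta>
    let ?x = "F (e r \<theta>)"
    have "norm (\<Phi> r \<theta>) \<le> \<bar>cos \<theta>\<bar> * norm ?x + \<bar>sin \<theta>\<bar> * norm (j ?x)"
      unfolding \<Phi>_def by (rule order_trans[OF norm_triangle_ineq4]) simp
    also have "\<dots> \<le> 1 * norm ?x + 1 * (c * norm ?x)"
      by (intro add_mono mult_mono j) auto
    also have "\<dots> = (1 + c) * norm ?x" by (simp add: algebra_simps)
    also have "\<dots> \<le> (1 + c) * B"
      using bound[OF e_in[of r \<theta>]] r \<open>0 \<le> c\<close> by (intro mult_left_mono) auto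
    finally show "norm (\<Phi> r \<theta>) \<le> (1 + c) * B" .
  qed simp
  moreover have "norm (G r) = r * norm (P 0)"
    using r \<open>P 0 = y\<close> by (simp add: y_def)
  ultimately have "(2 * pi) * (r * norm (D z0)) \<le> (2 * pi) * ((1 + c) * B)"
    by (simp add: algebra_simps)
  then have "r * norm (D z0) \<le> (1 + c) * B"
    by (simp only: mult_le_cancel_left_pos pi_gt_zero zero_less_mult_iff zero_less_numeral simp_thms)
  then show ?thesis using r by (simp add: field_simps)
qed


subsection \<open>Analytic semigroups and variation of constants\<close>

text \<open>\<open>Arg\<close> is continuous off the nonpositive real axis. On the negative axis it
  equals pi, so the bound on \<open>\<delta>\<close> keeps the sector away from the
  discontinuity.\<close>

lemma open_complex_sector:
  assumes "\<delta> \<le> pi"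
  shows "open (complex_sector \<delta>)"
proof -
  have "complex_sector \<delta> = (- \<real>\<^sub>\<le>\<^sub>0) \<inter> (\<lambda>z. \<bar>Arg z\<bar>) -` {..<\<delta>}"
  proof (intro set_eqI iffI)
    fix z assume z: "z \<in> complex_sector \<delta>"
    have "z \<notin> \<real>\<^sub>\<le>\<^sub>0"
    proof
      assume "z \<in> \<real>\<^sub>\<le>\<^sub>0"
      then obtain r where "z = of_real r" "r \<le> 0" by (auto elim: nonpos_Reals_cases)
      with z assms show False by (auto simp: complex_sector_def)
    qed
    with z show "z \<in> (- \<real>\<^sub>\<le>\<^sub>0) \<inter> (\<lambda>z. \<bar>Arg z\<bar>) -` {..<\<delta>}" by (auto simp: complex_sector_def)
  next
    fix z assume "z \<in> (- \<real>\<^sub>\<le>\<^sub>0) \<inter> (\<lambda>z. \<bar>Arg z\<bar>) -` {..<\<delta>}"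
    then show "z \<in> complex_sector \<delta>" by (auto simp: complex_sector_def)
  qed
  moreover have "open ((- \<real>\<^sub>\<le>\<^sub>0) \<inter> (\<lambda>z. \<bar>Arg z\<bar>) -` {..<\<delta>})"
    by (intro continuous_open_preimage continuous_intros)
      (auto simp: closed_nonpos_Reals_complex open_Compl)
  ultimately show ?thesis by simp
qed

lemma complex_sector_scale:
  "0 < r \<Longrightarrow> of_real r * z \<in> complex_sector \<delta> \<longleftrightarrow> z \<in> complex_sector \<delta>"
  by (simp add: complex_sector_def)

lemma complex_sector_of_real: "0 < \<delta> \<Longrightarrow> 0 < t \<Longrightarrow> complex_of_real t \<in> complex_sector \<delta>"
  by (simp add: complex_sector_def)

lemma complex_sector_mono: "\<delta>' \<le> \<delta> \<Longrightarrow> complex_sector \<delta>' \<subseteq> complex_sector \<delta>"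
  by (auto simp: complex_sector_def)

text \<open>Only strong convergence at 0 is given. Were \<open>S\<close> unbounded near 0 in the
  smaller sector, a sequence tending to 0 would contradict uniform boundedness; the semigroup law
  then carries the bound to any radius.\<close>

lemma analytic_semigroup_bounded:
  fixes S :: "complex \<Rightarrow> ('x::banach \<times> 'x) \<Rightarrow>\<^sub>L ('x \<times> 'x)"
  assumes S: "analytic_semigroup \<delta> S" and \<delta>': "0 < \<delta>'" "\<delta>' < \<delta>"
  shows "\<exists>M. \<forall>z\<in>complex_sector \<delta>'. norm z \<le> R \<longrightarrow> norm (S z) \<le> M"
proof -
  have "\<exists>\<epsilon>>0. \<exists>M. \<forall>z\<in>complex_sector \<delta>'. norm z \<le> \<epsilon> \<longrightarrow> norm (S z) \<le> M"
  proof (rule ccontr)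
    assume neg: "\<not> ?thesis"
    have "\<exists>z\<in>complex_sector \<delta>'. norm z \<le> 1 / real (Suc n) \<and> norm (S z) > real n" for n
    proof (rule ccontr)
      assume "\<not> (\<exists>z\<in>complex_sector \<delta>'. norm z \<le> 1 / real (Suc n) \<and> norm (S z) > real n)"
      then have "\<forall>z\<in>complex_sector \<delta>'. norm z \<le> 1 / real (Suc n) \<longrightarrow> norm (S z) \<le> real n"
        by force
      moreover have "0 < 1 / real (Suc n)" by simp
      ultimately show False using neg by blast
    qed
    then obtain z where z: "\<And>n. z n \<in> complex_sector \<delta>'" "\<And>n. norm (z n) \<le> 1 / real (Suc n)"
      "\<And>n. norm (S (z n)) > real n"
      by metis
    have "z \<longlonglongrightarrow> 0"
      by (rule Lim_null_comparison[OF always_eventually LIMSEQ_Suc[OF lim_inverse_n']])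
        (use z in simp)
    then have lim: "filterlim z (at 0 within complex_sector \<delta>') sequentially"
      using z(1) by (auto simp: filterlim_at complex_sector_def intro!: always_eventually)
    have "\<exists>k. \<forall>n. norm (S (z n) p) \<le> k" for p
    proof -
      have "((\<lambda>z. S z p) \<longlongrightarrow> p) (at 0 within complex_sector \<delta>')"
        using S \<delta>' unfolding analytic_semigroup_def by blast
      then have "(\<lambda>n. S (z n) p) \<longlonglongrightarrow> p"
        by (rule filterlim_compose[OF _ lim])
      then show ?thesis
        by (metis Bseq_def convergentI convergent_imp_Bseq)
    qed
    then obtain K where K: "\<And>n. norm (S (z n)) \<le> K"
      using uniform_boundedness_sequence[of "\<lambda>n. S (z n)"] by blast
    obtain n where "K < real n" using reals_Archimedean2 by blast
    with K[of n] z(3)[of n] show False by simp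
  qed
  then obtain \<epsilon> M where \<epsilon>: "0 < \<epsilon>" and M: "\<And>z. z \<in> complex_sector \<delta>' \<Longrightarrow> norm z \<le> \<epsilon> \<Longrightarrow> norm (S z) \<le> M"
    by blast
  \<comment> \<open>Halving the argument stays in the sector, so doubling the radius squares the
    bound.\<close>
  have grow: "\<exists>M. \<forall>z\<in>complex_sector \<delta>'. norm z \<le> \<epsilon> * 2 ^ k \<longrightarrow> norm (S z) \<le> M" for k
  proof (induction k)
    case 0
    show ?case using M by auto
  next
    case (Suc k)
    then obtain M where M: "\<And>z. z \<in> complex_sector \<delta>' \<Longrightarrow> norm z \<le> \<epsilon> * 2 ^ k \<Longrightarrow> norm (S z) \<le> M"
      by blast
    have "norm (S z) \<le> M * M" if z: "z \<in> complex_sector \<delta>'" "norm z \<le> \<epsilon> * 2 ^ Suc k" for z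
    proof -
      have half: "z / 2 \<in> complex_sector \<delta>'"
        using z complex_sector_scale[of "1/2" z \<delta>'] by simp
      then have "z / 2 \<in> complex_sector \<delta>" using complex_sector_mono[of \<delta>' \<delta>] \<delta>' by auto
      then have "S (z / 2 + z / 2) = S (z / 2) o\<^sub>L S (z / 2)"
        using S unfolding analytic_semigroup_def by blast
      then have "norm (S z) \<le> norm (S (z / 2)) * norm (S (z / 2))"
        using norm_blinfun_compose[of "S (z / 2)" "S (z / 2)"] by simp
      also have "norm (S (z / 2)) \<le> M"
        using z by (intro M half) (simp add: norm_divide)
      then have "norm (S (z / 2)) * norm (S (z / 2)) \<le> M * M"
        by (intro mult_mono) (auto intro: order_trans[OF norm_ge_zero])
      finally show ?thesis .
    qed
    then show ?case by blast
  qed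
  obtain k where "R / \<epsilon> < 2 ^ k" using real_arch_pow[of 2] by auto
  then have "R \<le> \<epsilon> * 2 ^ k" using \<epsilon> by (simp add: field_simps)
  with grow[of k] show ?thesis by (meson order_trans)
qed

text \<open>Cauchy's estimate on a disc around \<open>t\<close> whose radius is proportional to
  \<open>t\<close>: the values of \<open>S\<close> there are uniformly bounded, and the radius in
  the denominator produces \<open>K / t\<close>.\<close>

lemma analytic_semigroup_derivative_bound:
  fixes S :: "complex \<Rightarrow> ('x::banach \<times> 'x) \<Rightarrow>\<^sub>L ('x \<times> 'x)"
  assumes S: "analytic_semigroup \<delta> S"
  obtains D K where
    "\<And>z. z \<in> complex_sector \<delta> \<Longrightarrow>
        (S has_derivative (\<lambda>h. Re h *\<^sub>R D z + Im h *\<^sub>R (mult_i o\<^sub>L D z))) (at z)"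
    "\<And>t. 0 < t \<Longrightarrow> t \<le> R \<Longrightarrow> norm (D (of_real t)) \<le> K / t"
proof -
  have \<delta>: "0 < \<delta>" "\<delta> \<le> pi / 2" using S by (simp_all add: analytic_semigroup_def)
  have semi: "S (z + w) = S z o\<^sub>L S w" if "z \<in> complex_sector \<delta>" "w \<in> complex_sector \<delta>" for z w
    using S that unfolding analytic_semigroup_def by blast
  have "\<forall>z \<in> complex_sector \<delta>. \<exists>D.
        (S has_derivative (\<lambda>h. Re h *\<^sub>R D + Im h *\<^sub>R (mult_i o\<^sub>L D))) (at z)"
    using S unfolding analytic_semigroup_def by blast
  from bchoice[OF this] obtain D where D: "\<And>z. z \<in> complex_sector \<delta> \<Longrightarrow>
        (S has_derivative (\<lambda>h. Re h *\<^sub>R D z + Im h *\<^sub>R (mult_i o\<^sub>L D z))) (at z)"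
    by blast
  have sector_open: "open (complex_sector \<delta>)" "open (complex_sector (\<delta> / 2))"
    using \<delta> by (auto intro!: open_complex_sector)
  \<comment> \<open>The semigroup law is differentiated in its first argument; uniqueness of
    derivatives, evaluated at the increment 1, identifies the operators.\<close>
  have D_shift: "D (w + v) = D w o\<^sub>L S v"
    if w: "w \<in> complex_sector \<delta>" and v: "v \<in> complex_sector \<delta>" and wv: "w + v \<in> complex_sector \<delta>" for w v
  proof -
    have "((\<lambda>\<zeta>. S (\<zeta> + v)) has_derivative (\<lambda>h. Re h *\<^sub>R D (w + v) + Im h *\<^sub>R (mult_i o\<^sub>L D (w + v)))) (at w)"
      by (rule has_derivative_compose[of "\<lambda>\<zeta>. \<zeta> + v" "\<lambda>h. h", OF _ D[OF wv]])
        (auto intro!: derivative_eq_intros)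
    moreover have "((\<lambda>\<zeta>. S (\<zeta> + v)) has_derivative
        (\<lambda>h. (Re h *\<^sub>R D w + Im h *\<^sub>R (mult_i o\<^sub>L D w)) o\<^sub>L S v)) (at w)"
    proof (rule has_derivative_transform_within_open[OF _ sector_open(1) w])
      show "((\<lambda>\<zeta>. S \<zeta> o\<^sub>L S v) has_derivative
          (\<lambda>h. (Re h *\<^sub>R D w + Im h *\<^sub>R (mult_i o\<^sub>L D w)) o\<^sub>L S v)) (at w)"
        by (rule bounded_linear.has_derivative[OF bounded_bilinear.bounded_linear_left
              [OF bounded_bilinear_blinfun_compose] D[OF w]])
    qed (simp add: semi v)
    ultimately have "(\<lambda>h. Re h *\<^sub>R D (w + v) + Im h *\<^sub>R (mult_i o\<^sub>L D (w + v)))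
        = (\<lambda>h. (Re h *\<^sub>R D w + Im h *\<^sub>R (mult_i o\<^sub>L D w)) o\<^sub>L S v)"
      by (rule has_derivative_unique)
    from fun_cong[OF this, of 1] show ?thesis by simp
  qed
  \<comment> \<open>Complex differentiability is assumed without a continuous derivative. Writing
    \<open>\<zeta>\<close> as the fixed point \<open>z / 2\<close> plus a remainder moves the
    dependence on \<open>\<zeta>\<close> from \<open>D\<close> to the continuous
    \<open>S\<close>.\<close>
  have D_cont: "isCont D z" if z: "z \<in> complex_sector \<delta>" for z
  proof -
    have half: "z / 2 \<in> complex_sector \<delta>"
      using z complex_sector_scale[of "1/2" z \<delta>] by simp
    let ?N = "complex_sector \<delta> \<inter> (\<lambda>\<zeta>. \<zeta> - z / 2) -` complex_sector \<delta>"
    have "open ?N"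
      by (intro open_Int sector_open continuous_open_vimage continuous_intros)
    moreover have "z \<in> ?N" using z half by simp
    ultimately have "\<forall>\<^sub>F \<zeta> in nhds z. D \<zeta> = D (z / 2) o\<^sub>L S (\<zeta> - z / 2)"
      by (rule eventually_mono[OF eventually_nhds_in_open]) (use D_shift[OF half] in force)
    moreover have "isCont (\<lambda>\<zeta>. D (z / 2) o\<^sub>L S (\<zeta> - z / 2)) z"
    proof -
      have "isCont S (z - z / 2)" using has_derivative_continuous[OF D[OF half]] by simp
      moreover have "isCont (\<lambda>\<zeta>. \<zeta> - z / 2) z" by (intro continuous_intros)
      ultimately have "isCont (\<lambda>\<zeta>. S (\<zeta> - z / 2)) z" by (rule isCont_o2[rotated])
      then show ?thesis
        by (rule bounded_linear.isCont[OF bounded_bilinear.bounded_linear_right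
              [OF bounded_bilinear_blinfun_compose]])
    qed
    ultimately show ?thesis by (simp only: isCont_cong)
  qed
  \<comment> \<open>One disc around 1, scaled by \<open>t\<close>, serves every \<open>t\<close>.
    The bound \<open>\<kappa> \<le> 1\<close> keeps the scaled disc within norm
    \<open>2 * t\<close>, whence the radius \<open>2 * R\<close> in the choice of
    \<open>B\<close>.\<close>
  obtain \<kappa> where \<kappa>: "0 < \<kappa>" "\<kappa> \<le> 1" "cball 1 \<kappa> \<subseteq> complex_sector (\<delta> / 2)"
  proof -
    have "1 \<in> complex_sector (\<delta> / 2)" using \<delta> by (simp add: complex_sector_def)
    then obtain e where "0 < e" "cball 1 e \<subseteq> complex_sector (\<delta> / 2)"
      using sector_open(2) open_contains_cball by metis
    then show thesis by (intro that[of "min e 1"]) auto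
  qed
  obtain B where B: "\<And>z. z \<in> complex_sector (\<delta> / 2) \<Longrightarrow> norm z \<le> 2 * R \<Longrightarrow> norm (S z) \<le> B"
    using analytic_semigroup_bounded[OF S, of "\<delta> / 2" "2 * R"] \<delta> by auto
  define c where "c = norm (mult_i :: ('x \<times> 'x) \<Rightarrow>\<^sub>L ('x \<times> 'x))"
  have "norm (D (of_real t)) \<le> ((1 + c) * B / \<kappa>) / t" if t: "0 < t" "t \<le> R" for t
  proof -
    have ball: "z \<in> complex_sector (\<delta> / 2)" "norm z \<le> 2 * R" if z: "z \<in> cball (of_real t) (\<kappa> * t)" for z
    proof -
      have "norm (z / of_real t - 1) \<le> \<kappa>"
      proof -
        have "z / of_real t - 1 = (z - of_real t) / of_real t" using t by (simp add: diff_divide_distrib)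
        then show ?thesis
          using z t by (simp add: dist_norm norm_minus_commute norm_divide pos_divide_le_eq)
      qed
      then have "z / of_real t \<in> complex_sector (\<delta> / 2)" using \<kappa>(3)
        by (auto simp: dist_norm norm_minus_commute)
      then show "z \<in> complex_sector (\<delta> / 2)"
        using complex_sector_scale[of t "z / of_real t"] t by simp
      have "norm z \<le> norm (of_real t :: complex) + \<kappa> * t"
        using z norm_triangle_sub[of z "of_real t"] by (simp add: dist_norm norm_minus_commute)
      also have "\<dots> \<le> t + 1 * t" using t \<kappa> by (intro add_mono mult_right_mono) auto
      finally show "norm z \<le> 2 * R" using t by simp
    qed
    then have ball': "z \<in> complex_sector \<delta>" if "z \<in> cball (of_real t) (\<kappa> * t)" for z
      using that complex_sector_mono[of "\<delta>/2" \<delta>] \<delta> by auto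
    have "norm (D (of_real t)) \<le> (1 + c) * B / (\<kappa> * t)"
    proof (rule vector_cauchy_estimate[where F = S and j = "\<lambda>y. mult_i o\<^sub>L y"])
      show "bounded_linear (\<lambda>y. mult_i o\<^sub>L y :: ('x \<times> 'x) \<Rightarrow>\<^sub>L ('x \<times> 'x))"
        by (rule bounded_bilinear.bounded_linear_right[OF bounded_bilinear_blinfun_compose])
      show "mult_i o\<^sub>L (mult_i o\<^sub>L y) = - y" for y :: "('x \<times> 'x) \<Rightarrow>\<^sub>L ('x \<times> 'x)"
        by (rule blinfun_eqI) (simp add: mult_i.rep_eq blinfun.minus_left prod_eq_iff)
      show "norm (mult_i o\<^sub>L y) \<le> c * norm y" for y :: "('x \<times> 'x) \<Rightarrow>\<^sub>L ('x \<times> 'x)"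
        unfolding c_def by (rule norm_blinfun_compose)
      show "continuous_on (cball (of_real t) (\<kappa> * t)) D"
        using D_cont ball' by (intro continuous_at_imp_continuous_on) auto
    qed (use t \<kappa> ball ball' D B in \<open>auto simp: c_def\<close>)
    then show ?thesis by simp
  qed
  with D show thesis by (rule that)
qed

section \<open>Smoothing in real time and the variation of constants formula\<close>

locale smoothing_semigroup =
  fixes E E' :: "real \<Rightarrow> 'x::banach \<Rightarrow>\<^sub>L 'x" and T M :: real
  assumes T_pos: "0 < T" and M_ge_1: "1 \<le> M"
    and E_0: "E 0 = id_blinfun"
    and E_add: "0 \<le> s \<Longrightarrow> 0 \<le> t \<Longrightarrow> E (s + t) = E s o\<^sub>L E t"
    and E_bound: "0 \<le> t \<Longrightarrow> t \<le> T \<Longrightarrow> norm (E t) \<le> M"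
    and E_deriv: "0 < t \<Longrightarrow> (E has_vector_derivative E' t) (at t)"
    and E'_bound: "0 < t \<Longrightarrow> t \<le> T \<Longrightarrow> norm (E' t) \<le> M / t"
    and E_lim: "((\<lambda>t. E t x) \<longlongrightarrow> x) (at_right 0)"
begin

lemma E_apply_bound: "0 \<le> t \<Longrightarrow> t \<le> T \<Longrightarrow> norm (E t x) \<le> M * norm x"
  by (rule order_trans[OF norm_blinfun mult_right_mono[OF E_bound]]) auto

text \<open>The derivative bound decreases in time, so its value at the left end point controls the
  whole interval.\<close>

lemma E_difference_bound:
  assumes "0 < t" "0 \<le> s" "t + s \<le> T"
  shows "norm (E (t + s) - E t) \<le> M * s / t"
proof (cases "s = 0")
  case False
  have "norm (E (t + s) - E t) \<le> M / t * (t + s) - M / t * t"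
  proof (rule differentiable_bound_general)
    have "continuous (at \<sigma> within {t..t + s}) E" if "\<sigma> \<in> {t..t + s}" for \<sigma>
      using has_vector_derivative_continuous[OF E_deriv] that \<open>0 < t\<close>
      by (auto intro: continuous_at_imp_continuous_within)
    then show "continuous_on {t..t + s} E" by (simp add: continuous_on_eq_continuous_within)
    show "norm (E' \<sigma>) \<le> M / t" if "t < \<sigma>" "\<sigma> < t + s" for \<sigma>
    proof -
      have "norm (E' \<sigma>) \<le> M / \<sigma>" using assms that by (intro E'_bound) auto
      also have "\<dots> \<le> M / t" using that assms M_ge_1 by (intro divide_left_mono) auto
      finally show ?thesis .
    qed
    show "(E has_vector_derivative E' \<sigma>) (at \<sigma>)" if "t < \<sigma>" "\<sigma> < t + s" for \<sigma>
      using that assms by (intro E_deriv) auto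
  qed (use False assms in \<open>auto intro!: continuous_intros derivative_eq_intros\<close>)
  also have "M / t * (t + s) - M / t * t = M * s / t" using assms by (simp add: field_simps)
  finally show ?thesis .
qed simp

text \<open>Nothing is asked of \<open>x\<close>, neither regularity nor boundary values: a full
  power of \<open>s\<close> is gained at the price of \<open>1 / t\<close>.\<close>

lemma E_smoothing:
  assumes "0 < t" "0 \<le> s" "t + s \<le> T"
  shows "norm (E t (E s x - x)) \<le> M * s / t * norm x"
proof -
  have "E t (E s x - x) = (E (t + s) - E t) x"
    using assms E_add[of t s] by (simp add: blinfun.bilinear_simps)
  then show ?thesis
    using order_trans[OF norm_blinfun mult_right_mono[OF E_difference_bound[OF assms]]] by simp
qed

lemma continuous_on_E: "continuous_on {0..} (\<lambda>t. E t x)"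
  unfolding continuous_on_eq_continuous_within
proof
  fix t :: real assume t: "t \<in> {0..}"
  show "continuous (at t within {0..}) (\<lambda>t. E t x)"
  proof (cases "t = 0")
    case True
    have "at (0::real) within {0..} = at_right 0" by (rule at_within_Ici_at_right)
    then show ?thesis using True E_lim[of x] by (simp add: continuous_within E_0)
  next
    case False
    with t have "isCont E t" using has_vector_derivative_continuous[OF E_deriv[of t]] by simp
    then have "isCont (\<lambda>t. E t x) t" by (intro continuous_intros)
    then show ?thesis by (rule continuous_at_imp_continuous_within)
  qed
qed

text \<open>At the end point \<open>h\<close> the semigroup is only strongly continuous. The
  increment of \<open>p\<close> is therefore split off and controlled by the uniform bound, which
  leaves \<open>E\<close> acting on a fixed vector.\<close>

lemma continuous_on_E_apply:
  assumes h: "h \<le> T" and p: "continuous_on {0..h} p"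
  shows "continuous_on {0..h} (\<lambda>s. E (h - s) (p s))"
  unfolding continuous_on_def
proof
  fix s assume s: "s \<in> {0..h}"
  let ?F = "at s within {0..h}"
  have "((\<lambda>\<sigma>. E (h - \<sigma>) (p \<sigma> - p s)) \<longlongrightarrow> 0) ?F"
  proof (rule Lim_null_comparison)
    show "\<forall>\<^sub>F \<sigma> in ?F. norm (E (h - \<sigma>) (p \<sigma> - p s)) \<le> M * norm (p \<sigma> - p s)"
      using h by (auto simp: eventually_at_filter intro!: E_apply_bound always_eventually)
    have "((\<lambda>\<sigma>. p \<sigma> - p s) \<longlongrightarrow> 0) ?F"
      using p s by (simp add: continuous_on_def LIM_zero)
    then show "((\<lambda>\<sigma>. M * norm (p \<sigma> - p s)) \<longlongrightarrow> 0) ?F"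
      by (intro tendsto_mult_right_zero tendsto_norm_zero)
  qed
  moreover have "continuous_on {0..h} (\<lambda>\<sigma>. E (h - \<sigma>) (p s))"
    by (rule continuous_on_compose2[OF continuous_on_E]) (auto intro!: continuous_intros)
  then have "((\<lambda>\<sigma>. E (h - \<sigma>) (p s)) \<longlongrightarrow> E (h - s) (p s)) ?F"
    using s by (simp add: continuous_on_def)
  ultimately have "((\<lambda>\<sigma>. E (h - \<sigma>) (p \<sigma> - p s) + E (h - \<sigma>) (p s)) \<longlongrightarrow> 0 + E (h - s) (p s)) ?F"
    by (rule tendsto_add)
  then show "((\<lambda>\<sigma>. E (h - \<sigma>) (p \<sigma>)) \<longlongrightarrow> E (h - s) (p s)) ?F"
    by (simp add: blinfun.bilinear_simps)
qed

lemma integrable_E_apply: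
  assumes "h \<le> T" "continuous_on {0..h} p"
  shows "(\<lambda>s. E (h - s) (p s)) integrable_on {0..h}"
  using assms by (intro integrable_continuous_real continuous_on_E_apply)

text \<open>In the derivative of \<open>E (h - s) (p s)\<close> the term with \<open>E'\<close>
  cancels against \<open>a\<close>. The premise \<open>gen\<close> expresses that \<open>a s\<close>
  is \<open>A0 (p s)\<close>. Only interior differentiability is available, because \<open>E\<close>
  need not be differentiable at 0.\<close>

lemma variation_of_constants:
  assumes h: "0 \<le> h" "h \<le> T"
    and p: "\<And>s. s \<in> {0..h} \<Longrightarrow> (p has_vector_derivative a s + \<phi> s) (at s within {0..h})"
    and gen: "\<And>s t. s \<in> {0..h} \<Longrightarrow> 0 < t \<Longrightarrow> E' t (p s) = E t (a s)"
  shows "((\<lambda>s. E (h - s) (\<phi> s)) has_integral p h - E h (p 0)) {0..h}"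
proof -
  have "((\<lambda>s. E (h - s) (\<phi> s)) has_integral E (h - h) (p h) - E (h - 0) (p 0)) {0..h}"
  proof (rule fundamental_theorem_of_calculus_interior)
    have "continuous_on {0..h} p"
      unfolding continuous_on_eq_continuous_within using has_vector_derivative_continuous[OF p] by blast
    then show "continuous_on {0..h} (\<lambda>s. E (h - s) (p s))"
      using h by (intro continuous_on_E_apply)
    fix s assume s: "s \<in> {0<..<h}"
    have "(p has_vector_derivative a s + \<phi> s) (at s within {0..h})" using p s by simp
    then have "(p has_vector_derivative a s + \<phi> s) (at s)"
      using s by (simp add: at_within_Icc_at)
    moreover have "((\<lambda>s. E (h - s)) has_vector_derivative (-1) *\<^sub>R E' (h - s)) (at s)"
    proof -
      have "((\<lambda>s. h - s) has_vector_derivative -1) (at s)" by (auto intro!: derivative_eq_intros)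
      from vector_diff_chain_at[OF this E_deriv[of "h - s"]] s show ?thesis by (simp add: o_def)
    qed
    ultimately have "((\<lambda>s. E (h - s) (p s)) has_vector_derivative
        E (h - s) (a s + \<phi> s) + ((-1) *\<^sub>R E' (h - s)) (p s)) (at s)"
      by (intro blinfun.has_vector_derivative)
    then show "((\<lambda>s. E (h - s) (p s)) has_vector_derivative E (h - s) (\<phi> s)) (at s)"
      using gen[of s "h - s"] s by (simp add: blinfun.bilinear_simps)
  qed (use h in simp)
  then show ?thesis by (simp add: E_0)
qed

end

text \<open>On the positive axis the complex semigroup acts componentwise as \<open>E\<close>, so
  restriction to real vectors followed by projection turns the bounds for \<open>S\<close> and its
  derivative into bounds for \<open>E\<close> and \<open>E'\<close>.\<close>

lemma generates_analytic_semigroup_smoothing: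
  assumes gen: "generates_analytic_semigroup D0 A0 (E :: real \<Rightarrow> 'x::banach \<Rightarrow>\<^sub>L 'x)" and T: "0 < T"
  obtains E' M where "smoothing_semigroup E E' T M"
    "\<And>x t. x \<in> D0 \<Longrightarrow> 0 < t \<Longrightarrow> E' t x = E t (A0 x)"
proof -
  obtain \<delta> and S :: "complex \<Rightarrow> ('x \<times> 'x) \<Rightarrow>\<^sub>L ('x \<times> 'x)" where S: "analytic_semigroup \<delta> S"
    and SE: "\<And>t x y. 0 \<le> t \<Longrightarrow> S (of_real t) (x, y) = (E t x, E t y)"
    using gen unfolding generates_analytic_semigroup_def by blast
  have \<delta>: "0 < \<delta>" using S by (simp add: analytic_semigroup_def)
  note sector [intro] = complex_sector_of_real[OF \<delta>]
  obtain D K where D: "\<And>z. z \<in> complex_sector \<delta> \<Longrightarrow>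
        (S has_derivative (\<lambda>h. Re h *\<^sub>R D z + Im h *\<^sub>R (mult_i o\<^sub>L D z))) (at z)"
    and K: "\<And>t. 0 < t \<Longrightarrow> t \<le> T \<Longrightarrow> norm (D (of_real t)) \<le> K / t"
    using analytic_semigroup_derivative_bound[OF S] by blast
  obtain B where B: "\<And>z. z \<in> complex_sector (\<delta> / 2) \<Longrightarrow> norm z \<le> T \<Longrightarrow> norm (S z) \<le> B"
    using analytic_semigroup_bounded[OF S, of "\<delta> / 2" T] \<delta> by auto
  define \<iota> :: "'x \<Rightarrow>\<^sub>L ('x \<times> 'x)" where "\<iota> = Blinfun (\<lambda>x. (x, 0))"
  have \<iota>: "\<iota> x = (x, 0)" for x
    unfolding \<iota>_def by (subst bounded_linear_Blinfun_apply) (auto intro!: bounded_linear_Pair bounded_linear_ident bounded_linear_zero)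
  define Q where "Q Y = fst_blinfun o\<^sub>L (Y o\<^sub>L \<iota>)" for Y :: "('x \<times> 'x) \<Rightarrow>\<^sub>L ('x \<times> 'x)"
  have Q_linear: "bounded_linear Q"
    unfolding Q_def
    by (intro bounded_linear_compose[OF bounded_bilinear.bounded_linear_right[OF bounded_bilinear_blinfun_compose]
        bounded_bilinear.bounded_linear_left[OF bounded_bilinear_blinfun_compose]])
  obtain k where k: "0 < k" "\<And>Y. norm (Q Y) \<le> norm Y * k"
    using bounded_linear.pos_bounded[OF Q_linear] by blast
  have Q_S: "Q (S (of_real t)) = E t" if "0 \<le> t" for t
    using that by (intro blinfun_eqI) (simp add: Q_def \<iota> SE)
  define E' where "E' t = Q (D (of_real t))" for t
  \<comment> \<open>\<open>norm (E 0)\<close> is listed separately because no sector contains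
    0.\<close>
  define M where "M = max 1 (max (norm (E 0)) (max (B * k) (K * k)))"
  have E_deriv: "(E has_vector_derivative E' t) (at t)" if t: "0 < t" for t
  proof -
    have "(complex_of_real has_derivative of_real) (at t)" by (auto intro!: derivative_eq_intros)
    from has_derivative_compose[OF this D[OF sector[OF t]]]
    have "((\<lambda>t. Q (S (of_real t))) has_derivative (\<lambda>h. Q (h *\<^sub>R D (of_real t)))) (at t)"
      by (intro bounded_linear.has_derivative[OF Q_linear]) simp
    then have "(E has_derivative (\<lambda>h. Q (h *\<^sub>R D (of_real t)))) (at t)"
      by (rule has_derivative_transform_within_open[where s = "{0<..}"]) (use t Q_S in auto)
    then show ?thesis
      by (simp add: has_vector_derivative_def E'_def linear_cmul[OF bounded_linear.linear[OF Q_linear]])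
  qed
  have E_0: "E 0 = id_blinfun"
  proof (rule blinfun_eqI)
    fix x
    have "S 0 = id_blinfun" using S by (simp add: analytic_semigroup_def)
    then show "E 0 x = id_blinfun x" using SE[of 0 x x] by simp
  qed
  have E_add: "E (s + t) = E s o\<^sub>L E t" if "0 \<le> s" "0 \<le> t" for s t
  proof (cases "s = 0 \<or> t = 0")
    case True
    then show ?thesis by (auto simp: E_0 intro: blinfun_eqI)
  next
    case False
    with that have "S (of_real s + of_real t) = S (of_real s) o\<^sub>L S (of_real t)"
      using S sector[of s] sector[of t] unfolding analytic_semigroup_def by simp
    then have "S (of_real (s + t)) (x, x) = S (of_real s) (S (of_real t) (x, x))" for x by simp
    then show ?thesis using that by (intro blinfun_eqI) (simp add: SE del: of_real_add)
  qed
  have E_lim: "((\<lambda>t. E t x) \<longlongrightarrow> x) (at_right 0)" for x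
  proof -
    have "((\<lambda>z. S z (x, x)) \<longlongrightarrow> (x, x)) (at 0 within complex_sector (\<delta> / 2))"
      using S \<delta> unfolding analytic_semigroup_def by simp
    moreover have "filterlim complex_of_real (at 0 within complex_sector (\<delta> / 2)) (at_right 0)"
      using \<delta> by (auto simp: filterlim_at complex_sector_def eventually_at_filter intro!: tendsto_eq_intros)
    ultimately have "((\<lambda>t. S (of_real t) (x, x)) \<longlongrightarrow> (x, x)) (at_right 0)"
      by (rule filterlim_compose)
    then have "((\<lambda>t. fst (S (of_real t) (x, x))) \<longlongrightarrow> fst (x, x)) (at_right 0)"
      by (rule tendsto_fst)
    moreover have "\<forall>\<^sub>F t in at_right 0. fst (S (of_real t) (x, x)) = E t x"
      by (auto simp: eventually_at_filter SE)
    ultimately show ?thesis by (simp add: tendsto_cong)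
  qed
  have "smoothing_semigroup E E' T M"
  proof
    show "norm (E t) \<le> M" if "0 \<le> t" "t \<le> T" for t
    proof (cases "t = 0")
      case False
      with that have "norm (S (of_real t)) \<le> B" using \<delta>
        by (intro B complex_sector_of_real) auto
      then have "norm (E t) \<le> B * k"
        using order_trans[OF k(2) mult_right_mono, of "S (of_real t)" B] k(1) Q_S[OF that(1)] by simp
      then show ?thesis by (simp add: M_def)
    qed (simp add: M_def)
    show "norm (E' t) \<le> M / t" if t: "0 < t" "t \<le> T" for t
    proof -
      have "norm (E' t) \<le> K / t * k"
        unfolding E'_def by (rule order_trans[OF k(2) mult_right_mono]) (use k K[OF t] in auto)
      also have "\<dots> = (K * k) / t" by simp
      also have "\<dots> \<le> M / t" using t by (intro divide_right_mono) (auto simp: M_def)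
      finally show ?thesis .
    qed
  qed (use T E_0 E_add E_deriv E_lim in \<open>auto simp: M_def\<close>)
  \<comment> \<open>The right difference quotient of \<open>E t x\<close> has two limits that must
    agree: one by pulling \<open>E t\<close> out of the quotient defining \<open>A0 x\<close>, one
    from operator norm differentiability.\<close>
  moreover have "E' t x = E t (A0 x)" if x: "x \<in> D0" and t: "0 < t" for x t
  proof -
    have "((\<lambda>h. (1 / h) *\<^sub>R (E h x - x)) \<longlongrightarrow> A0 x) (at_right 0)"
      using gen x unfolding generates_analytic_semigroup_def by blast
    then have "((\<lambda>h. E t ((1 / h) *\<^sub>R (E h x - x))) \<longlongrightarrow> E t (A0 x)) (at_right 0)"
      by (intro blinfun.tendsto tendsto_const)
    moreover have "\<forall>\<^sub>F h in at_right 0. E t ((1 / h) *\<^sub>R (E h x - x)) = (1 / h) *\<^sub>R (E (t + h) x - E t x)"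
      using t by (auto simp: eventually_at_filter E_add blinfun.bilinear_simps)
    ultimately have 1: "((\<lambda>h. (1 / h) *\<^sub>R (E (t + h) x - E t x)) \<longlongrightarrow> E t (A0 x)) (at_right 0)"
      by (simp add: tendsto_cong)
    have "((\<lambda>t. E t x) has_vector_derivative E' t x) (at t)"
      by (rule bounded_linear.has_vector_derivative[OF blinfun.bounded_linear_left E_deriv[OF t]])
    then have "((\<lambda>h. norm (E (t + h) x - E t x - h *\<^sub>R E' t x) / norm h) \<longlongrightarrow> 0) (at_right 0)"
      unfolding has_vector_derivative_def has_derivative_at by (auto intro: tendsto_within_subset)
    moreover have "\<forall>\<^sub>F h in at_right 0. norm (E (t + h) x - E t x - h *\<^sub>R E' t x) / norm h
        = norm ((1 / h) *\<^sub>R (E (t + h) x - E t x) - E' t x)"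
    proof -
      have "norm (w - h *\<^sub>R y) / norm h = norm ((1 / h) *\<^sub>R w - y)" if "0 < h" for h :: real and w y :: 'x
      proof -
        have "(1 / h) *\<^sub>R w - y = (1 / h) *\<^sub>R (w - h *\<^sub>R y)" using that by (simp add: algebra_simps)
        then show ?thesis by simp
      qed
      then show ?thesis by (auto simp: eventually_at_filter)
    qed
    ultimately have "((\<lambda>h. norm ((1 / h) *\<^sub>R (E (t + h) x - E t x) - E' t x)) \<longlongrightarrow> 0) (at_right 0)"
      by (simp only: tendsto_cong)
    then have "((\<lambda>h. (1 / h) *\<^sub>R (E (t + h) x - E t x)) \<longlongrightarrow> E' t x) (at_right 0)"
      by (simp only: tendsto_norm_zero_iff LIM_zero_iff)
    from tendsto_unique[OF _ this 1] show ?thesis by simp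
  qed
  ultimately show thesis by (rule that)
qed


subsection \<open>The flow of the reaction\<close>

lemma vector_increment_bound:
  fixes w :: "real \<Rightarrow> 'a::real_normed_vector"
  assumes w: "\<And>s. s \<in> {0..t} \<Longrightarrow> (w has_vector_derivative w' s) (at s within {0..t})"
    and B: "\<And>s. s \<in> {0..t} \<Longrightarrow> norm (w' s) \<le> B" and t: "0 \<le> t"
  shows "norm (w t - w 0) \<le> B * t"
proof -
  have "norm (w t - w 0) \<le> B * norm (t - 0)"
  proof (rule differentiable_bound[of "{0..t}" w "\<lambda>s h. h *\<^sub>R w' s"])
    fix s assume s: "s \<in> {0..t}"
    show "(w has_derivative (\<lambda>h. h *\<^sub>R w' s)) (at s within {0..t})"
      using w[OF s] by (simp add: has_vector_derivative_def)
    show "onorm (\<lambda>h. h *\<^sub>R w' s) \<le> B"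
      using B[OF s] by (intro onorm_le) (simp add: mult_left_mono mult.commute[of B])
  qed (use t in auto)
  then show ?thesis using t by simp
qed

lemma vector_derivative_within_mono:
  assumes "\<And>s. s \<in> {0..t::real} \<Longrightarrow> (w has_vector_derivative w' s) (at s within {0..t})" "\<sigma> \<le> t" "s \<in> {0..\<sigma>}"
  shows "(w has_vector_derivative w' s) (at s within {0..\<sigma>})"
  using assms by (intro has_vector_derivative_within_subset[OF assms(1)]) auto

text \<open>Local regularity of \<open>f\<close> around one point of the trajectory. The second
  derivative is represented by the Lipschitz bound for \<open>f'\<close>; a single \<open>K\<close>
  serves for all four estimates.\<close>

locale reaction_ball =
  fixes U :: "'x::banach set" and f :: "'x \<Rightarrow> 'x" and f' :: "'x \<Rightarrow> 'x \<Rightarrow>\<^sub>L 'x"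
    and x0 :: 'x and r K :: real
  assumes r_pos: "0 < r" and K_ge_1: "1 \<le> K" and ball_U: "cball x0 r \<subseteq> U"
    and f_bound: "y \<in> cball x0 r \<Longrightarrow> norm (f y) \<le> K"
    and f_deriv: "y \<in> cball x0 r \<Longrightarrow> (f has_derivative f' y) (at y)"
    and f'_bound: "y \<in> cball x0 r \<Longrightarrow> norm (f' y) \<le> K"
    and f'_lipschitz: "y \<in> cball x0 r \<Longrightarrow> z \<in> cball x0 r \<Longrightarrow> norm (f' y - f' z) \<le> K * norm (y - z)"
begin

lemma f_lipschitz:
  assumes "y \<in> cball x0 r" "z \<in> cball x0 r"
  shows "norm (f y - f z) \<le> K * norm (y - z)"
  by (rule differentiable_bound[of "cball x0 r" f f'])
    (use assms f'_bound in \<open>auto simp: norm_blinfun.rep_eq[symmetric] intro!: has_derivative_at_withinI[OF f_deriv]\<close>)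

text \<open>Mean value estimate on the segment, where \<open>f'\<close> differs from its value at
  \<open>y\<close> by at most \<open>K * norm (z - y)\<close>. The factor 1/2 of Taylor's formula is
  given up.\<close>

lemma f_taylor:
  assumes y: "y \<in> cball x0 r" and z: "z \<in> cball x0 r"
  shows "norm (f z - f y - f' y (z - y)) \<le> K * norm (z - y) ^ 2"
proof -
  have seg: "closed_segment y z \<subseteq> cball x0 r"
    by (rule closed_segment_subset) (use y z in auto)
  have "norm (f z - f y - f' y (z - y)) \<le> norm (z - y) * (K * norm (z - y))"
  proof (rule differentiable_bound_linearization[where S = "closed_segment y z" and f' = "\<lambda>x. f' x"])
    fix x assume x: "x \<in> closed_segment y z"
    show "(f has_derivative f' x) (at x within closed_segment y z)"
      using seg x by (intro has_derivative_at_withinI[OF f_deriv]) auto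
    have "norm (f' x - f' y) \<le> K * norm (x - y)" using f'_lipschitz x seg y by auto
    also have "norm (x - y) \<le> norm (z - y)"
      using segment_bound(1)[OF x] by (simp add: norm_minus_commute)
    finally have "norm (f' x - f' y) \<le> K * norm (z - y)" using K_ge_1 by (simp add: mult_left_mono)
    then show "onorm (blinfun_apply (f' x) - blinfun_apply (f' y)) \<le> K * norm (z - y)"
      by (simp add: norm_blinfun.rep_eq minus_blinfun.rep_eq fun_diff_def)
  qed (auto simp: closed_segment_def algebra_simps intro!: exI)
  then show ?thesis by (simp add: power2_eq_square algebra_simps)
qed

text \<open>Each expansion, inserted into \<open>w' = f(w)\<close> and integrated, yields the next.
  The two terms of size \<open>K ^ 3 * s\<^sup>2\<close> come from the Taylor remainder of
  \<open>f\<close> and from the preceding expansion.\<close>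

lemma curve_bounds:
  assumes t: "0 \<le> t"
    and w: "\<And>s. s \<in> {0..t} \<Longrightarrow> (w has_vector_derivative f (w s)) (at s within {0..t})"
    and ball: "\<And>s. s \<in> {0..t} \<Longrightarrow> w s \<in> cball x0 r"
  shows "norm (w t - w 0) \<le> K * t"
    and "norm (w t - w 0 - t *\<^sub>R f (w 0)) \<le> K\<^sup>2 * t\<^sup>2"
    and "norm (w t - w 0 - t *\<^sub>R f (w 0) - (t\<^sup>2 / 2) *\<^sub>R f' (w 0) (f (w 0))) \<le> 2 * K ^ 3 * t ^ 3"
proof -
  have w0: "w 0 \<in> cball x0 r" using ball t by simp
  have 1: "norm (w s - w 0) \<le> K * s" if s: "s \<in> {0..t}" for s
    by (rule vector_increment_bound[where w' = "\<lambda>s. f (w s)"])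
      (use s ball f_bound in \<open>auto intro!: vector_derivative_within_mono[OF w]\<close>)
  have 2: "norm (w s - w 0 - s *\<^sub>R f (w 0)) \<le> K\<^sup>2 * s\<^sup>2" if s: "s \<in> {0..t}" for s
  proof -
    have "norm ((w s - s *\<^sub>R f (w 0)) - (w 0 - 0 *\<^sub>R f (w 0))) \<le> (K * (K * s)) * s"
    proof (rule vector_increment_bound[where w' = "\<lambda>s. f (w s) - f (w 0)"])
      fix \<sigma> assume \<sigma>: "\<sigma> \<in> {0..s}"
      show "((\<lambda>\<sigma>. w \<sigma> - \<sigma> *\<^sub>R f (w 0)) has_vector_derivative f (w \<sigma>) - f (w 0)) (at \<sigma> within {0..s})"
        using \<sigma> s by (intro has_vector_derivative_diff vector_derivative_within_mono[OF w])
          (auto intro!: derivative_eq_intros)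
      have "norm (f (w \<sigma>) - f (w 0)) \<le> K * norm (w \<sigma> - w 0)"
        using \<sigma> s ball w0 by (intro f_lipschitz) auto
      also have "\<dots> \<le> K * (K * \<sigma>)" using 1[of \<sigma>] \<sigma> s K_ge_1 by (intro mult_left_mono) auto
      also have "\<dots> \<le> K * (K * s)" using \<sigma> K_ge_1 by (intro mult_left_mono) auto
      finally show "norm (f (w \<sigma>) - f (w 0)) \<le> K * (K * s)" .
    qed (use s in auto)
    then show ?thesis by (simp add: power2_eq_square algebra_simps)
  qed
  show "norm (w t - w 0) \<le> K * t" "norm (w t - w 0 - t *\<^sub>R f (w 0)) \<le> K\<^sup>2 * t\<^sup>2"
    using 1[of t] 2[of t] t by auto
  let ?k = "f' (w 0) (f (w 0))"
  have "norm ((w t - t *\<^sub>R f (w 0) - (t\<^sup>2 / 2) *\<^sub>R ?k) - (w 0 - 0 *\<^sub>R f (w 0) - (0\<^sup>2 / 2) *\<^sub>R ?k))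
      \<le> (2 * K ^ 3 * t\<^sup>2) * t"
  proof (rule vector_increment_bound[where w' = "\<lambda>s. f (w s) - f (w 0) - s *\<^sub>R ?k"])
    fix s assume s: "s \<in> {0..t}"
    show "((\<lambda>s. w s - s *\<^sub>R f (w 0) - (s\<^sup>2 / 2) *\<^sub>R ?k) has_vector_derivative
        f (w s) - f (w 0) - s *\<^sub>R ?k) (at s within {0..t})"
      by (intro has_vector_derivative_diff w[OF s]) (auto intro!: derivative_eq_intros)
    have "f (w s) - f (w 0) - s *\<^sub>R ?k
        = (f (w s) - f (w 0) - f' (w 0) (w s - w 0)) + f' (w 0) (w s - w 0 - s *\<^sub>R f (w 0))"
      by (simp add: blinfun.bilinear_simps)
    then have "norm (f (w s) - f (w 0) - s *\<^sub>R ?k)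
        \<le> norm (f (w s) - f (w 0) - f' (w 0) (w s - w 0)) + norm (f' (w 0) (w s - w 0 - s *\<^sub>R f (w 0)))"
      by (metis norm_triangle_ineq)
    also have "\<dots> \<le> K * (K * s)\<^sup>2 + K * (K\<^sup>2 * s\<^sup>2)"
    proof (intro add_mono)
      have "norm (f (w s) - f (w 0) - f' (w 0) (w s - w 0)) \<le> K * norm (w s - w 0) ^ 2"
        using ball[OF s] w0 by (intro f_taylor)
      also have "\<dots> \<le> K * (K * s)\<^sup>2"
        using 1[OF s] K_ge_1 by (intro mult_left_mono power_mono) auto
      finally show "norm (f (w s) - f (w 0) - f' (w 0) (w s - w 0)) \<le> K * (K * s)\<^sup>2" .
      have "norm (f' (w 0) (w s - w 0 - s *\<^sub>R f (w 0))) \<le> norm (f' (w 0)) * norm (w s - w 0 - s *\<^sub>R f (w 0))"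
        by (rule norm_blinfun)
      also have "\<dots> \<le> K * (K\<^sup>2 * s\<^sup>2)"
        using f'_bound[OF w0] 2[OF s] K_ge_1 by (intro mult_mono) auto
      finally show "norm (f' (w 0) (w s - w 0 - s *\<^sub>R f (w 0))) \<le> K * (K\<^sup>2 * s\<^sup>2)" .
    qed
    also have "\<dots> = 2 * K ^ 3 * s\<^sup>2" by (simp add: power2_eq_square power3_eq_cube algebra_simps)
    also have "\<dots> \<le> 2 * K ^ 3 * t\<^sup>2" using s K_ge_1 by (intro mult_left_mono power_mono) auto
    finally show "norm (f (w s) - f (w 0) - s *\<^sub>R ?k) \<le> 2 * K ^ 3 * t\<^sup>2" .
  qed (rule t)
  then show "norm (w t - w 0 - t *\<^sub>R f (w 0) - (t\<^sup>2 / 2) *\<^sub>R ?k) \<le> 2 * K ^ 3 * t ^ 3"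
    by (simp add: power2_eq_square power3_eq_cube algebra_simps)
qed

text \<open>A maximum replaces Gronwall: if \<open>m\<close> is the largest distance of the curves,
  then \<open>m\<close> is at most the initial distance plus \<open>K * t * m\<close>, and the last
  term is at most \<open>m / 2\<close>.\<close>

lemma curve_difference:
  assumes t: "0 \<le> t" "K * t \<le> 1 / 2"
    and w: "\<And>s. s \<in> {0..t} \<Longrightarrow> (w has_vector_derivative f (w s)) (at s within {0..t})"
    and v: "\<And>s. s \<in> {0..t} \<Longrightarrow> (v has_vector_derivative f (v s)) (at s within {0..t})"
    and ball: "\<And>s. s \<in> {0..t} \<Longrightarrow> w s \<in> cball x0 r" "\<And>s. s \<in> {0..t} \<Longrightarrow> v s \<in> cball x0 r"
  shows "norm ((w t - v t) - (w 0 - v 0)) \<le> 2 * K * t * norm (w 0 - v 0)"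
proof -
  have "continuous_on {0..t} (\<lambda>s. norm (w s - v s))"
    using has_vector_derivative_continuous[OF w] has_vector_derivative_continuous[OF v]
    by (intro continuous_intros) (auto simp: continuous_on_eq_continuous_within)
  then obtain s0 where s0: "s0 \<in> {0..t}" "\<And>s. s \<in> {0..t} \<Longrightarrow> norm (w s - v s) \<le> norm (w s0 - v s0)"
    using continuous_attains_sup[of "{0..t}" "\<lambda>s. norm (w s - v s)"] t by auto
  define m where "m = norm (w s0 - v s0)"
  have inc: "norm ((w s - v s) - (w 0 - v 0)) \<le> K * m * s" if s: "s \<in> {0..t}" for s
  proof (rule vector_increment_bound[where w' = "\<lambda>s. f (w s) - f (v s)"])
    fix \<sigma> assume \<sigma>: "\<sigma> \<in> {0..s}"
    show "((\<lambda>\<sigma>. w \<sigma> - v \<sigma>) has_vector_derivative f (w \<sigma>) - f (v \<sigma>)) (at \<sigma> within {0..s})"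
      using \<sigma> s by (intro has_vector_derivative_diff vector_derivative_within_mono[OF w]
          vector_derivative_within_mono[OF v]) auto
    have "norm (f (w \<sigma>) - f (v \<sigma>)) \<le> K * norm (w \<sigma> - v \<sigma>)"
      using \<sigma> s ball by (intro f_lipschitz) auto
    also have "\<dots> \<le> K * m" using s0(2)[of \<sigma>] \<sigma> s K_ge_1 by (auto simp: m_def intro!: mult_left_mono)
    finally show "norm (f (w \<sigma>) - f (v \<sigma>)) \<le> K * m" .
  qed (use s in auto)
  have "m \<le> norm (w 0 - v 0) + norm ((w s0 - v s0) - (w 0 - v 0))"
    unfolding m_def by norm
  also have "norm ((w s0 - v s0) - (w 0 - v 0)) \<le> K * m * s0" by (rule inc[OF s0(1)])
  also have "K * m * s0 \<le> m * (K * t)"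
    using s0(1) K_ge_1 by (auto simp: m_def intro!: mult_left_mono)
  also have "\<dots> \<le> m * (1 / 2)" using t by (intro mult_left_mono) (auto simp: m_def)
  finally have "m \<le> 2 * norm (w 0 - v 0)" by simp
  then have "K * m * t \<le> K * (2 * norm (w 0 - v 0)) * t"
    using K_ge_1 t by (intro mult_right_mono mult_left_mono) auto
  with inc[of t] t show ?thesis by (simp add: algebra_simps)
qed

text \<open>\<open>flow_f\<close> confines the curve to \<open>U\<close> only, where
  \<open>f\<close> may be unbounded. Up to the first time on or beyond the sphere the speed is at
  most \<open>K\<close>, so the distance from the centre is at most \<open>r / 2 + r / 4\<close>, a
  contradiction.\<close>

lemma flow_f_stays:
  assumes t: "0 \<le> t" "K * t \<le> r / 4" and y: "y \<in> cball x0 (r / 2)" and flow: "flow_f U f t y z"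
  obtains w where "w 0 = y" "w t = z" "\<And>s. s \<in> {0..t} \<Longrightarrow> w s \<in> cball x0 r"
    "\<And>s. s \<in> {0..t} \<Longrightarrow> (w has_vector_derivative f (w s)) (at s within {0..t})"
proof -
  obtain w where w: "w 0 = y" "w t = z"
    "\<And>s. s \<in> {0..t} \<Longrightarrow> (w has_vector_derivative f (w s)) (at s within {0..t})"
    using flow unfolding flow_f_def by blast
  have cont: "continuous_on {0..t} (\<lambda>s. norm (w s - x0))"
    using has_vector_derivative_continuous[OF w(3)]
    by (intro continuous_intros) (auto simp: continuous_on_eq_continuous_within)
  have "norm (w s - x0) < r" if s: "s \<in> {0..t}" for s
  proof (rule ccontr)
    assume "\<not> norm (w s - x0) < r"
    define Z where "Z = {0..t} \<inter> (\<lambda>s. norm (w s - x0)) -` {r..}"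
    have "closed Z" unfolding Z_def
      by (intro continuous_closed_preimage cont) auto
    moreover have "bounded Z"
      by (rule bounded_subset[OF bounded_closed_interval[of 0 t]]) (auto simp: Z_def)
    ultimately have "compact Z" by (simp add: compact_eq_bounded_closed)
    moreover have "s \<in> Z" using s \<open>\<not> norm (w s - x0) < r\<close> by (simp add: Z_def)
    ultimately obtain s1 where s1: "s1 \<in> Z" "\<And>\<sigma>. \<sigma> \<in> Z \<Longrightarrow> s1 \<le> \<sigma>"
      using compact_attains_inf[of Z] by blast
    have in_ball: "w \<sigma> \<in> cball x0 r" if "0 \<le> \<sigma>" "\<sigma> < s1" for \<sigma>
    proof -
      have "\<sigma> \<notin> Z" using s1(2)[of \<sigma>] that by auto
      then show ?thesis using that s1(1) by (auto simp: Z_def dist_norm norm_minus_commute)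
    qed
    have "0 < s1"
    proof (rule ccontr)
      assume "\<not> 0 < s1"
      then have "s1 = 0" using s1(1) by (auto simp: Z_def)
      then show False using s1(1) w(1) y r_pos by (auto simp: Z_def dist_norm norm_minus_commute)
    qed
    have "norm (w s1 - w 0) \<le> K * s1 - K * 0"
    proof (rule differentiable_bound_general[where f' = "\<lambda>s. f (w s)"])
      have "continuous_on {0..t} w"
        using has_vector_derivative_continuous[OF w(3)] by (auto simp: continuous_on_eq_continuous_within)
      then show "continuous_on {0..s1} w"
        by (rule continuous_on_subset) (use s1 in \<open>auto simp: Z_def\<close>)
      fix \<sigma> assume \<sigma>: "0 < \<sigma>" "\<sigma> < s1"
      then have "(w has_vector_derivative f (w \<sigma>)) (at \<sigma> within {0..t})"
        using s1(1) by (intro w) (auto simp: Z_def)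
      then show "(w has_vector_derivative f (w \<sigma>)) (at \<sigma>)"
        using \<sigma> s1(1) by (simp add: at_within_Icc_at Z_def)
      show "norm (f (w \<sigma>)) \<le> K" using \<sigma> by (intro f_bound in_ball) auto
    qed (use \<open>0 < s1\<close> in \<open>auto intro!: continuous_intros derivative_eq_intros\<close>)
    also have "\<dots> \<le> K * t" using s1(1) K_ge_1 by (simp add: Z_def)
    finally have "norm (w s1 - w 0) \<le> r / 4" using t by simp
    moreover have "norm (w 0 - x0) \<le> r / 2" using y w(1) by (simp add: dist_norm norm_minus_commute)
    moreover have "norm (w s1 - x0) \<le> norm (w s1 - w 0) + norm (w 0 - x0)" by norm
    ultimately show False using s1(1) r_pos by (simp add: Z_def)
  qed
  then have "w s \<in> cball x0 r" if "s \<in> {0..t}" for s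
    using that by (auto simp: dist_norm norm_minus_commute less_imp_le)
  with w show thesis by (intro that)
qed

lemma flow_f_expansion:
  assumes t: "0 \<le> t" "K * t \<le> r / 4" and y: "y \<in> cball x0 (r / 2)" and flow: "flow_f U f t y z"
  shows "norm (z - y) \<le> K * t"
    and "norm (z - y - t *\<^sub>R f y) \<le> K\<^sup>2 * t\<^sup>2"
    and "norm (z - y - t *\<^sub>R f y - (t\<^sup>2 / 2) *\<^sub>R f' y (f y)) \<le> 2 * K ^ 3 * t ^ 3"
proof -
  obtain w where w: "w 0 = y" "w t = z" "\<And>s. s \<in> {0..t} \<Longrightarrow> w s \<in> cball x0 r"
    "\<And>s. s \<in> {0..t} \<Longrightarrow> (w has_vector_derivative f (w s)) (at s within {0..t})"
    using flow_f_stays[OF assms] by blast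
  from curve_bounds[OF t(1) w(4,3)] w(1,2)
  show "norm (z - y) \<le> K * t" "norm (z - y - t *\<^sub>R f y) \<le> K\<^sup>2 * t\<^sup>2"
    "norm (z - y - t *\<^sub>R f y - (t\<^sup>2 / 2) *\<^sub>R f' y (f y)) \<le> 2 * K ^ 3 * t ^ 3"
    by auto
qed

lemma flow_f_difference:
  assumes t: "0 \<le> t" "K * t \<le> r / 4" "K * t \<le> 1 / 2"
    and y: "y \<in> cball x0 (r / 2)" "y' \<in> cball x0 (r / 2)"
    and flow: "flow_f U f t y z" "flow_f U f t y' z'"
  shows "norm ((z - z') - (y - y')) \<le> 2 * K * t * norm (y - y')"
proof -
  obtain w where w: "w 0 = y" "w t = z" "\<And>s. s \<in> {0..t} \<Longrightarrow> w s \<in> cball x0 r"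
    "\<And>s. s \<in> {0..t} \<Longrightarrow> (w has_vector_derivative f (w s)) (at s within {0..t})"
    using flow_f_stays[OF t(1,2) y(1) flow(1)] by blast
  obtain v where v: "v 0 = y'" "v t = z'" "\<And>s. s \<in> {0..t} \<Longrightarrow> v s \<in> cball x0 r"
    "\<And>s. s \<in> {0..t} \<Longrightarrow> (v has_vector_derivative f (v s)) (at s within {0..t})"
    using flow_f_stays[OF t(1,2) y(2) flow(2)] by blast
  from curve_difference[OF t(1,3) w(4) v(4) w(3) v(3)] w(1,2) v(1,2) show ?thesis by simp
qed

text \<open>Picard iteration: \<open>K * t \<le> r / 4\<close> keeps the iterates in the ball, and
  \<open>K * t \<le> 1 / 2\<close> makes the integral operator a contraction with factor
  1/2.\<close>

lemma flow_f_exists: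
  assumes t: "0 \<le> t" "K * t \<le> r / 4" "K * t \<le> 1 / 2" and y: "y \<in> cball x0 (r / 2)"
  shows "\<exists>z. flow_f U f t y z"
proof -
  \<comment> \<open>Elements of the complete space of bounded continuous functions are defined on
    the whole line; clamping the time to \<open>[0, t]\<close> extends the iterates by
    constants.\<close>
  define cl where "cl s = max 0 (min s t)" for s :: real
  define S where "S = PiC (UNIV :: real set) (\<lambda>_. cball x0 r)"
  define op where "op \<phi> s = y + integral {0..cl s} (\<lambda>\<sigma>. f (apply_bcontfun \<phi> \<sigma>))" for \<phi> s
  have cl: "cl s \<in> {0..t}" for s using t by (auto simp: cl_def)
  have contf: "continuous_on (cball x0 r) f"
    using f_deriv has_derivative_continuous by (metis continuous_at_imp_continuous_on)
  have cont: "continuous_on A (\<lambda>\<sigma>. f (apply_bcontfun \<phi> \<sigma>))" if "\<phi> \<in> S" for A \<phi>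
    using that by (intro continuous_on_compose2[OF contf]) (auto simp: S_def mem_PiC_iff)
  have op_ball: "op \<phi> s \<in> cball x0 r" if \<phi>: "\<phi> \<in> S" for \<phi> s
  proof -
    have "norm (integral {0..cl s} (\<lambda>\<sigma>. f (apply_bcontfun \<phi> \<sigma>))) \<le> K * (cl s - 0)"
      using cl[of s] \<phi> by (intro integral_bound cont f_bound) (auto simp: S_def mem_PiC_iff)
    also have "\<dots> \<le> K * t" using cl[of s] K_ge_1 by auto
    also have "\<dots> \<le> r / 2" using t r_pos by simp
    finally have 1: "norm (op \<phi> s - y) \<le> r / 2" by (simp add: op_def)
    have 2: "norm (y - x0) \<le> r / 2" using y by (simp add: dist_norm norm_minus_commute)
    have "norm (x0 - op \<phi> s) \<le> norm (op \<phi> s - y) + norm (y - x0)" by norm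
    with 1 2 show ?thesis by (simp add: dist_norm)
  qed
  have op_bcont: "op \<phi> \<in> bcontfun" if \<phi>: "\<phi> \<in> S" for \<phi>
  proof (rule bcontfun_normI)
    show "continuous_on UNIV (op \<phi>)"
      unfolding op_def
    proof (intro continuous_intros)
      have "continuous_on {0..t} (\<lambda>u. integral {0..u} (\<lambda>\<sigma>. f (apply_bcontfun \<phi> \<sigma>)))"
        using cont[OF \<phi>] by (intro indefinite_integral_continuous_1 integrable_continuous_real)
      then show "continuous_on UNIV (\<lambda>s. integral {0..cl s} (\<lambda>\<sigma>. f (apply_bcontfun \<phi> \<sigma>)))"
        by (rule continuous_on_compose2) (use cl in \<open>auto simp: cl_def intro!: continuous_intros\<close>)
    qed
    show "norm (op \<phi> s) \<le> norm x0 + r" for s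
    proof -
      have "norm (op \<phi> s - x0) \<le> r"
        using op_ball[OF \<phi>, of s] by (simp add: dist_norm norm_minus_commute)
      moreover have "norm (op \<phi> s) \<le> norm x0 + norm (op \<phi> s - x0)" by norm
      ultimately show ?thesis by simp
    qed
  qed
  define P where "P \<phi> = Bcontfun (op \<phi>)" for \<phi>
  have P: "apply_bcontfun (P \<phi>) = op \<phi>" if "\<phi> \<in> S" for \<phi>
    using op_bcont[OF that] by (simp add: P_def Bcontfun_inverse)
  have "\<exists>!\<phi>\<in>S. P \<phi> = \<phi>"
  proof (rule Banach_fix)
    show "complete S" unfolding S_def by (intro complete_eq_closed[THEN iffD2] closed_PiC) auto
    have "const_bcontfun x0 \<in> S"
      using r_pos by (auto simp: S_def mem_PiC_iff const_bcontfun.rep_eq)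
    then show "S \<noteq> {}" by auto
    show "P ` S \<subseteq> S" using op_ball by (auto simp: S_def mem_PiC_iff P[unfolded S_def])
    have "dist (P \<phi>) (P \<psi>) \<le> 1 / 2 * dist \<phi> \<psi>" if \<phi>: "\<phi> \<in> S" and \<psi>: "\<psi> \<in> S" for \<phi> \<psi>
    proof (rule dist_bound)
      fix s
      have "P \<phi> s - P \<psi> s = integral {0..cl s} (\<lambda>\<sigma>. f (apply_bcontfun \<phi> \<sigma>) - f (apply_bcontfun \<psi> \<sigma>))"
        using cont[OF \<phi>] cont[OF \<psi>] P[OF \<phi>] P[OF \<psi>]
        by (simp add: op_def integral_diff integrable_continuous_real)
      also have "norm \<dots> \<le> (K * dist \<phi> \<psi>) * (cl s - 0)"
      proof (rule integral_bound)
        show "continuous_on {0..cl s} (\<lambda>\<sigma>. f (apply_bcontfun \<phi> \<sigma>) - f (apply_bcontfun \<psi> \<sigma>))"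
          using cont[OF \<phi>] cont[OF \<psi>] by (intro continuous_intros)
        fix \<sigma>
        have "norm (f (apply_bcontfun \<phi> \<sigma>) - f (apply_bcontfun \<psi> \<sigma>)) \<le> K * norm (apply_bcontfun \<phi> \<sigma> - apply_bcontfun \<psi> \<sigma>)"
          using \<phi> \<psi> by (intro f_lipschitz) (auto simp: S_def mem_PiC_iff)
        also have "\<dots> \<le> K * dist \<phi> \<psi>"
          using dist_bounded[of \<phi> \<sigma> \<psi>] K_ge_1 by (intro mult_left_mono) (auto simp: dist_norm)
        finally show "norm (f (apply_bcontfun \<phi> \<sigma>) - f (apply_bcontfun \<psi> \<sigma>)) \<le> K * dist \<phi> \<psi>" .
      qed (use cl[of s] in auto)
      also have "\<dots> = (K * cl s) * dist \<phi> \<psi>" by simp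
      also have "\<dots> \<le> (1 / 2) * dist \<phi> \<psi>"
      proof (rule mult_right_mono)
        have "K * cl s \<le> K * t" using cl[of s] K_ge_1 by auto
        with t show "K * cl s \<le> 1 / 2" by simp
      qed simp
      finally show "dist (P \<phi> s) (P \<psi> s) \<le> 1 / 2 * dist \<phi> \<psi>" by (simp add: dist_norm)
    qed
    then show "\<And>\<phi> \<psi>. \<phi> \<in> S \<Longrightarrow> \<psi> \<in> S \<Longrightarrow> dist (P \<phi>) (P \<psi>) \<le> 1 / 2 * dist \<phi> \<psi>" by blast
  qed auto
  then obtain \<phi> where \<phi>: "\<phi> \<in> S" "P \<phi> = \<phi>" by blast
  then have fixpoint: "apply_bcontfun \<phi> = op \<phi>" using P[of \<phi>] by simp
  have "flow_f U f t y (op \<phi> t)"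
    unfolding flow_f_def
  proof (intro exI[of _ "op \<phi>"] conjI ballI)
    show "op \<phi> 0 = y" using t by (simp add: op_def cl_def)
    fix s assume s: "s \<in> {0..t}"
    show "op \<phi> s \<in> U" using op_ball[OF \<phi>(1)] ball_U by auto
    have "((\<lambda>u. y + integral {0..u} (\<lambda>\<sigma>. f (apply_bcontfun \<phi> \<sigma>))) has_vector_derivative
        0 + f (apply_bcontfun \<phi> s)) (at s within {0..t})"
      by (intro has_vector_derivative_add has_vector_derivative_const integral_has_vector_derivative
          cont[OF \<phi>(1)] s)
    then have "((\<lambda>u. y + integral {0..u} (\<lambda>\<sigma>. f (apply_bcontfun \<phi> \<sigma>))) has_vector_derivative
        f (op \<phi> s)) (at s within {0..t})"
      by (simp add: fixpoint)
    then show "(op \<phi> has_vector_derivative f (op \<phi> s)) (at s within {0..t})"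
      by (rule has_vector_derivative_transform[OF s, rotated]) (simp add: op_def cl_def)
  qed simp
  then show ?thesis by blast
qed

end


subsection \<open>Local error of the splitting\<close>

text \<open>A Landau symbol with one constant for a whole family of steps: a parameter
  \<open>p\<close> encodes a step, and \<open>h p\<close> is its size.\<close>

definition unif_bigO :: "'p set \<Rightarrow> ('p \<Rightarrow> real) \<Rightarrow> nat \<Rightarrow> ('p \<Rightarrow> 'a::real_normed_vector) \<Rightarrow> bool" where
  "unif_bigO P h n R \<longleftrightarrow> (\<exists>C. \<forall>p\<in>P. norm (R p) \<le> C * h p ^ n)"

lemma unif_bigOI: "(\<And>p. p \<in> P \<Longrightarrow> norm (R p) \<le> C * h p ^ n) \<Longrightarrow> unif_bigO P h n R"
  by (auto simp: unif_bigO_def)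

lemma unif_bigO_cong:
  "unif_bigO P h n R \<Longrightarrow> (\<And>p. p \<in> P \<Longrightarrow> S p = R p) \<Longrightarrow> unif_bigO P h n S"
  by (auto simp: unif_bigO_def)

lemma unif_bigO_add:
  assumes "unif_bigO P h n R" "unif_bigO P h n S"
  shows "unif_bigO P h n (\<lambda>p. R p + S p)"
proof -
  obtain C D where "\<And>p. p \<in> P \<Longrightarrow> norm (R p) \<le> C * h p ^ n" "\<And>p. p \<in> P \<Longrightarrow> norm (S p) \<le> D * h p ^ n"
    using assms by (auto simp: unif_bigO_def)
  then have "norm (R p + S p) \<le> (C + D) * h p ^ n" if "p \<in> P" for p
    unfolding distrib_right using that by (intro norm_triangle_mono)
  then show ?thesis by (rule unif_bigOI)
qed

lemma unif_bigO_minus: "unif_bigO P h n R \<Longrightarrow> unif_bigO P h n (\<lambda>p. - R p)"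
  by (simp add: unif_bigO_def)

lemma unif_bigO_diff:
  "unif_bigO P h n R \<Longrightarrow> unif_bigO P h n S \<Longrightarrow> unif_bigO P h n (\<lambda>p. R p - S p)"
  using unif_bigO_add[OF _ unif_bigO_minus, of P h n R S] by simp

lemma unif_bigO_mono:
  assumes R: "unif_bigO P h m R" and "n \<le> m" and h: "\<And>p. p \<in> P \<Longrightarrow> 0 \<le> h p \<and> h p \<le> 1"
  shows "unif_bigO P h n R"
proof -
  obtain C where C: "\<And>p. p \<in> P \<Longrightarrow> norm (R p) \<le> C * h p ^ m"
    using R by (auto simp: unif_bigO_def)
  have "norm (R p) \<le> \<bar>C\<bar> * h p ^ n" if p: "p \<in> P" for p
  proof -
    have "norm (R p) \<le> \<bar>C\<bar> * h p ^ m"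
      using C[OF p] h[OF p] by (meson abs_ge_self mult_right_mono order_trans zero_le_power)
    also have "\<dots> \<le> \<bar>C\<bar> * h p ^ n"
      using h[OF p] \<open>n \<le> m\<close> by (intro mult_left_mono power_decreasing) auto
    finally show ?thesis .
  qed
  then show ?thesis by (rule unif_bigOI)
qed

text \<open>The hypothesis is a norm inequality rather than a bilinear map, so that scaling,
  operator application and quadratic Taylor remainders are covered alike.\<close>

lemma unif_bigO_bilinear:
  assumes R: "unif_bigO P h m R" and S: "unif_bigO P h n S"
    and le: "\<And>p. p \<in> P \<Longrightarrow> norm (Z p) \<le> norm (R p) * norm (S p)"
    and h: "\<And>p. p \<in> P \<Longrightarrow> 0 \<le> h p"
  shows "unif_bigO P h (m + n) Z"
proof -
  obtain C D where C: "\<And>p. p \<in> P \<Longrightarrow> norm (R p) \<le> C * h p ^ m"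
    and D: "\<And>p. p \<in> P \<Longrightarrow> norm (S p) \<le> D * h p ^ n"
    using R S by (auto simp: unif_bigO_def)
  have "norm (Z p) \<le> (C * D) * h p ^ (m + n)" if p: "p \<in> P" for p
  proof -
    have "norm (Z p) \<le> (C * h p ^ m) * (D * h p ^ n)"
      using le[OF p] C[OF p] D[OF p]
      by (meson mult_mono norm_ge_zero order_trans)
    then show ?thesis by (simp add: power_add algebra_simps)
  qed
  then show ?thesis by (rule unif_bigOI)
qed

lemma unif_bigO_scaleR:
  assumes "unif_bigO P h n S" "\<And>p. p \<in> P \<Longrightarrow> 0 \<le> h p"
  shows "unif_bigO P h (m + n) (\<lambda>p. (C * h p ^ m) *\<^sub>R S p)"
proof (rule unif_bigO_bilinear[OF _ assms(1)])
  show "unif_bigO P h m (\<lambda>p. C * h p ^ m)"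
    by (rule unif_bigOI[of _ _ "\<bar>C\<bar>"]) (use assms(2) in \<open>simp add: abs_mult\<close>)
qed (use assms(2) in auto)

lemma unif_bigO_apply:
  fixes L :: "'p \<Rightarrow> 'a::real_normed_vector \<Rightarrow>\<^sub>L 'b::real_normed_vector"
  assumes "unif_bigO P h n S" "\<And>p. p \<in> P \<Longrightarrow> norm (L p) \<le> B" "\<And>p. p \<in> P \<Longrightarrow> 0 \<le> h p"
  shows "unif_bigO P h n (\<lambda>p. L p (S p))"
  using unif_bigO_bilinear[OF unif_bigOI[of P L B h 0] assms(1), of "\<lambda>p. L p (S p)"] assms(2,3)
  by (simp add: norm_blinfun)

locale parabolic_problem = smoothing_semigroup E E' T M
  for E E' :: "real \<Rightarrow> 'x::banach \<Rightarrow>\<^sub>L 'x" and T M +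
  fixes U :: "'x set" and f :: "'x \<Rightarrow> 'x" and f' :: "'x \<Rightarrow> 'x \<Rightarrow>\<^sub>L 'x" and r K :: real
    and c c' a :: "real \<Rightarrow> 'x"
  assumes reaction: "t \<in> {0..T} \<Longrightarrow> reaction_ball U f f' (c t) r K"
    and c_cont: "continuous_on {0..T} c"
    and exact: "0 \<le> t \<Longrightarrow> 0 \<le> h \<Longrightarrow> t + h \<le> T \<Longrightarrow>
        c (t + h) = c t + integral {0..h} (\<lambda>s. E (h - s) (c' t + (f (c (t + s)) - f (c t))))"
    and c'_bound: "t \<in> {0..T} \<Longrightarrow> norm (c' t) \<le> K"
    and a_bound: "t \<in> {0..T} \<Longrightarrow> norm (a t) \<le> K"
    and c_taylor: "0 \<le> t \<Longrightarrow> 0 \<le> s \<Longrightarrow> t + s \<le> T \<Longrightarrow> norm (c (t + s) - c t - s *\<^sub>R c' t) \<le> K * s\<^sup>2"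
    and fc_taylor: "0 \<le> t \<Longrightarrow> 0 \<le> s \<Longrightarrow> t + s \<le> T \<Longrightarrow>
        norm (f (c (t + s)) - f (c t) - s *\<^sub>R f' (c t) (c' t)) \<le> K * s\<^sup>2"
begin

lemma r_pos: "0 < r" and K_ge_1: "1 \<le> K"
  using reaction_ball.r_pos reaction_ball.K_ge_1 reaction[of 0] T_pos by auto

text \<open>\<open>1 / K\<close> makes the half steps of the reaction contractive. With the other
  bound, the drift \<open>h / 2 * K + 3 * M * K * h\<close> of a parabolic step is at most
  \<open>7 * r / 32\<close>, less than the \<open>3 * r / 8\<close> that separates
  \<open>r / 8\<close> from \<open>r / 2\<close>.\<close>

definition h0 :: real where "h0 = min (1 / K) (r / (16 * M * K))"

lemma h0_pos: "0 < h0"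
  using r_pos K_ge_1 M_ge_1 by (simp add: h0_def)

definition valid :: "real \<Rightarrow> real \<Rightarrow> bool" where
  "valid t h \<longleftrightarrow> 0 \<le> t \<and> 0 \<le> h \<and> h \<le> h0 \<and> t + h \<le> T"

lemma validD:
  assumes "valid t h"
  shows "0 \<le> t" "t \<in> {0..T}" "0 \<le> h" "h \<le> T" "h \<le> 1" "K * h \<le> 1" "16 * M * K * h \<le> r" "t + h \<le> T"
proof -
  have h: "0 \<le> h" "h \<le> 1 / K" "h \<le> r / (16 * M * K)" "0 \<le> t" "t + h \<le> T"
    using assms by (auto simp: valid_def h0_def)
  show "0 \<le> t" "t \<in> {0..T}" "0 \<le> h" "h \<le> T" "t + h \<le> T" using h by auto
  show "K * h \<le> 1" "16 * M * K * h \<le> r"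
    using h K_ge_1 M_ge_1 by (auto simp: pos_le_divide_eq mult.commute)
  have "h \<le> K * h" using mult_right_mono[OF K_ge_1 h(1)] by simp
  with \<open>K * h \<le> 1\<close> show "h \<le> 1" by simp
qed

lemma valid_half:
  assumes "valid t h"
  shows "0 \<le> h / 2" "K * (h / 2) \<le> r / 4" "K * (h / 2) \<le> 1 / 2"
proof -
  note v = validD[OF assms]
  have "0 \<le> K * h" using v(3) K_ge_1 by simp
  moreover have "K * h \<le> M * (K * h)" using mult_right_mono[OF M_ge_1, of "K * h"] calculation by simp
  moreover have "16 * (M * (K * h)) \<le> r" using v(7) by (simp add: mult.assoc)
  ultimately have "2 * (K * h) \<le> r" by linarith
  then show "0 \<le> h / 2" "K * (h / 2) \<le> r / 4" "K * (h / 2) \<le> 1 / 2" using v by auto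
qed

text \<open>The homogenization uses \<open>\<rho>0 = u t + (h / 2) * f (u t)\<close> and \<open>\<rho>1 = - f (u t)\<close>.  Since
  \<open>u' = A u + f u\<close>, the inhomogeneity is \<open>u' t + (h / 2 - s) * A (f (u t))\<close>; \<open>a\<close> stands for \<open>A (f u)\<close>.\<close>

definition parabolic_step :: "real \<Rightarrow> real \<Rightarrow> 'x \<Rightarrow> 'x" where
  "parabolic_step t h v = c t - (h / 2) *\<^sub>R f (c t) + E h (v - c t - (h / 2) *\<^sub>R f (c t))
     + integral {0..h} (\<lambda>s. E (h - s) (c' t + (h / 2 - s) *\<^sub>R a t))"

text \<open>The time \<open>t\<close> fixes the homogenizing functions only, not the flow: for the
  concrete problem the resulting map turns out to be the same for every \<open>t\<close>.\<close>

definition splitting_step :: "real \<Rightarrow> real \<Rightarrow> 'x \<Rightarrow> 'x \<Rightarrow> bool" where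
  "splitting_step t h y z \<longleftrightarrow>
     (\<exists>w. flow_f U f (h / 2) y w \<and> flow_f U f (h / 2) (parabolic_step t h w) z)"

section \<open>Existence and stability of one step\<close>

lemma f_c_bound: "t \<in> {0..T} \<Longrightarrow> norm (f (c t)) \<le> K"
  using reaction_ball.f_bound[OF reaction] r_pos by simp

lemma f'_c_bound: "t \<in> {0..T} \<Longrightarrow> norm (f' (c t)) \<le> K"
  using reaction_ball.f'_bound[OF reaction] r_pos by simp

text \<open>\<open>E h\<close> may enlarge the initial deviation by the factor \<open>M\<close>; the
  radius \<open>r / (8 * M)\<close> compensates for it, and the smallness of \<open>h\<close>
  absorbs the remaining terms.\<close>

lemma parabolic_step_near:
  assumes v: "valid t h" and y: "norm (y - c t) \<le> r / (8 * M)" and w: "norm (w - y) \<le> K * (h / 2)"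
  shows "parabolic_step t h w \<in> cball (c t) (r / 2)"
proof -
  note v' = validD[OF v]
  let ?d = "w - c t - (h / 2) *\<^sub>R f (c t)"
  let ?I = "integral {0..h} (\<lambda>s. E (h - s) (c' t + (h / 2 - s) *\<^sub>R a t))"
  have fc: "norm ((h / 2) *\<^sub>R f (c t)) \<le> h / 2 * K"
    using f_c_bound v' by (simp add: mult_left_mono)
  have "norm (w - c t - q) \<le> norm (w - y) + norm (y - c t) + norm q" for q by norm
  then have "norm ?d \<le> norm (w - y) + norm (y - c t) + norm ((h / 2) *\<^sub>R f (c t))" .
  also have "\<dots> \<le> K * (h / 2) + r / (8 * M) + h / 2 * K" by (intro add_mono w y fc)
  finally have "norm ?d \<le> K * h + r / (8 * M)" by simp
  then have d: "norm (E h ?d) \<le> M * (K * h + r / (8 * M))"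
    using M_ge_1 v' by (intro order_trans[OF E_apply_bound mult_left_mono]) auto
  have "norm ?I \<le> (M * (2 * K)) * (h - 0)"
  proof (rule integral_bound)
    show "continuous_on {0..h} (\<lambda>s. E (h - s) (c' t + (h / 2 - s) *\<^sub>R a t))"
      using v' by (intro continuous_on_E_apply continuous_intros)
    fix s assume s: "s \<in> {0..h}"
    have "\<bar>h / 2 - s\<bar> \<le> 1" using s v' by auto
    then have "norm ((h / 2 - s) *\<^sub>R a t) \<le> 1 * K"
      using a_bound[OF v'(2)] unfolding norm_scaleR by (intro mult_mono) auto
    then have "norm (c' t + (h / 2 - s) *\<^sub>R a t) \<le> 2 * K"
      using c'_bound[of t] v' norm_triangle_ineq[of "c' t" "(h / 2 - s) *\<^sub>R a t"] by auto
    then show "norm (E (h - s) (c' t + (h / 2 - s) *\<^sub>R a t)) \<le> M * (2 * K)"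
      using M_ge_1 v' s by (intro order_trans[OF E_apply_bound mult_left_mono]) auto
  qed (use v' in auto)
  then have I: "norm ?I \<le> 2 * (M * K * h)" by simp
  have "norm (c t - q + d + i - c t) \<le> norm q + norm d + norm i" for q d i by norm
  then have "norm (parabolic_step t h w - c t) \<le> norm ((h / 2) *\<^sub>R f (c t)) + norm (E h ?d) + norm ?I"
    unfolding parabolic_step_def .
  also have "\<dots> \<le> h / 2 * K + M * (K * h + r / (8 * M)) + 2 * (M * K * h)"
    by (intro add_mono fc d I)
  also have "\<dots> = h / 2 * K + 3 * (M * K * h) + r / 8" using M_ge_1 by (simp add: field_simps)
  also have "\<dots> \<le> r / 2"
  proof -
    have "1 * (K * h) \<le> M * (K * h)" using v'(3) K_ge_1 M_ge_1 by (intro mult_right_mono) auto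
    then show ?thesis using v'(7) r_pos by (simp add: algebra_simps)
  qed
  finally show ?thesis by (simp add: dist_norm norm_minus_commute)
qed

lemma near_in_ball: "norm (y - c t) \<le> r / (8 * M) \<Longrightarrow> y \<in> cball (c t) (r / 2)"
proof -
  assume y: "norm (y - c t) \<le> r / (8 * M)"
  have "r / (8 * M) \<le> r / 2" using r_pos M_ge_1 by (intro divide_left_mono) auto
  with y show ?thesis by (simp add: dist_norm norm_minus_commute)
qed

lemma first_flow:
  assumes v: "valid t h" and y: "norm (y - c t) \<le> r / (8 * M)" and w: "flow_f U f (h / 2) y w"
  shows "norm (w - y) \<le> K * (h / 2)"
  using reaction_ball.flow_f_expansion(1)[OF reaction valid_half(1,2)[OF v] near_in_ball[OF y] w]
    validD[OF v] by simp

lemma splitting_step_exists: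
  assumes v: "valid t h" and y: "norm (y - c t) \<le> r / (8 * M)"
  shows "\<exists>z. splitting_step t h y z"
proof -
  note reaction' = reaction[OF validD(2)[OF v]]
  obtain w where w: "flow_f U f (h / 2) y w"
    using reaction_ball.flow_f_exists[OF reaction' valid_half[OF v] near_in_ball[OF y]] by blast
  have "parabolic_step t h w \<in> cball (c t) (r / 2)"
    by (rule parabolic_step_near[OF v y first_flow[OF v y w]])
  then show ?thesis
    using reaction_ball.flow_f_exists[OF reaction' valid_half[OF v]] w unfolding splitting_step_def by blast
qed

text \<open>The parabolic step is affine with linear part \<open>E h\<close>, and each half flow is
  the identity up to O(\<open>h\<close>). \<open>E h\<close> is kept unestimated: bounding it by
  \<open>M\<close> in each step would accumulate powers of \<open>M\<close>.\<close>

lemma splitting_step_stable: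
  assumes v: "valid t h" and y: "norm (y - c t) \<le> r / (8 * M)" "norm (y' - c t) \<le> r / (8 * M)"
    and z: "splitting_step t h y z" "splitting_step t h y' z'"
  shows "norm ((z - z') - E h (y - y')) \<le> 3 * M * K * h * norm (y - y')"
proof -
  note v' = validD[OF v]
  note reaction' = reaction[OF v'(2)]
  let ?A = "parabolic_step t h"
  obtain w w' where w: "flow_f U f (h / 2) y w" "flow_f U f (h / 2) (?A w) z"
    and w': "flow_f U f (h / 2) y' w'" "flow_f U f (h / 2) (?A w') z'"
    using z unfolding splitting_step_def by blast
  note diff = reaction_ball.flow_f_difference[OF reaction' valid_half[OF v]]
  have A: "?A w - ?A w' = E h (w - w')"
    by (simp add: parabolic_step_def blinfun.bilinear_simps)
  have near: "?A w \<in> cball (c t) (r / 2)" "?A w' \<in> cball (c t) (r / 2)"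
    using parabolic_step_near[OF v] first_flow[OF v] y w(1) w'(1) by blast+
  let ?e = "norm (y - y')"
  have 1: "norm ((w - w') - (y - y')) \<le> K * h * ?e"
    using diff[OF near_in_ball[OF y(1)] near_in_ball[OF y(2)] w(1) w'(1)] by simp
  have "K * h * ?e \<le> 1 * ?e" using v' by (intro mult_right_mono) auto
  moreover have "norm (w - w') \<le> ?e + norm ((w - w') - (y - y'))" by norm
  ultimately have "norm (w - w') \<le> 2 * ?e" using 1 by simp
  then have 2: "norm (E h (w - w')) \<le> M * (2 * ?e)"
    using M_ge_1 v' by (intro order_trans[OF E_apply_bound mult_left_mono]) auto
  have "norm ((z - z') - E h (w - w')) \<le> K * h * norm (E h (w - w'))"
    using diff[OF near w(2) w'(2)] by (simp add: A)
  also have "\<dots> \<le> K * h * (M * (2 * ?e))"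
    using 2 K_ge_1 v' by (intro mult_left_mono) auto
  finally have 3: "norm ((z - z') - E h (w - w')) \<le> K * h * (M * (2 * ?e))" .
  have 4: "norm (E h ((w - w') - (y - y'))) \<le> M * (K * h * ?e)"
    using M_ge_1 v' 1 by (intro order_trans[OF E_apply_bound mult_left_mono]) auto
  have "(z - z') - E h (y - y') = ((z - z') - E h (w - w')) + E h ((w - w') - (y - y'))"
    by (simp add: blinfun.bilinear_simps)
  then have "norm ((z - z') - E h (y - y')) \<le> norm ((z - z') - E h (w - w')) + norm (E h ((w - w') - (y - y')))"
    by (metis norm_triangle_ineq)
  also have "\<dots> \<le> K * h * (M * (2 * ?e)) + M * (K * h * ?e)" by (rule add_mono[OF 3 4])
  finally show ?thesis by (simp add: algebra_simps)
qed

section \<open>Size and smoothing of the second order defect\<close>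

lemma integral_E_bound:
  assumes h: "0 \<le> h" "h \<le> T" and p: "continuous_on {0..h} p"
    and B: "\<And>s. s \<in> {0..h} \<Longrightarrow> norm (p s) \<le> B"
  shows "norm (integral {0..h} (\<lambda>s. E (h - s) (p s))) \<le> M * B * h"
proof -
  have "norm (integral {0..h} (\<lambda>s. E (h - s) (p s))) \<le> (M * B) * (h - 0)"
  proof (rule integral_bound)
    show "continuous_on {0..h} (\<lambda>s. E (h - s) (p s))"
      using h p by (intro continuous_on_E_apply)
    show "norm (E (h - s) (p s)) \<le> M * B" if "s \<in> {0..h}" for s
      using that B[OF that] h M_ge_1 by (intro order_trans[OF E_apply_bound mult_left_mono]) auto
  qed (use h in simp)
  then show ?thesis by simp
qed

text \<open>The factor \<open>1 / \<sigma>\<close>, summed over the grid points \<open>\<sigma> = h, 2 * h, \<dots>\<close>, produces the logarithm.\<close>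

lemma smoothing_defect:
  assumes h: "0 \<le> h" "h \<le> T" and \<psi>: "continuous_on {0..h} \<psi>" "\<forall>s\<in>{0..h}. \<bar>\<psi> s\<bar> \<le> h"
  shows "norm (integral {0..h} (\<lambda>s. \<psi> s *\<^sub>R (E (h - s) x - x))) \<le> 2 * M * norm x * h\<^sup>2"
    and "0 < \<sigma> \<Longrightarrow> \<sigma> + h \<le> T \<Longrightarrow>
      norm (E \<sigma> (integral {0..h} (\<lambda>s. \<psi> s *\<^sub>R (E (h - s) x - x)))) \<le> M * norm x * h ^ 3 / \<sigma>"
proof -
  let ?g = "\<lambda>s. \<psi> s *\<^sub>R (E (h - s) x - x)"
  have cont: "continuous_on {0..h} ?g"
    using h \<psi> by (intro continuous_intros continuous_on_E_apply)
  have "norm (integral {0..h} ?g) \<le> (h * (2 * M * norm x)) * (h - 0)"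
  proof (rule integral_bound[OF h(1) cont])
    fix s assume s: "s \<in> {0..h}"
    have "norm (E (h - s) x - x) \<le> norm (E (h - s) x) + norm x" by (rule norm_triangle_ineq4)
    also have "\<dots> \<le> M * norm x + M * norm x"
      using s h M_ge_1 by (intro add_mono E_apply_bound) (auto simp: mult_le_cancel_right1)
    finally show "norm (?g s) \<le> h * (2 * M * norm x)"
      using bspec[OF \<psi>(2) s] h by (simp add: mult_mono)
  qed
  then show "norm (integral {0..h} ?g) \<le> 2 * M * norm x * h\<^sup>2"
    by (simp add: power2_eq_square algebra_simps)
  show "norm (E \<sigma> (integral {0..h} ?g)) \<le> M * norm x * h ^ 3 / \<sigma>" if \<sigma>: "0 < \<sigma>" "\<sigma> + h \<le> T"
  proof -
    have "E \<sigma> (integral {0..h} ?g) = integral {0..h} (\<lambda>s. E \<sigma> (?g s))"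
      by (rule integral_linear[OF integrable_continuous_real[OF cont] blinfun.bounded_linear_right,
            unfolded o_def, symmetric])
    also have "norm \<dots> \<le> (h * (M * h / \<sigma> * norm x)) * (h - 0)"
    proof (rule integral_bound[OF h(1)])
      show "continuous_on {0..h} (\<lambda>s. E \<sigma> (?g s))"
        by (rule continuous_on_compose2[OF linear_continuous_on[OF blinfun.bounded_linear_right] cont subset_UNIV])
      fix s assume s: "s \<in> {0..h}"
      have "norm (E \<sigma> (E (h - s) x - x)) \<le> M * (h - s) / \<sigma> * norm x"
        using s \<sigma> by (intro E_smoothing) auto
      also have "\<dots> \<le> M * h / \<sigma> * norm x"
        using s \<sigma> M_ge_1 by (intro mult_right_mono divide_right_mono mult_left_mono) auto
      finally have "\<bar>\<psi> s\<bar> * norm (E \<sigma> (E (h - s) x - x)) \<le> h * (M * h / \<sigma> * norm x)"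
        using bspec[OF \<psi>(2) s] h by (intro mult_mono) auto
      then show "norm (E \<sigma> (?g s)) \<le> h * (M * h / \<sigma> * norm x)"
        by (simp add: blinfun.scaleR_right)
    qed
    also have "\<dots> = M * norm x * h ^ 3 / \<sigma>" by (simp add: power3_eq_cube)
    finally show ?thesis .
  qed
qed

text \<open>The part of the local error that is of order two only.\<close>

definition defect :: "real \<Rightarrow> real \<Rightarrow> 'x" where
  "defect t h = (h\<^sup>2 / 8) *\<^sub>R (E h (f' (c t) (f (c t))) - f' (c t) (f (c t)))
     + integral {0..h} (\<lambda>s. (h / 2 - s) *\<^sub>R (E (h - s) (a t) - a t))
     - integral {0..h} (\<lambda>s. s *\<^sub>R (E (h - s) (f' (c t) (c' t)) - f' (c t) (c' t)))"

lemma f'_apply_bound: "t \<in> {0..T} \<Longrightarrow> norm y \<le> K \<Longrightarrow> norm (f' (c t) y) \<le> K\<^sup>2"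
  using f'_c_bound[of t] K_ge_1
  by (intro order_trans[OF norm_blinfun]) (auto simp: power2_eq_square intro!: mult_mono)

text \<open>The first bound is for the most recent step, whose defect has not been propagated; the
  second is for all earlier ones.\<close>

lemma defect_bound:
  assumes v: "valid t h"
  shows "norm (defect t h) \<le> 5 * M * K\<^sup>2 * h\<^sup>2"
    and "0 < \<sigma> \<Longrightarrow> \<sigma> + h \<le> T \<Longrightarrow> norm (E \<sigma> (defect t h)) \<le> 3 * M * K\<^sup>2 * h ^ 3 / \<sigma>"
proof -
  note v' = validD[OF v]
  let ?k = "f' (c t) (f (c t))" and ?r = "f' (c t) (c' t)"
  let ?Q1 = "(h\<^sup>2 / 8) *\<^sub>R (E h ?k - ?k)"
  let ?Q2 = "integral {0..h} (\<lambda>s. (h / 2 - s) *\<^sub>R (E (h - s) (a t) - a t))"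
  let ?Q3 = "integral {0..h} (\<lambda>s. s *\<^sub>R (E (h - s) ?r - ?r))"
  have K: "K \<le> K\<^sup>2" using K_ge_1 by (simp add: power2_eq_square)
  have k: "norm ?k \<le> K\<^sup>2" and r: "norm ?r \<le> K\<^sup>2" and a: "norm (a t) \<le> K\<^sup>2"
    using f'_apply_bound f_c_bound c'_bound a_bound[of t] v' K by auto
  have \<psi>: "continuous_on {0..h} (\<lambda>s. h / 2 - s)" "\<forall>s\<in>{0..h}. \<bar>h / 2 - s\<bar> \<le> h"
    "continuous_on {0..h} (\<lambda>s. s)" "\<forall>s\<in>{0..h}. \<bar>s\<bar> \<le> h"
    by (auto intro!: continuous_intros)
  note Q2 = smoothing_defect[OF v'(3,4) \<psi>(1,2), where x = "a t"]
  note Q3 = smoothing_defect[OF v'(3,4) \<psi>(3,4), where x = ?r]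
  have Q1: "norm ?Q1 \<le> M * K\<^sup>2 * h\<^sup>2"
  proof -
    have "norm (E h ?k - ?k) \<le> norm (E h ?k) + norm ?k" by (rule norm_triangle_ineq4)
    also have "\<dots> \<le> M * norm ?k + M * norm ?k"
      using v' M_ge_1 by (intro add_mono E_apply_bound) (auto simp: mult_le_cancel_right1)
    also have "\<dots> \<le> M * K\<^sup>2 + M * K\<^sup>2" using k M_ge_1 by (intro add_mono mult_left_mono) auto
    finally have "h\<^sup>2 / 8 * norm (E h ?k - ?k) \<le> h\<^sup>2 / 8 * (2 * (M * K\<^sup>2))"
      by (intro mult_left_mono) auto
    also have "\<dots> \<le> h\<^sup>2 * (M * K\<^sup>2)" using M_ge_1 by simp
    finally show ?thesis by (simp add: mult.commute)
  qed
  have "norm (defect t h) \<le> norm ?Q1 + norm ?Q2 + norm ?Q3"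
    unfolding defect_def
    by (rule order_trans[OF norm_triangle_ineq4 add_right_mono[OF norm_triangle_ineq]])
  also have "\<dots> \<le> M * K\<^sup>2 * h\<^sup>2 + 2 * M * K\<^sup>2 * h\<^sup>2 + 2 * M * K\<^sup>2 * h\<^sup>2"
  proof (intro add_mono Q1)
    have "2 * M * y * h\<^sup>2 \<le> 2 * M * K\<^sup>2 * h\<^sup>2" if "y \<le> K\<^sup>2" for y
      using that M_ge_1 by (intro mult_right_mono mult_left_mono) auto
    with Q2(1) Q3(1) a r show "norm ?Q2 \<le> 2 * M * K\<^sup>2 * h\<^sup>2" "norm ?Q3 \<le> 2 * M * K\<^sup>2 * h\<^sup>2"
      by (meson order_trans)+
  qed
  finally show "norm (defect t h) \<le> 5 * M * K\<^sup>2 * h\<^sup>2" by simp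
  assume \<sigma>: "0 < \<sigma>" "\<sigma> + h \<le> T"
  have mono: "M * y * h ^ 3 / \<sigma> \<le> M * K\<^sup>2 * h ^ 3 / \<sigma>" if "y \<le> K\<^sup>2" for y
    using that M_ge_1 \<sigma> v' by (intro divide_right_mono mult_right_mono mult_left_mono) auto
  have "norm (E \<sigma> ?Q1) \<le> h\<^sup>2 / 8 * (M * h / \<sigma> * norm ?k)"
    using mult_left_mono[OF E_smoothing[OF \<sigma>(1) v'(3) \<sigma>(2), of ?k], of "h\<^sup>2 / 8"]
    by (simp add: blinfun.scaleR_right)
  also have "\<dots> \<le> h\<^sup>2 * (M * h / \<sigma> * norm ?k)"
    using v' M_ge_1 \<sigma> by (intro mult_right_mono) auto
  also have "\<dots> = M * norm ?k * h ^ 3 / \<sigma>" by (simp add: power2_eq_square power3_eq_cube)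
  also have "\<dots> \<le> M * K\<^sup>2 * h ^ 3 / \<sigma>" by (rule mono[OF k])
  finally have EQ1: "norm (E \<sigma> ?Q1) \<le> M * K\<^sup>2 * h ^ 3 / \<sigma>" .
  have "norm (E \<sigma> (defect t h)) \<le> norm (E \<sigma> ?Q1) + norm (E \<sigma> ?Q2) + norm (E \<sigma> ?Q3)"
    unfolding defect_def blinfun.diff_right blinfun.add_right
    by (rule order_trans[OF norm_triangle_ineq4 add_right_mono[OF norm_triangle_ineq]])
  also have "\<dots> \<le> M * K\<^sup>2 * h ^ 3 / \<sigma> + M * K\<^sup>2 * h ^ 3 / \<sigma> + M * K\<^sup>2 * h ^ 3 / \<sigma>"
    by (intro add_mono EQ1 order_trans[OF Q2(2)[OF \<sigma>] mono[OF a]] order_trans[OF Q3(2)[OF \<sigma>] mono[OF r]])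
  finally show "norm (E \<sigma> (defect t h)) \<le> 3 * M * K\<^sup>2 * h ^ 3 / \<sigma>" by simp
qed

section \<open>Expansion of a step that starts on the exact solution\<close>

lemma fc_cont:
  assumes "0 \<le> t" "t + h \<le> T"
  shows "continuous_on {0..h} (\<lambda>s. f (c (t + s)))"
proof -
  have "continuous_on {0..T} (\<lambda>t. f (c t))"
    unfolding continuous_on_eq_continuous_within
  proof
    fix t assume t: "t \<in> {0..T}"
    have "continuous (at t within {0..T}) c"
      using c_cont t by (simp add: continuous_on_eq_continuous_within)
    moreover have "isCont f (c t)"
      using reaction_ball.f_deriv[OF reaction[OF t], of "c t"] r_pos has_derivative_continuous by force
    ultimately show "continuous (at t within {0..T}) (\<lambda>t. f (c t))"
      by (rule continuous_within_compose3[rotated])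
  qed
  then show ?thesis
    by (rule continuous_on_compose2) (use assms in \<open>auto intro!: continuous_intros\<close>)
qed

text \<open>The parameter set for the uniform order symbols. The intermediate and final values are
  components of the parameter because the flow is a relation and not a function.\<close>

definition exact_steps :: "(real \<times> real \<times> 'x \<times> 'x) set" where
  "exact_steps = {(t, h, w, z). valid t h \<and> flow_f U f (h / 2) (c t) w \<and>
     flow_f U f (h / 2) (parabolic_step t h w) z}"

text \<open>Write \<open>k = f'(u) f(u)\<close> and \<open>r' = f'(u) u'\<close>. The coefficients
  of \<open>k\<close> are \<open>h\<^sup>2/8\<close> under \<open>E h\<close> from the first half
  flow, \<open>h\<^sup>2/8\<close> from the second, and \<open>- h\<^sup>2/4\<close> from
  \<open>(h/2) f(w2)\<close>; together they give \<open>(h\<^sup>2/8) (E h - 1) k\<close>. The same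
  \<open>(h/2) f(w2)\<close> supplies \<open>(h\<^sup>2/2) r'\<close>, which offsets the integral of
  \<open>s E(h-s) r'\<close>, while the weight \<open>h/2 - s\<close> has mean zero.\<close>

lemma local_error:
  "\<exists>C. \<forall>t h z. valid t h \<longrightarrow> splitting_step t h (c t) z \<longrightarrow>
     norm (z - c (t + h) - defect t h) \<le> C * h ^ 3"
proof -
  let ?P = exact_steps
  define tt :: "real \<times> real \<times> 'x \<times> 'x \<Rightarrow> real" where "tt = fst"
  define hh :: "real \<times> real \<times> 'x \<times> 'x \<Rightarrow> real" where "hh p = fst (snd p)" for p
  define w1 :: "real \<times> real \<times> 'x \<times> 'x \<Rightarrow> 'x" where "w1 p = fst (snd (snd p))" for p
  define z :: "real \<times> real \<times> 'x \<times> 'x \<Rightarrow> 'x" where "z p = snd (snd (snd p))" for p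
  define x where "x p = c (tt p)" for p
  define x' where "x' p = c' (tt p)" for p
  define a' where "a' p = a (tt p)" for p
  define L where "L p = f' (x p)" for p
  define w2 where "w2 p = parabolic_step (tt p) (hh p) (w1 p)" for p
  define xp where "xp p = c (tt p + hh p)" for p
  define k where "k p = L p (f (x p))" for p
  define r' where "r' p = L p (x' p)" for p
  define J where "J p \<phi> = integral {0..hh p} (\<lambda>s. E (hh p - s) (\<phi> s))" for p \<phi>
  define I2 where "I2 p = J p (\<lambda>s. (hh p / 2 - s) *\<^sub>R a' p)" for p
  define I3 where "I3 p = J p (\<lambda>s. f (c (tt p + s)) - f (x p))" for p
  let ?O = "unif_bigO ?P hh"
  have v: "valid (tt p) (hh p)" if "p \<in> ?P" for p
    using that by (auto simp: exact_steps_def tt_def hh_def)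
  note v' = validD[OF v]
  have w1: "flow_f U f (hh p / 2) (x p) (w1 p)" and z: "flow_f U f (hh p / 2) (w2 p) (z p)" if "p \<in> ?P" for p
    using that by (auto simp: exact_steps_def tt_def hh_def w1_def z_def x_def w2_def)
  have x_near: "norm (x p - c (tt p)) \<le> r / (8 * M)" for p
    using r_pos M_ge_1 by (simp add: x_def)
  have w2_ball: "w2 p \<in> cball (x p) (r / 2)" if p: "p \<in> ?P" for p
    using parabolic_step_near[OF v[OF p] x_near first_flow[OF v[OF p] x_near w1[OF p]]]
    by (simp add: w2_def x_def)
  have w2_ball': "w2 p \<in> cball (x p) r" if p: "p \<in> ?P" for p
    using w2_ball[OF p] r_pos by simp
  have rb: "reaction_ball U f f' (x p) r K" if p: "p \<in> ?P" for p
    using reaction[OF v'(2)[OF p]] by (simp add: x_def)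
  have x_ball: "x p \<in> cball (x p) (r / 2)" "x p \<in> cball (x p) r" for p using r_pos by auto
  have h0: "0 \<le> hh p" if "p \<in> ?P" for p using v'(3)[OF that] .
  have h1: "0 \<le> hh p \<and> hh p \<le> 1" if "p \<in> ?P" for p using v'(3,5)[OF that] by simp
  have L_bound: "norm (L p) \<le> K" if p: "p \<in> ?P" for p
    using f'_c_bound[OF v'(2)[OF p]] by (simp add: L_def x_def)
  have E_bound': "norm (E (hh p)) \<le> M" if p: "p \<in> ?P" for p
    using E_bound[OF v'(3,4)[OF p]] .
  have fx: "norm (f (x p)) \<le> K" if p: "p \<in> ?P" for p
    using f_c_bound[OF v'(2)[OF p]] by (simp add: x_def)
  note O_up = unif_bigO_mono[OF _ _ h1]
  have O_L: "?O n (\<lambda>p. L p (S p))" if "?O n S" for n and S :: "_ \<Rightarrow> 'x"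
    by (rule unif_bigO_apply[OF that L_bound h0])
  have O_E: "?O n (\<lambda>p. E (hh p) (S p))" if "?O n S" for n and S :: "_ \<Rightarrow> 'x"
    by (rule unif_bigO_apply[OF that E_bound' h0])
  have O_f: "?O 0 (\<lambda>p. f (x p))" using fx by (intro unif_bigOI[of _ _ K]) simp
  have O_k: "?O 0 k" unfolding k_def by (rule O_L[OF O_f])
  have O_x': "?O 0 x'" using c'_bound[OF v'(2)] by (intro unif_bigOI[of _ _ K]) (simp add: x'_def)
  have cont_f: "continuous_on {0..hh p} (\<lambda>s. f (c (tt p + s)) - f (x p))" if p: "p \<in> ?P" for p
    by (intro continuous_intros fc_cont v'(1,8)[OF p])

  have J_diff: "J p (\<lambda>s. \<phi> s - \<psi> s) = J p \<phi> - J p \<psi>"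
    and J_add: "J p (\<lambda>s. \<phi> s + \<psi> s) = J p \<phi> + J p \<psi>"
    if p: "p \<in> ?P" and cont: "continuous_on {0..hh p} \<phi>" "continuous_on {0..hh p} \<psi>" for p \<phi> \<psi>
    unfolding J_def blinfun.diff_right blinfun.add_right
    by (intro integral_diff integral_add integrable_E_apply v'(4)[OF p] cont)+

  \<comment> \<open>The quadratic coefficient is \<open>(h/2)\<^sup>2 / 2 = h\<^sup>2 / 8\<close>,
    the flow running over half a step.\<close>
  have R1: "?O 3 (\<lambda>p. w1 p - x p - (hh p / 2) *\<^sub>R f (x p) - ((hh p)\<^sup>2 / 8) *\<^sub>R k p)" (is "unif_bigO _ _ _ ?R1")
  proof (rule unif_bigOI)
    fix p assume p: "p \<in> ?P"
    show "norm (?R1 p) \<le> (2 * K ^ 3 / 8) * hh p ^ 3"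
      using reaction_ball.flow_f_expansion(3)[OF rb[OF p] valid_half(1,2)[OF v[OF p]] x_ball(1) w1[OF p]]
      by (simp add: k_def L_def power_divide)
  qed
  have I2: "?O 2 I2"
  proof (rule unif_bigOI)
    fix p assume p: "p \<in> ?P"
    have "norm (I2 p) \<le> M * (hh p * K) * hh p"
      unfolding I2_def J_def
    proof (rule integral_E_bound[OF v'(3,4)[OF p]])
      fix s assume "s \<in> {0..hh p}"
      then have "\<bar>hh p / 2 - s\<bar> \<le> hh p" by auto
      moreover have "norm (a' p) \<le> K" using a_bound[OF v'(2)[OF p]] by (simp add: a'_def)
      ultimately show "norm ((hh p / 2 - s) *\<^sub>R a' p) \<le> hh p * K"
        using h0[OF p] by (simp add: mult_mono)
    qed (intro continuous_intros)
    then show "norm (I2 p) \<le> (M * K) * hh p ^ 2" by (simp add: power2_eq_square algebra_simps)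
  qed
  have R7: "?O 3 (\<lambda>p. I3 p - J p (\<lambda>s. s *\<^sub>R r' p))" (is "unif_bigO _ _ _ ?R7")
  proof (rule unif_bigOI)
    fix p assume p: "p \<in> ?P"
    have "?R7 p = J p (\<lambda>s. f (c (tt p + s)) - f (x p) - s *\<^sub>R r' p)"
      unfolding I3_def by (intro J_diff[symmetric] p cont_f continuous_intros)
    also have "norm \<dots> \<le> M * (K * (hh p)\<^sup>2) * hh p"
      unfolding J_def
    proof (rule integral_E_bound[OF v'(3,4)[OF p]])
      show "continuous_on {0..hh p} (\<lambda>s. f (c (tt p + s)) - f (x p) - s *\<^sub>R r' p)"
        by (intro continuous_on_diff[OF cont_f[OF p]] continuous_intros)
      fix s assume s: "s \<in> {0..hh p}"
      have "norm (f (c (tt p + s)) - f (x p) - s *\<^sub>R r' p) \<le> K * s\<^sup>2"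
        unfolding x_def r'_def L_def x'_def
        using s v'(1,8)[OF p] by (intro fc_taylor) auto
      also have "\<dots> \<le> K * (hh p)\<^sup>2" using s K_ge_1 by (intro mult_left_mono power_mono) auto
      finally show "norm (f (c (tt p + s)) - f (x p) - s *\<^sub>R r' p) \<le> K * (hh p)\<^sup>2" .
    qed
    also have "\<dots> = (M * K) * hh p ^ 3" by (simp add: power2_eq_square power3_eq_cube)
    finally show "norm (?R7 p) \<le> (M * K) * hh p ^ 3" .
  qed
  have "?O 2 (\<lambda>p. J p (\<lambda>s. s *\<^sub>R r' p))"
  proof (rule unif_bigOI)
    fix p assume p: "p \<in> ?P"
    have "norm (J p (\<lambda>s. s *\<^sub>R r' p)) \<le> M * (hh p * K\<^sup>2) * hh p"
      unfolding J_def
    proof (rule integral_E_bound[OF v'(3,4)[OF p]])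
      fix s assume s: "s \<in> {0..hh p}"
      have "norm (r' p) \<le> K\<^sup>2"
        using f'_apply_bound[OF v'(2)[OF p] c'_bound[OF v'(2)[OF p]]] by (simp add: r'_def L_def x_def x'_def)
      then show "norm (s *\<^sub>R r' p) \<le> hh p * K\<^sup>2" using s by (simp add: mult_mono)
    qed (intro continuous_intros)
    then show "norm (J p (\<lambda>s. s *\<^sub>R r' p)) \<le> (M * K\<^sup>2) * hh p ^ 2"
      by (simp add: power2_eq_square algebra_simps)
  qed
  from unif_bigO_add[OF this O_up[OF R7, of 2]] have I3: "?O 2 I3"
    by (rule unif_bigO_cong) simp_all
  \<comment> \<open>Exact and numerical parabolic evolution use the same frozen \<open>u(t)\<close>,
    so the Duhamel integrals of \<open>x'\<close> cancel on subtraction. What remains under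
    \<open>E\<close> is already of order two, by the choice of boundary data.\<close>
  have w2_eq: "w2 p = xp p - (hh p / 2) *\<^sub>R f (x p)
      + E (hh p) (((hh p)\<^sup>2 / 8) *\<^sub>R k p + ?R1 p) + I2 p - I3 p" if p: "p \<in> ?P" for p
  proof -
    have cont: "continuous_on {0..hh p} (\<lambda>s. x' p)" "continuous_on {0..hh p} (\<lambda>s. (hh p / 2 - s) *\<^sub>R a' p)"
      by (intro continuous_intros)+
    have "xp p = x p + J p (\<lambda>s. x' p + (f (c (tt p + s)) - f (x p)))"
      using exact[OF v'(1,3,8)[OF p]] by (simp add: xp_def x_def x'_def J_def)
    also have "J p (\<lambda>s. x' p + (f (c (tt p + s)) - f (x p))) = J p (\<lambda>s. x' p) + I3 p"
      unfolding I3_def by (intro J_add p cont cont_f)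
    finally have 1: "xp p = x p + J p (\<lambda>s. x' p) + I3 p" by simp
    have "w2 p = x p - (hh p / 2) *\<^sub>R f (x p) + E (hh p) (w1 p - x p - (hh p / 2) *\<^sub>R f (x p))
        + J p (\<lambda>s. x' p + (hh p / 2 - s) *\<^sub>R a' p)"
      by (simp add: w2_def parabolic_step_def x_def x'_def a'_def J_def)
    also have "J p (\<lambda>s. x' p + (hh p / 2 - s) *\<^sub>R a' p) = J p (\<lambda>s. x' p) + I2 p"
      unfolding I2_def by (intro J_add p cont)
    finally show ?thesis using 1 by simp
  qed
  have "?O 2 (\<lambda>p. xp p - x p - hh p *\<^sub>R x' p)"
    using c_taylor[OF v'(1,3,8)] by (intro unif_bigOI[of _ _ K]) (simp add: xp_def x_def x'_def)
  moreover have "?O 2 (\<lambda>p. ((hh p)\<^sup>2 / 8) *\<^sub>R k p)"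
    using unif_bigO_scaleR[OF O_k h0, of 2 "1 / 8"] by simp
  then have "?O 2 (\<lambda>p. E (hh p) (((hh p)\<^sup>2 / 8) *\<^sub>R k p + ?R1 p))"
    by (intro O_E unif_bigO_add[OF _ O_up[OF R1]]) simp_all
  ultimately have "?O 2 (\<lambda>p. (xp p - x p - hh p *\<^sub>R x' p)
      + E (hh p) (((hh p)\<^sup>2 / 8) *\<^sub>R k p + ?R1 p) + I2 p - I3 p)"
    by (rule unif_bigO_diff[OF unif_bigO_add[OF unif_bigO_add I2] I3])
  \<comment> \<open>The term \<open>- (h/2) f\<close> is the trace of the boundary correction; it is
    responsible for the \<open>- (h/2) k\<close> that appears in the expansion of
    \<open>f (w2 p)\<close>.\<close>
  then have R2: "?O 2 (\<lambda>p. w2 p - x p - (hh p *\<^sub>R x' p - (hh p / 2) *\<^sub>R f (x p)))" (is "unif_bigO _ _ _ ?R2")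
    by (rule unif_bigO_cong) (simp add: w2_eq)
  have "?O 1 (\<lambda>p. hh p *\<^sub>R x' p - (hh p / 2) *\<^sub>R f (x p))"
    using unif_bigO_diff[OF unif_bigO_scaleR[OF O_x' h0, of 1 1] unif_bigO_scaleR[OF O_f h0, of 1 "1/2"]]
    by simp
  from unif_bigO_add[OF this O_up[OF R2]] have O_w2: "?O 1 (\<lambda>p. w2 p - x p)"
    by (simp add: unif_bigO_cong)
  have "?O (1 + 1) (\<lambda>p. f (w2 p) - f (x p) - L p (w2 p - x p))"
  proof (rule unif_bigO_bilinear[OF _ O_w2 _ h0])
    show "?O 1 (\<lambda>p. K *\<^sub>R (w2 p - x p))"
      using unif_bigO_scaleR[OF O_w2 h0, of 0 K] by simp
    fix p assume p: "p \<in> ?P"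
    show "norm (f (w2 p) - f (x p) - L p (w2 p - x p)) \<le> norm (K *\<^sub>R (w2 p - x p)) * norm (w2 p - x p)"
      using reaction_ball.f_taylor[OF rb[OF p] x_ball(2) w2_ball'[OF p]] K_ge_1
      by (simp add: L_def power2_eq_square)
  qed
  then have R3: "?O 2 (\<lambda>p. f (w2 p) - f (x p) - L p (w2 p - x p))"
    by (simp only: one_add_one)
  from unif_bigO_add[OF R3 O_L[OF R2]]
  have R4: "?O 2 (\<lambda>p. f (w2 p) - f (x p) - hh p *\<^sub>R r' p + (hh p / 2) *\<^sub>R k p)" (is "unif_bigO _ _ _ ?R4")
    unfolding r'_def k_def blinfun.diff_right blinfun.scaleR_right by (rule unif_bigO_cong) simp
  have O_fdiff: "?O 1 (\<lambda>p. f (w2 p) - f (x p))"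
  proof (rule unif_bigO_cong[OF unif_bigO_add[OF O_up[OF R3] O_L[OF O_w2]]])
  qed simp_all
  have R5: "?O 1 (\<lambda>p. f' (w2 p) (f (w2 p)) - k p)" (is "unif_bigO _ _ _ ?R5")
  proof -
    have "?O (1 + 0) (\<lambda>p. (f' (w2 p) - L p) (f (w2 p)))"
    proof (rule unif_bigO_bilinear[OF _ _ _ h0])
      show "?O 1 (\<lambda>p. K *\<^sub>R (w2 p - x p))"
        using unif_bigO_scaleR[OF O_w2 h0, of 0 K] by simp
      show "?O 0 (\<lambda>p. f (w2 p))"
        using reaction_ball.f_bound[OF rb w2_ball'] by (intro unif_bigOI[of _ _ K]) simp
      fix p assume p: "p \<in> ?P"
      have "norm (f' (w2 p) - L p) \<le> norm (K *\<^sub>R (w2 p - x p))"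
        using reaction_ball.f'_lipschitz[OF rb[OF p] w2_ball'[OF p] x_ball(2)] K_ge_1 by (simp add: L_def)
      then show "norm ((f' (w2 p) - L p) (f (w2 p))) \<le> norm (K *\<^sub>R (w2 p - x p)) * norm (f (w2 p))"
        by (intro order_trans[OF norm_blinfun mult_right_mono]) auto
    qed
    from unif_bigO_add[OF this[unfolded add_0_right] O_L[OF O_fdiff]] show ?thesis
      unfolding k_def blinfun.diff_right blinfun.diff_left by (rule unif_bigO_cong) simp
  qed
  have R6: "?O 3 (\<lambda>p. z p - w2 p - (hh p / 2) *\<^sub>R f (w2 p) - ((hh p)\<^sup>2 / 8) *\<^sub>R f' (w2 p) (f (w2 p)))"
    (is "unif_bigO _ _ _ ?R6")
  proof (rule unif_bigOI)
    fix p assume p: "p \<in> ?P"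
    show "norm (?R6 p) \<le> (2 * K ^ 3 / 8) * hh p ^ 3"
      using reaction_ball.flow_f_expansion(3)[OF rb[OF p] valid_half(1,2)[OF v[OF p]] w2_ball[OF p] z[OF p]]
      by (simp add: power_divide)
  qed
  have "?O 3 (\<lambda>p. (hh p / 2) *\<^sub>R ?R4 p)" "?O 3 (\<lambda>p. ((hh p)\<^sup>2 / 8) *\<^sub>R ?R5 p)"
    using unif_bigO_scaleR[OF R4 h0, of 1 "1/2"] unif_bigO_scaleR[OF R5 h0, of 2 "1/8"]
    by (simp_all add: eval_nat_numeral)
  note unif_bigO_add[OF unif_bigO_add[OF unif_bigO_add[OF unif_bigO_diff
        [OF O_E[OF R1] R7] this(1)] this(2)] R6]
  then have "?O 3 (\<lambda>p. z p - xp p - defect (tt p) (hh p))"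
  proof (rule unif_bigO_cong)
    fix p assume p: "p \<in> ?P"
    \<comment> \<open>The weight \<open>h/2 - s\<close> integrates to zero over the step, so
      subtracting the constant vector changes nothing.\<close>
    have D2: "integral {0..hh p} (\<lambda>s. (hh p / 2 - s) *\<^sub>R (E (hh p - s) (a' p) - a' p)) = I2 p"
    proof -
      have "((\<lambda>s. (hh p / 2 - s) *\<^sub>R a' p) has_integral 
          ((hh p / 2 * hh p - (hh p)\<^sup>2 / 2) *\<^sub>R a' p - (hh p / 2 * 0 - 0\<^sup>2 / 2) *\<^sub>R a' p)) {0..hh p}"
        by (rule fundamental_theorem_of_calculus[OF h0[OF p]]) (auto intro!: derivative_eq_intros)
      then have "integral {0..hh p} (\<lambda>s. (hh p / 2 - s) *\<^sub>R a' p) = 0"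
        by (simp add: integral_unique power2_eq_square)
      then show ?thesis
        unfolding I2_def J_def scaleR_diff_right blinfun.scaleR_right
        by (subst integral_diff)
          (auto intro!: integrable_continuous_real continuous_intros continuous_on_E_apply v'(4)[OF p])
    qed
    have D3: "integral {0..hh p} (\<lambda>s. s *\<^sub>R (E (hh p - s) (r' p) - r' p))
        = J p (\<lambda>s. s *\<^sub>R r' p) - ((hh p)\<^sup>2 / 2) *\<^sub>R r' p"
    proof -
      have "((\<lambda>s. s *\<^sub>R r' p) has_integral ((hh p)\<^sup>2 / 2) *\<^sub>R r' p - (0\<^sup>2 / 2) *\<^sub>R r' p) {0..hh p}"
        by (rule fundamental_theorem_of_calculus[OF h0[OF p]]) (auto intro!: derivative_eq_intros)
      then have "integral {0..hh p} (\<lambda>s. s *\<^sub>R r' p) = ((hh p)\<^sup>2 / 2) *\<^sub>R r' p"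
        by (simp add: integral_unique)
      then show ?thesis
        unfolding J_def scaleR_diff_right blinfun.scaleR_right
        by (subst integral_diff)
          (auto intro!: integrable_continuous_real continuous_intros continuous_on_E_apply v'(4)[OF p])
    qed
    have defect: "defect (tt p) (hh p) = ((hh p)\<^sup>2 / 8) *\<^sub>R (E (hh p) (k p) - k p) + I2 p
        - (J p (\<lambda>s. s *\<^sub>R r' p) - ((hh p)\<^sup>2 / 2) *\<^sub>R r' p)"
      unfolding D2[symmetric] D3[symmetric]
      by (simp add: defect_def k_def L_def x_def x'_def r'_def a'_def)
    \<comment> \<open>Pure algebra in arbitrary vectors, stated apart from the analytic quantities.
      The only arithmetic is \<open>h\<^sup>2/4 = h\<^sup>2/8 + h\<^sup>2/8\<close>, matching the
      two half flows.\<close>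
    have identity: "zp - y - ((h\<^sup>2 / 8) *\<^sub>R (Ek - kp) + i2 - (j - (h\<^sup>2 / 2) *\<^sub>R rp)) =
        ER - (i3 - j) + (h / 2) *\<^sub>R (fw - fx - h *\<^sub>R rp + (h / 2) *\<^sub>R kp) + (h\<^sup>2 / 8) *\<^sub>R (fk - kp)
        + (zp - w - (h / 2) *\<^sub>R fw - (h\<^sup>2 / 8) *\<^sub>R fk)"
      if w: "w = y - (h / 2) *\<^sub>R fx + ((h\<^sup>2 / 8) *\<^sub>R Ek + ER) + i2 - i3"
      for zp y w Ek kp i2 j rp ER i3 fw fx fk :: 'x and h
    proof -
      have "(h / 2) *\<^sub>R ((h / 2) *\<^sub>R kp) = (h\<^sup>2 / 8) *\<^sub>R kp + (h\<^sup>2 / 8) *\<^sub>R kp"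
        by (simp add: scaleR_left_distrib[symmetric] power2_eq_square)
      moreover have "(h / 2) *\<^sub>R (h *\<^sub>R rp) = (h\<^sup>2 / 2) *\<^sub>R rp" by (simp add: power2_eq_square)
      ultimately show ?thesis
        unfolding w scaleR_add_right[of "h / 2"] scaleR_diff_right by (simp add: algebra_simps)
    qed
    show "z p - xp p - defect (tt p) (hh p) =
        E (hh p) (?R1 p) - ?R7 p + (hh p / 2) *\<^sub>R ?R4 p + ((hh p)\<^sup>2 / 8) *\<^sub>R ?R5 p + ?R6 p"
      unfolding defect
      by (rule identity) (use w2_eq[OF p] in \<open>simp only: blinfun.add_right blinfun.scaleR_right\<close>)
  qed
  then obtain C where C: "\<And>p. p \<in> ?P \<Longrightarrow> norm (z p - xp p - defect (tt p) (hh p)) \<le> C * hh p ^ 3"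
    by (auto simp: unif_bigO_def)
  have "norm (\<zeta> - c (t + h) - defect t h) \<le> C * h ^ 3" if st: "valid t h" "splitting_step t h (c t) \<zeta>" for t h \<zeta>
  proof -
    obtain w where "(t, h, w, \<zeta>) \<in> ?P"
      using st by (auto simp: splitting_step_def exact_steps_def)
    from C[OF this] show ?thesis by (simp add: tt_def hh_def z_def xp_def)
  qed
  then show ?thesis by blast
qed

end


subsection \<open>Global error\<close>

text \<open>The majorant \<open>B * (1 + a) ^ m\<close> satisfies the recursion with equality, by
  the geometric sum.\<close>

lemma discrete_gronwall:
  fixes g :: "nat \<Rightarrow> real"
  assumes "0 \<le> a" and g: "\<And>m. m \<le> n \<Longrightarrow> g m \<le> a * (\<Sum>j<m. g j) + B"
  shows "m \<le> n \<Longrightarrow> g m \<le> B * (1 + a) ^ m"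
proof (induction m rule: less_induct)
  case (less m)
  have geom: "a * (\<Sum>j<m. (1 + a) ^ j) + 1 = (1 + a) ^ m" for m
    by (induction m) (simp_all add: algebra_simps)
  have "g m \<le> a * (\<Sum>j<m. g j) + B" using g less.prems by blast
  also have "\<dots> \<le> a * (\<Sum>j<m. B * (1 + a) ^ j) + B"
    using less \<open>0 \<le> a\<close> by (intro add_mono mult_left_mono sum_mono) auto
  also have "\<dots> = B * (a * (\<Sum>j<m. (1 + a) ^ j) + 1)"
    by (simp add: sum_distrib_left[symmetric] algebra_simps)
  finally show ?case by (simp only: geom)
qed

lemma sum_inverse_le_ln:
  assumes "0 < m"
  shows "(\<Sum>i<m. 1 / real (Suc i)) \<le> 1 + ln (real m)"
proof -
  obtain k where k: "m = Suc k" using assms gr0_implies_Suc by blast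
  have "(harm (Suc k) :: real) - ln (real (Suc k)) \<le> harm (Suc 0) - ln (real (Suc 0))"
    using decseqD[OF decseq_harm_diff_ln, of 0 k] by simp
  then show ?thesis using k by (simp add: harm_altdef inverse_eq_divide)
qed

text \<open>Makes the claimed error bound small through \<open>h\<close> alone, as required to keep
  the iterates near the trajectory.\<close>

lemma power2_log_le:
  assumes "0 < h" "h \<le> (1::real)"
  shows "h\<^sup>2 * (1 + \<bar>ln h\<bar>) \<le> h"
proof -
  have "ln (1 / h) \<le> 1 / h - 1" using assms by (intro ln_le_minus_one) auto
  then have "1 + \<bar>ln h\<bar> \<le> 1 / h" using assms by (simp add: ln_div)
  then have "h\<^sup>2 * (1 + \<bar>ln h\<bar>) \<le> h\<^sup>2 * (1 / h)" by (intro mult_left_mono) auto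
  then show ?thesis using assms by (simp add: power2_eq_square)
qed

section \<open>Error recursion and bootstrap\<close>

context parabolic_problem
begin

definition trajectory :: "real \<Rightarrow> nat \<Rightarrow> (nat \<Rightarrow> 'x) \<Rightarrow> bool" where
  "trajectory h n un \<longleftrightarrow> un 0 = c 0 \<and> (\<forall>k<n. splitting_step (real k * h) h (un k) (un (Suc k)))"

lemma trajectory_mono: "trajectory h n un \<Longrightarrow> m \<le> n \<Longrightarrow> trajectory h m un"
  by (auto simp: trajectory_def)

lemma valid_grid:
  assumes "0 < h" "h \<le> h0" "real n * h \<le> T" "k < n"
  shows "valid (real k * h) h"
proof -
  have "real k * h + h = real (Suc k) * h" by (simp add: algebra_simps)
  also have "\<dots> \<le> real n * h" using assms by (intro mult_right_mono) auto
  finally show ?thesis using assms by (simp add: valid_def)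
qed

text \<open>Discrete Duhamel formula: a perturbation made in step \<open>j\<close> is propagated
  over the \<open>m - Suc j\<close> steps that follow, the last one over time 0.\<close>

lemma error_representation:
  assumes h: "0 < h" "real m * h \<le> T" and e0: "e 0 = 0"
    and e: "\<And>k. k < m \<Longrightarrow> e (Suc k) = E h (e k) + d k"
  shows "e m = (\<Sum>j<m. E (real (m - Suc j) * h) (d j))"
  using assms
proof (induction m)
  case (Suc m)
  have "real m * h \<le> real (Suc m) * h" using Suc.prems(1) by (intro mult_right_mono) auto
  with Suc.prems(2) have "real m * h \<le> T" by linarith
  then have IH: "e m = (\<Sum>j<m. E (real (m - Suc j) * h) (d j))"
    using Suc.prems(1,3,4) by (intro Suc.IH) auto
  have "E h (E (real (m - Suc j) * h) (d j)) = E (real (Suc m - Suc j) * h) (d j)" if "j < m" for j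
  proof -
    have "real (Suc m - Suc j) * h = h + real (m - Suc j) * h"
      using that by (simp add: of_nat_diff algebra_simps)
    moreover have "0 \<le> real (m - Suc j) * h" using Suc.prems(1) by simp
    ultimately have "E (real (Suc m - Suc j) * h) = E h o\<^sub>L E (real (m - Suc j) * h)"
      using E_add[of h "real (m - Suc j) * h"] Suc.prems(1) by (simp only: less_imp_le)
    then show ?thesis by (simp only: blinfun_apply_blinfun_compose)
  qed
  then have "E h (e m) = (\<Sum>j<m. E (real (Suc m - Suc j) * h) (d j))"
    unfolding IH by (simp add: blinfun.sum_right)
  moreover have "e (Suc m) = E h (e m) + d m" using Suc.prems(4) by blast
  ultimately show ?case by (simp add: E_0)
qed simp

text \<open>A defect that is \<open>i\<close> steps old contributes about
  \<open>h\<^sup>2 / (i + 1)\<close>. The harmonic sum is at most \<open>1 + ln m\<close>, and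
  \<open>m \<le> T / h\<close> turns this into the logarithms of \<open>T\<close> and
  \<open>h\<close>.\<close>

lemma defect_sum_bound:
  assumes h: "0 < h" "h \<le> h0" "real m * h \<le> T"
  shows "(\<Sum>j<m. norm (E (real (m - Suc j) * h) (defect (real j * h) h)))
    \<le> 10 * M * K\<^sup>2 * (1 + \<bar>ln T\<bar>) * (h\<^sup>2 * (1 + \<bar>ln h\<bar>))"
proof (cases "m = 0")
  case True
  then show ?thesis using M_ge_1 by simp
next
  case False
  have step: "norm (E (real (m - Suc j) * h) (defect (real j * h) h)) \<le> 10 * M * K\<^sup>2 * h\<^sup>2 * (1 / real (Suc (m - Suc j)))"
    if j: "j < m" for j
  proof -
    have v: "valid (real j * h) h" by (rule valid_grid[OF h j])
    define i where "i = m - Suc j"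
    have C: "0 \<le> M * K\<^sup>2 * h\<^sup>2" using M_ge_1 by simp
    have "norm (E (real i * h) (defect (real j * h) h)) \<le> 10 * M * K\<^sup>2 * h\<^sup>2 * (1 / real (Suc i))"
    proof (cases "i = 0")
      case True
      have "norm (defect (real j * h) h) \<le> 5 * M * K\<^sup>2 * h\<^sup>2" by (rule defect_bound(1)[OF v])
      also have "\<dots> \<le> 10 * M * K\<^sup>2 * h\<^sup>2" using C by simp
      finally show ?thesis using True by (simp add: E_0)
    next
      case False
      have "real i * h + h = real (m - j) * h" using j by (simp add: i_def of_nat_diff algebra_simps)
      also have "\<dots> \<le> real m * h" using h by (intro mult_right_mono) auto
      finally have "real i * h + h \<le> T" using h by simp
      then have "norm (E (real i * h) (defect (real j * h) h)) \<le> 3 * M * K\<^sup>2 * h ^ 3 / (real i * h)"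
        using False h by (intro defect_bound(2)[OF v]) auto
      also have "\<dots> = (M * K\<^sup>2 * h\<^sup>2) * (3 / real i)"
        using h by (simp add: power2_eq_square power3_eq_cube)
      \<comment> \<open>\<open>3 / i \<le> 6 / (i + 1)\<close> for positive \<open>i\<close>; the
        larger constant 10 serves both cases.\<close>
      also have "\<dots> \<le> (M * K\<^sup>2 * h\<^sup>2) * (10 / real (Suc i))"
        using False by (intro mult_left_mono C) (auto simp: field_simps)
      finally show ?thesis by (simp add: mult_ac)
    qed
    then show ?thesis by (simp add: i_def)
  qed
  have "(\<Sum>j<m. norm (E (real (m - Suc j) * h) (defect (real j * h) h)))
      \<le> (\<Sum>j<m. 10 * M * K\<^sup>2 * h\<^sup>2 * (1 / real (Suc (m - Suc j))))"
    by (intro sum_mono step) auto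
  also have "\<dots> = 10 * M * K\<^sup>2 * h\<^sup>2 * (\<Sum>j<m. 1 / real (Suc (m - Suc j)))"
    by (simp only: sum_distrib_left)
  also have "(\<Sum>j<m. 1 / real (Suc (m - Suc j))) = (\<Sum>i<m. 1 / real (Suc i))"
    by (rule sum.nat_diff_reindex[of "\<lambda>i. 1 / real (Suc i)"])
  also have "10 * M * K\<^sup>2 * h\<^sup>2 * (\<Sum>i<m. 1 / real (Suc i))
      \<le> 10 * M * K\<^sup>2 * h\<^sup>2 * ((1 + \<bar>ln T\<bar>) * (1 + \<bar>ln h\<bar>))"
  proof (rule mult_left_mono)
    have "(\<Sum>i<m. 1 / real (Suc i)) \<le> 1 + ln (real m)" using False by (intro sum_inverse_le_ln) simp
    also have "\<dots> \<le> (1 + \<bar>ln T\<bar>) * (1 + \<bar>ln h\<bar>)"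
    proof -
      have "real m \<le> T / h" using h by (simp add: pos_le_divide_eq)
      then have "ln (real m) \<le> ln (T / h)" using False by simp
      also have "\<dots> = ln T - ln h" using h T_pos by (simp add: ln_div)
      also have "\<dots> \<le> \<bar>ln T\<bar> + \<bar>ln h\<bar>" by simp
      finally have "ln (real m) \<le> \<bar>ln T\<bar> + \<bar>ln h\<bar>" .
      moreover have "0 \<le> \<bar>ln T\<bar> * \<bar>ln h\<bar>" by simp
      ultimately show ?thesis unfolding distrib_left distrib_right mult_1 mult_1_right by linarith
    qed
    finally show "(\<Sum>i<m. 1 / real (Suc i)) \<le> (1 + \<bar>ln T\<bar>) * (1 + \<bar>ln h\<bar>)" .
  qed (use M_ge_1 in simp)
  finally show ?thesis by (simp only: mult_ac)
qed

text \<open>A bootstrap: the error recursion needs earlier iterates close to the trajectory, and the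
  error bound it yields is what keeps later iterates close, provided that \<open>h\<close> is
  small.\<close>

theorem convergence:
  "\<exists>h1>0. \<exists>C\<ge>0. \<forall>h\<in>{0<..h1}. \<forall>n. real n * h \<le> T \<longrightarrow>
     (\<exists>un. trajectory h n un) \<and>
     (\<forall>un. trajectory h n un \<longrightarrow> norm (un n - c (real n * h)) \<le> C * h\<^sup>2 * (1 + \<bar>ln h\<bar>))"
proof -
  obtain CL0 where CL0: "\<And>t h z. valid t h \<Longrightarrow> splitting_step t h (c t) z \<Longrightarrow>
      norm (z - c (t + h) - defect t h) \<le> CL0 * h ^ 3"
    using local_error by blast
  define CL where "CL = \<bar>CL0\<bar>"
  have CL: "norm (z - c (t + h) - defect t h) \<le> CL * h ^ 3"
    if "valid t h" "splitting_step t h (c t) z" for t h z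
  proof -
    have "CL0 * h ^ 3 \<le> CL * h ^ 3"
      unfolding CL_def using validD(3)[OF that(1)] by (intro mult_right_mono) auto
    then show ?thesis using CL0[OF that] by simp
  qed
  define \<rho> where "\<rho> = r / (8 * M)"
  have \<rho>: "0 < \<rho>" using r_pos M_ge_1 by (simp add: \<rho>_def)
  define C1 where "C1 = 10 * M * K\<^sup>2 * (1 + \<bar>ln T\<bar>) + M * CL * T"
  define C where "C = C1 * exp (3 * M\<^sup>2 * K * T)"
  have MT: "0 \<le> M * CL * T" using M_ge_1 T_pos by (simp add: CL_def)
  have "0 < 10 * M * K\<^sup>2 * (1 + \<bar>ln T\<bar>)" using M_ge_1 K_ge_1 by (intro mult_pos_pos) auto
  then have C1: "0 < C1" using MT unfolding C1_def by (rule add_pos_nonneg)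
  then have C: "0 < C" by (simp add: C_def)
  \<comment> \<open>For such \<open>h\<close> the final error bound is at most
    \<open>C * h \<le> \<rho>\<close>, so that the conclusion restores the nearness assumed in the
    recursion.\<close>
  define h1 where "h1 = min h0 (\<rho> / C)"
  have h1: "0 < h1" using h0_pos \<rho> C by (simp add: h1_def)
  have small: "h \<le> h0" "C * h\<^sup>2 * (1 + \<bar>ln h\<bar>) \<le> \<rho>" "h \<le> 1" if h: "h \<in> {0<..h1}" for h
  proof -
    show "h \<le> h0" using h by (simp add: h1_def)
    have "h0 \<le> 1 / K" by (simp add: h0_def)
    also have "\<dots> \<le> 1" using K_ge_1 by simp
    finally show "h \<le> 1" using \<open>h \<le> h0\<close> by simp
    then have "C * (h\<^sup>2 * (1 + \<bar>ln h\<bar>)) \<le> C * h"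
      using h C by (intro mult_left_mono power2_log_le) auto
    also have "\<dots> \<le> \<rho>" using h C by (simp add: h1_def pos_le_divide_eq mult.commute)
    finally show "C * h\<^sup>2 * (1 + \<bar>ln h\<bar>) \<le> \<rho>" by (simp add: mult.assoc)
  qed
  \<comment> \<open>The numerical step is compared with the step \<open>z\<close> from the exact
    value at the same time: stability controls the first difference, the local error the
    second.\<close>
  have recursion: "norm ((un (Suc k) - c (real (Suc k) * h)) - E h (un k - c (real k * h)) - defect (real k * h) h)
        \<le> 3 * M * K * h * norm (un k - c (real k * h)) + CL * h ^ 3"
    if v: "valid (real k * h) h" and st: "splitting_step (real k * h) h (un k) (un (Suc k))"
      and near: "norm (un k - c (real k * h)) \<le> \<rho>" for un :: "nat \<Rightarrow> 'x" and k h
  proof -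
    let ?t = "real k * h"
    obtain z where z: "splitting_step ?t h (c ?t) z"
      using splitting_step_exists[OF v, of "c ?t"] r_pos M_ge_1 by auto
    have "norm ((un (Suc k) - z) - E h (un k - c ?t)) \<le> 3 * M * K * h * norm (un k - c ?t)"
      using near r_pos M_ge_1 by (intro splitting_step_stable[OF v _ _ st z]) (auto simp: \<rho>_def)
    moreover have "norm (z - c (?t + h) - defect ?t h) \<le> CL * h ^ 3" by (rule CL[OF v z])
    moreover have "?t + h = real (Suc k) * h" by (simp add: algebra_simps)
    moreover have "norm ((x - y) - \<epsilon> - d) \<le> norm ((x - z) - \<epsilon>) + norm (z - y - d)" for x y \<epsilon> d :: 'x
      by norm
    ultimately show ?thesis by (smt (verit))
  qed
  \<comment> \<open>The induction hypothesis supplies nearness only. Gronwall is restarted from the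
    zero initial error for each \<open>n\<close>, so the constant does not grow along the
    induction.\<close>
  have error: "norm (un n - c (real n * h)) \<le> C * h\<^sup>2 * (1 + \<bar>ln h\<bar>)"
    if h: "h \<in> {0<..h1}" and "real n * h \<le> T" "trajectory h n un" for h n un
    using that(2,3)
  proof (induction n rule: less_induct)
    case (less n)
    have h': "0 < h" "h \<le> h0" using h small by auto
    have le_T: "real m * h \<le> T" if "m \<le> n" for m
    proof -
      have "real m * h \<le> real n * h" using that h' by (intro mult_right_mono) auto
      then show ?thesis using less.prems by simp
    qed
    define e where "e k = un k - c (real k * h)" for k
    define \<kappa> where "\<kappa> k = e (Suc k) - E h (e k) - defect (real k * h) h" for k
    have near: "norm (e k) \<le> \<rho>" if "k < n" for k
      using less.IH[OF that le_T trajectory_mono[OF less.prems(2)]] that small(2)[OF h] by (simp add: e_def)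
    have \<kappa>: "norm (\<kappa> k) \<le> 3 * M * K * h * norm (e k) + CL * h ^ 3" if k: "k < n" for k
      using recursion[OF valid_grid[OF h' less.prems(1) k], of un] near[OF k] less.prems(2) k
      by (simp add: \<kappa>_def e_def trajectory_def)
    define B where "B = C1 * (h\<^sup>2 * (1 + \<bar>ln h\<bar>))"
    have "norm (e m) \<le> (3 * M\<^sup>2 * K * h) * (\<Sum>j<m. norm (e j)) + B" if m: "m \<le> n" for m
    proof -
      have idx: "0 \<le> real (m - Suc j) * h" "real (m - Suc j) * h \<le> T" for j
        using h' le_T[of "m - Suc j"] m by auto
      have "e m = (\<Sum>j<m. E (real (m - Suc j) * h) (defect (real j * h) h + \<kappa> j))"
        using less.prems(2) m
        by (intro error_representation h' le_T) (auto simp: \<kappa>_def e_def trajectory_def)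
      also have "\<dots> = (\<Sum>j<m. E (real (m - Suc j) * h) (defect (real j * h) h))
          + (\<Sum>j<m. E (real (m - Suc j) * h) (\<kappa> j))"
        by (simp add: blinfun.add_right sum.distrib)
      finally have "norm (e m) \<le> (\<Sum>j<m. norm (E (real (m - Suc j) * h) (defect (real j * h) h)))
          + (\<Sum>j<m. norm (E (real (m - Suc j) * h) (\<kappa> j)))"
        by (simp add: norm_triangle_mono norm_sum)
      also have "\<dots> \<le> 10 * M * K\<^sup>2 * (1 + \<bar>ln T\<bar>) * (h\<^sup>2 * (1 + \<bar>ln h\<bar>))
          + (\<Sum>j<m. M * (3 * M * K * h * norm (e j) + CL * h ^ 3))"
      proof (intro add_mono sum_mono defect_sum_bound h' le_T[OF m])
        fix j assume "j \<in> {..<m}"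
        then show "norm (E (real (m - Suc j) * h) (\<kappa> j)) \<le> M * (3 * M * K * h * norm (e j) + CL * h ^ 3)"
          using \<kappa>[of j] m M_ge_1 by (intro order_trans[OF E_apply_bound[OF idx] mult_left_mono]) auto
      qed
      also have "(\<Sum>j<m. M * (3 * M * K * h * norm (e j) + CL * h ^ 3))
          = 3 * M\<^sup>2 * K * h * (\<Sum>j<m. norm (e j)) + M * CL * (real m * h) * h\<^sup>2"
        by (simp add: distrib_left sum.distrib sum_distrib_left power2_eq_square power3_eq_cube algebra_simps)
      \<comment> \<open>The \<open>m\<close> remainders of size \<open>h ^ 3\<close> sum to order
        two because \<open>m * h \<le> T\<close>.\<close>
      also have "M * CL * (real m * h) * h\<^sup>2 \<le> M * CL * T * (h\<^sup>2 * (1 + \<bar>ln h\<bar>))"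
      proof (intro mult_mono)
        show "h\<^sup>2 \<le> h\<^sup>2 * (1 + \<bar>ln h\<bar>)" by (simp add: algebra_simps)
      qed (use le_T[OF m] M_ge_1 h' T_pos in \<open>auto simp: CL_def\<close>)
      finally show ?thesis by (simp add: B_def C1_def algebra_simps)
    qed
    from discrete_gronwall[OF _ this, of n]
    have "norm (e n) \<le> B * (1 + 3 * M\<^sup>2 * K * h) ^ n" using h' K_ge_1 by simp
    also have "\<dots> \<le> B * exp (3 * M\<^sup>2 * K * T)"
    proof (rule mult_left_mono)
      have "(1 + 3 * M\<^sup>2 * K * h) ^ n \<le> exp (3 * M\<^sup>2 * K * h) ^ n"
        using h' K_ge_1 by (intro power_mono exp_ge_add_one_self) auto
      also have "\<dots> = exp (3 * M\<^sup>2 * K * (real n * h))"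
        by (simp add: exp_of_nat_mult[symmetric] algebra_simps)
      also have "\<dots> \<le> exp (3 * M\<^sup>2 * K * T)"
        using less.prems(1) K_ge_1 by (simp add: mult_left_mono)
      finally show "(1 + 3 * M\<^sup>2 * K * h) ^ n \<le> exp (3 * M\<^sup>2 * K * T)" .
    qed (use C1 in \<open>simp add: B_def\<close>)
    also have "\<dots> = C * h\<^sup>2 * (1 + \<bar>ln h\<bar>)" by (simp add: B_def C_def)
    finally show ?case by (simp add: e_def)
  qed
  \<comment> \<open>The error bound for the first \<open>n\<close> steps places the current iterate
    where one more step is solvable.\<close>
  have exist: "\<exists>un. trajectory h n un" if h: "h \<in> {0<..h1}" and "real n * h \<le> T" for h n
    using that(2)
  proof (induction n)
    case 0
    show ?case by (rule exI[of _ "\<lambda>_. c 0"]) (simp add: trajectory_def)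
  next
    case (Suc n)
    have "real n * h \<le> real (Suc n) * h" using h by (intro mult_right_mono) auto
    then have n: "real n * h \<le> T" using Suc.prems by simp
    then obtain un where un: "trajectory h n un" using Suc.IH by blast
    have "norm (un n - c (real n * h)) \<le> \<rho>" using error[OF h n un] small(2)[OF h] by simp
    moreover have "valid (real n * h) h"
      using h small(1)[OF h] by (intro valid_grid[OF _ _ Suc.prems]) auto
    ultimately obtain z where z: "splitting_step (real n * h) h (un n) z"
      using splitting_step_exists unfolding \<rho>_def by blast
    have "trajectory h (Suc n) (un(Suc n := z))"
      using un z by (auto simp: trajectory_def less_Suc_eq)
    then show ?case by blast
  qed
  show ?thesis using h1 C error exist by (intro exI[of _ h1] conjI exI[of _ C]) auto
qed

end


subsection \<open>Realization on function spaces\<close>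

text \<open>\<open>Ck_closure\<close> speaks about continuous extensions \<open>h\<close>, while
  \<open>partial_deriv\<close> iterates derivatives of the function itself. Functions that agree on
  the open set \<open>\<Omega>\<close> have the same derivatives there.\<close>

lemma partial_deriv_Ck_closure:
  assumes \<Omega>: "open \<Omega>" and w: "Ck_closure k \<Omega> w"
  shows "set is \<subseteq> Basis \<Longrightarrow> length is \<le> k \<Longrightarrow>
    \<exists>h. Ck_closure (k - length is) \<Omega> h \<and> (\<forall>x\<in>\<Omega>. partial_deriv is w x = h x)"
proof (induction "is")
  case Nil
  then show ?case using w by auto
next
  case (Cons i "is")
  then obtain h where h: "Ck_closure (k - length is) \<Omega> h" "\<And>x. x \<in> \<Omega> \<Longrightarrow> partial_deriv is w x = h x"
    by auto
  have "k - length is = Suc (k - length (i # is))" using Cons.prems by simp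
  with h(1) have "\<forall>x\<in>\<Omega>. h differentiable (at x)"
    "\<forall>i\<in>Basis. \<exists>h'. Ck_closure (k - length (i # is)) \<Omega> h' \<and> (\<forall>x\<in>\<Omega>. h' x = frechet_derivative h (at x) i)"
    by simp_all
  then obtain h' where h': "Ck_closure (k - length (i # is)) \<Omega> h'"
    "\<And>x. x \<in> \<Omega> \<Longrightarrow> h' x = frechet_derivative h (at x) i" and diff: "\<And>x. x \<in> \<Omega> \<Longrightarrow> h differentiable (at x)"
    using Cons.prems by auto
  have "partial_deriv (i # is) w x = h' x" if x: "x \<in> \<Omega>" for x
  proof -
    have "(h has_derivative frechet_derivative h (at x)) (at x)"
      using diff[OF x] by (simp add: frechet_derivative_works)
    then have "(partial_deriv is w has_derivative frechet_derivative h (at x)) (at x)"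
      by (rule has_derivative_transform_within_open[OF _ \<Omega> x]) (simp add: h(2))
    then have "frechet_derivative (partial_deriv is w) (at x) = frechet_derivative h (at x)"
      by (rule frechet_derivative_at[symmetric])
    then show ?thesis by (simp add: h'(2)[OF x])
  qed
  with h'(1) show ?case by blast
qed

lemma partial_deriv_differentiable:
  assumes \<Omega>: "open \<Omega>" and w: "Ck_closure k \<Omega> w" and "is": "set is \<subseteq> Basis" "length is < k" and x: "x \<in> \<Omega>"
  shows "partial_deriv is w differentiable (at x)"
proof -
  obtain h where h: "Ck_closure (k - length is) \<Omega> h" "\<And>x. x \<in> \<Omega> \<Longrightarrow> partial_deriv is w x = h x"
    using partial_deriv_Ck_closure[OF \<Omega> w "is"(1)] "is"(2) by auto
  obtain j where "k - length is = Suc j" using "is"(2) by (metis Suc_diff_Suc)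
  with h(1) have "h differentiable (at x)" using x by simp
  then obtain D where "(h has_derivative D) (at x)" by (auto simp: differentiable_def)
  then have "(partial_deriv is w has_derivative D) (at x)"
    by (rule has_derivative_transform_within_open[OF _ \<Omega> x]) (simp add: h(2))
  then show ?thesis by (auto simp: differentiable_def)
qed

text \<open>\<open>frechet_derivative\<close> is a choice operator, additive only where both
  derivatives exist; hence the bound \<open>k\<close> on the order.\<close>

lemma partial_deriv_linear:
  assumes \<Omega>: "open \<Omega>" and w: "Ck_closure k \<Omega> w" and z: "Ck_closure k \<Omega> z"
  shows "set is \<subseteq> Basis \<Longrightarrow> length is \<le> k \<Longrightarrow> x \<in> \<Omega> \<Longrightarrow>
    partial_deriv is (\<lambda>x. w x + \<alpha> *\<^sub>R z x) x = partial_deriv is w x + \<alpha> *\<^sub>R partial_deriv is z x"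
proof (induction "is" arbitrary: x)
  case (Cons i "is")
  let ?w = "partial_deriv is w" and ?z = "partial_deriv is z"
  have "(?w has_derivative frechet_derivative ?w (at x)) (at x)"
    "(?z has_derivative frechet_derivative ?z (at x)) (at x)"
    using partial_deriv_differentiable[OF \<Omega> w _ _ Cons.prems(3)]
      partial_deriv_differentiable[OF \<Omega> z _ _ Cons.prems(3)] Cons.prems(1,2)
    by (simp_all add: frechet_derivative_works[symmetric])
  then have "((\<lambda>x. ?w x + \<alpha> *\<^sub>R ?z x) has_derivative
      (\<lambda>h. frechet_derivative ?w (at x) h + \<alpha> *\<^sub>R frechet_derivative ?z (at x) h)) (at x)"
    by (intro has_derivative_add has_derivative_scaleR_right)
  then have "(partial_deriv is (\<lambda>x. w x + \<alpha> *\<^sub>R z x) has_derivative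
      (\<lambda>h. frechet_derivative ?w (at x) h + \<alpha> *\<^sub>R frechet_derivative ?z (at x) h)) (at x)"
    by (rule has_derivative_transform_within_open[OF _ \<Omega> Cons.prems(3)])
      (use Cons.IH Cons.prems in simp)
  from frechet_derivative_at[OF this] show ?case by (simp add: fun_eq_iff)
qed simp

lemma fun_subspace_linear:
  "fun_subspace W \<Longrightarrow> w \<in> W \<Longrightarrow> z \<in> W \<Longrightarrow> (\<lambda>x. w x + \<alpha> *\<^sub>R z x) \<in> W"
  by (simp add: fun_subspace_def)

text \<open>\<open>A\<close> is prescribed only on smooth functions and only at points of
  \<open>\<Omega>\<close>, so linearity is pointwise there and requires smoothness of the
  combination as well.\<close>

lemma linear_diff_operator_linear:
  assumes \<Omega>: "open \<Omega>" and A: "linear_diff_operator m \<Omega> A"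
    and w: "Ck_closure m \<Omega> w" "Ck_closure m \<Omega> z" "Ck_closure m \<Omega> (\<lambda>x. w x + \<alpha> *\<^sub>R z x)" and x: "x \<in> \<Omega>"
  shows "A (\<lambda>x. w x + \<alpha> *\<^sub>R z x) x = A w x + \<alpha> *\<^sub>R A z x"
proof -
  obtain I :: "'a list set" and a :: "'a list \<Rightarrow> 'a \<Rightarrow> 'b \<Rightarrow>\<^sub>L 'b" where
    I: "\<And>is. is \<in> I \<Longrightarrow> set is \<subseteq> Basis \<and> length is \<le> m"
    and A: "\<And>w x. Ck_closure m \<Omega> w \<Longrightarrow> x \<in> \<Omega> \<Longrightarrow> A w x = (\<Sum>is\<in>I. a is x (partial_deriv is w x))"
  proof -
    show thesis
      using A[unfolded linear_diff_operator_def] by (elim exE conjE) (rule that, simp_all)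
  qed
  have "A (\<lambda>x. w x + \<alpha> *\<^sub>R z x) x
      = (\<Sum>is\<in>I. a is x (partial_deriv is w x + \<alpha> *\<^sub>R partial_deriv is z x))"
    unfolding A[OF w(3) x]
    by (intro sum.cong refl arg_cong[where f = "blinfun_apply _"] partial_deriv_linear[OF \<Omega> w(1,2) _ _ x])
      (use I in auto)
  then show ?thesis
    by (simp add: A w(1,2) x blinfun.add_right blinfun.scaleR_right sum.distrib scaleR_sum_right)
qed

text \<open>\<open>generator\<close> is the sole point where boundary values meet the semigroup: it
  is the identity \<open>A0 (q w) = q (A w)\<close> for \<open>w\<close> vanishing on
  \<open>\<Gamma>\<close>, after application of \<open>E t\<close>. Linearity is stated through
  \<open>q\<close>, since \<open>A w\<close> is determined inside \<open>\<Omega>\<close>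
  only.\<close>

locale dirichlet_problem = smoothing_semigroup E E' T M
  for E E' :: "real \<Rightarrow> 'x::banach \<Rightarrow>\<^sub>L 'x" and T M +
  fixes \<Gamma> :: "'d set" and q :: "('d \<Rightarrow> 'v::real_vector) \<Rightarrow> 'x" and W :: "('d \<Rightarrow> 'v) set"
    and A :: "('d \<Rightarrow> 'v) \<Rightarrow> 'd \<Rightarrow> 'v"
  assumes W: "fun_subspace W"
    and q_linear: "w \<in> W \<Longrightarrow> z \<in> W \<Longrightarrow> q (\<lambda>x. w x + \<alpha> *\<^sub>R z x) = q w + \<alpha> *\<^sub>R q z"
    and qA_linear: "w \<in> W \<Longrightarrow> z \<in> W \<Longrightarrow> q (A (\<lambda>x. w x + \<alpha> *\<^sub>R z x)) = q (A w) + \<alpha> *\<^sub>R q (A z)"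
    and generator: "w \<in> W \<Longrightarrow> (\<And>x. x \<in> \<Gamma> \<Longrightarrow> w x = 0) \<Longrightarrow> 0 < t \<Longrightarrow> E' t (q w) = E t (q (A w))"
begin

lemma W_linear: "w \<in> W \<Longrightarrow> z \<in> W \<Longrightarrow> (\<lambda>x. w x + \<alpha> *\<^sub>R z x) \<in> W"
  by (rule fun_subspace_linear[OF W])

text \<open>As \<open>b\<close> is constant in time, \<open>u(t + s) - u(t)\<close> vanishes on
  \<open>\<Gamma>\<close>; variation of constants applies to it with inhomogeneity
  \<open>A u(t) + \<phi>(t + s)\<close>.\<close>

lemma exact_mild:
  assumes th: "0 \<le> t" "0 \<le> h" "t + h \<le> T"
    and u: "\<And>t. t \<in> {0..T} \<Longrightarrow> u t \<in> W" "\<And>t x. t \<in> {0..T} \<Longrightarrow> x \<in> \<Gamma> \<Longrightarrow> u t x = b x"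
    and du: "\<And>t. t \<in> {0..T} \<Longrightarrow>
      ((\<lambda>s. q (u s)) has_vector_derivative q (A (u t)) + \<phi> t) (at t within {0..T})"
  shows "q (u (t + h)) = q (u t)
      + integral {0..h} (\<lambda>s. E (h - s) ((q (A (u t)) + \<phi> t) + (\<phi> (t + s) - \<phi> t)))"
proof -
  let ?d = "\<lambda>s x. u (t + s) x + (-1) *\<^sub>R u t x"
  have ts: "t + s \<in> {0..T}" if "s \<in> {0..h}" for s using that th by auto
  have t: "t \<in> {0..T}" using th by auto
  have d: "q (?d s) = q (u (t + s)) - q (u t)" "q (A (?d s)) = q (A (u (t + s))) - q (A (u t))" "?d s \<in> W"
    if "s \<in> {0..h}" for s
    using q_linear[OF u(1)[OF ts[OF that]] u(1)[OF t], of "-1"]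
      qA_linear[OF u(1)[OF ts[OF that]] u(1)[OF t], of "-1"]
      W_linear[OF u(1)[OF ts[OF that]] u(1)[OF t], of "-1"] by simp_all
  have "((\<lambda>s. E (h - s) (q (A (u t)) + \<phi> (t + s))) has_integral
      (q (u (t + h)) - q (u t)) - E h (q (u (t + 0)) - q (u t))) {0..h}"
  proof (rule variation_of_constants[where a = "\<lambda>s. q (A (u (t + s))) - q (A (u t))"])
    fix s assume s: "s \<in> {0..h}"
    have "((\<lambda>s. q (u (t + s))) has_vector_derivative q (A (u (t + s))) + \<phi> (t + s)) (at s within {0..h})"
    proof -
      have "((+) t has_vector_derivative 1) (at s within {0..h})" by (auto intro!: derivative_eq_intros)
      moreover have "((\<lambda>s. q (u s)) has_vector_derivative q (A (u (t + s))) + \<phi> (t + s))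
          (at (t + s) within (+) t ` {0..h})"
        by (rule has_vector_derivative_within_subset[OF du[OF ts[OF s]]]) (use th in auto)
      ultimately show ?thesis
        using vector_diff_chain_within[of "(+) t" 1 s "{0..h}" "\<lambda>s. q (u s)"] by (simp add: o_def)
    qed
    then show "((\<lambda>s. q (u (t + s)) - q (u t)) has_vector_derivative
        (q (A (u (t + s))) - q (A (u t))) + (q (A (u t)) + \<phi> (t + s))) (at s within {0..h})"
      by (auto intro!: derivative_eq_intros)
    fix \<sigma> :: real assume "0 < \<sigma>"
    have "E' \<sigma> (q (?d s)) = E \<sigma> (q (A (?d s)))"
      using u(2)[OF ts[OF s]] u(2)[OF t] d(3)[OF s] \<open>0 < \<sigma>\<close> by (intro generator) auto
    then show "E' \<sigma> (q (u (t + s)) - q (u t)) = E \<sigma> (q (A (u (t + s))) - q (A (u t)))"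
      by (simp only: d[OF s])
  qed (use th in auto)
  from integral_unique[OF this] show ?thesis by simp
qed

text \<open>The difference of two homogenizing functions vanishes on \<open>\<Gamma>\<close> at all
  times of the step; by variation of constants it accounts exactly for the difference of the two
  inhomogeneities.\<close>

lemma homogenization_independent:
  assumes h: "0 < h" "h \<le> T" and W: "\<rho>0 \<in> W" "\<rho>1 \<in> W" "\<sigma>0 \<in> W" "\<sigma>1 \<in> W"
    and bc: "\<And>s x. s \<in> {0..h} \<Longrightarrow> x \<in> \<Gamma> \<Longrightarrow> \<rho>0 x + s *\<^sub>R \<rho>1 x = \<sigma>0 x + s *\<^sub>R \<sigma>1 x"
  shows "q \<rho>0 + h *\<^sub>R q \<rho>1 + mild_solution_at E (\<lambda>s. (q (A \<rho>0) + s *\<^sub>R q (A \<rho>1)) - q \<rho>1) (v - q \<rho>0) h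
       = q \<sigma>0 + h *\<^sub>R q \<sigma>1 + mild_solution_at E (\<lambda>s. (q (A \<sigma>0) + s *\<^sub>R q (A \<sigma>1)) - q \<sigma>1) (v - q \<sigma>0) h"
proof -
  let ?z0 = "\<lambda>x. \<rho>0 x + (-1) *\<^sub>R \<sigma>0 x" and ?z1 = "\<lambda>x. \<rho>1 x + (-1) *\<^sub>R \<sigma>1 x"
  have z: "?z0 \<in> W" "?z1 \<in> W" by (rule W_linear[OF W(1,3)], rule W_linear[OF W(2,4)])
  have qz: "q ?z0 = q \<rho>0 - q \<sigma>0" "q ?z1 = q \<rho>1 - q \<sigma>1"
    "q (A ?z0) = q (A \<rho>0) - q (A \<sigma>0)" "q (A ?z1) = q (A \<rho>1) - q (A \<sigma>1)"
    using q_linear[OF W(1,3), of "-1"] q_linear[OF W(2,4), of "-1"]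
      qA_linear[OF W(1,3), of "-1"] qA_linear[OF W(2,4), of "-1"] by simp_all
  have z0: "?z0 x = 0" if "x \<in> \<Gamma>" for x using bc[of 0 x] that h by simp
  \<comment> \<open>Subtracting the boundary identities at times 0 and \<open>h\<close> isolates the
    linear coefficient; this uses that \<open>h\<close> is not zero.\<close>
  have z1: "?z1 x = 0" if "x \<in> \<Gamma>" for x using bc[of h x] bc[of 0 x] that h by simp
  let ?r\<rho> = "\<lambda>s. (q (A \<rho>0) + s *\<^sub>R q (A \<rho>1)) - q \<rho>1" and ?r\<sigma> = "\<lambda>s. (q (A \<sigma>0) + s *\<^sub>R q (A \<sigma>1)) - q \<sigma>1"
  have "((\<lambda>s. E (h - s) (?r\<sigma> s - ?r\<rho> s)) has_integral
      (q ?z0 + h *\<^sub>R q ?z1) - E h (q ?z0 + 0 *\<^sub>R q ?z1)) {0..h}"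
  proof (rule variation_of_constants[where a = "\<lambda>s. q (A ?z0) + s *\<^sub>R q (A ?z1)"])
    fix s assume s: "s \<in> {0..h}"
    have "((\<lambda>s. q ?z0 + s *\<^sub>R q ?z1) has_vector_derivative q ?z1) (at s within {0..h})"
      by (auto intro!: derivative_eq_intros)
    moreover have "q (A ?z0) + s *\<^sub>R q (A ?z1) + (?r\<sigma> s - ?r\<rho> s) = q ?z1"
      unfolding qz by (simp add: algebra_simps)
    ultimately show "((\<lambda>s. q ?z0 + s *\<^sub>R q ?z1) has_vector_derivative
        q (A ?z0) + s *\<^sub>R q (A ?z1) + (?r\<sigma> s - ?r\<rho> s)) (at s within {0..h})"
      by (simp only:)
    fix t :: real assume t: "0 < t"
    have "E' t (q (\<lambda>x. ?z0 x + s *\<^sub>R ?z1 x)) = E t (q (A (\<lambda>x. ?z0 x + s *\<^sub>R ?z1 x)))"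
      using z0 z1 t by (intro generator W_linear z) (simp_all only: scaleR_zero_right add_0)
    then show "E' t (q ?z0 + s *\<^sub>R q ?z1) = E t (q (A ?z0) + s *\<^sub>R q (A ?z1))"
      by (simp only: q_linear[OF z] qA_linear[OF z])
  qed (use h in auto)
  from integral_unique[OF this]
  have "integral {0..h} (\<lambda>s. E (h - s) (?r\<sigma> s)) - integral {0..h} (\<lambda>s. E (h - s) (?r\<rho> s))
      = (q ?z0 + h *\<^sub>R q ?z1) - E h (q ?z0)"
    unfolding blinfun.diff_right[of _ "?r\<sigma> _" "?r\<rho> _"]
    by (subst (asm) integral_diff) (auto intro!: integrable_E_apply h continuous_intros)
  then show ?thesis
    unfolding mild_solution_at_def qz blinfun.diff_right by (simp add: algebra_simps)
qed

end

lemma C2_on_compact: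
  fixes f :: "'x::banach \<Rightarrow> 'x"
  assumes U: "open U" and f: "C2_on U f" and S: "compact S" "S \<subseteq> U" "S \<noteq> {}"
  obtains f' f'' r K where "0 < r" "1 \<le> K"
    "\<And>x K'. x \<in> S \<Longrightarrow> K \<le> K' \<Longrightarrow> reaction_ball U f f' x r K'"
    "\<And>x. x \<in> U \<Longrightarrow> (f has_derivative blinfun_apply (f' x)) (at x)"
    "\<And>x. x \<in> U \<Longrightarrow> (f' has_derivative blinfun_apply (f'' x)) (at x)"
    "\<And>x. x \<in> S \<Longrightarrow> norm (f' x) \<le> K" "\<And>x. x \<in> S \<Longrightarrow> norm (f'' x) \<le> K"
proof -
  obtain f' :: "'x \<Rightarrow> 'x \<Rightarrow>\<^sub>L 'x" and f'' :: "'x \<Rightarrow> 'x \<Rightarrow>\<^sub>L ('x \<Rightarrow>\<^sub>L 'x)" where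
    df: "\<And>x. x \<in> U \<Longrightarrow> (f has_derivative blinfun_apply (f' x)) (at x)" and
    df': "\<And>x. x \<in> U \<Longrightarrow> (f' has_derivative blinfun_apply (f'' x)) (at x)" and
    cont: "continuous_on U f''"
    using f unfolding C2_on_def by blast
  define \<phi> where "\<phi> x = norm (f x) + norm (f' x) + norm (f'' x)" for x
  have cont_f: "continuous_on U f" "continuous_on U f'"
    using has_derivative_continuous[OF df] has_derivative_continuous[OF df']
    by (auto intro: continuous_at_imp_continuous_on)
  have cont_\<phi>: "continuous_on U \<phi>"
    unfolding \<phi>_def by (intro continuous_intros cont cont_f)
  obtain x1 where x1: "\<And>x. x \<in> S \<Longrightarrow> \<phi> x \<le> \<phi> x1"
    using continuous_attains_sup[OF S(1,3) continuous_on_subset[OF cont_\<phi> S(2)]] by blast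
  define K where "K = max 1 (\<phi> x1 + 1)"
  \<comment> \<open>Exceeding the maximum by 1 makes the condition open, so a ball of one common
    radius fits around every point of \<open>S\<close>.\<close>
  define V where "V = U \<inter> \<phi> -` {..<\<phi> x1 + 1}"
  have "open V" unfolding V_def by (rule continuous_open_preimage[OF cont_\<phi> U]) simp
  moreover have "S \<subseteq> V" using x1 S(2) by (force simp: V_def)
  ultimately obtain r where r: "0 < r" "(\<Union>x\<in>S. cball x r) \<subseteq> V"
    using compact_subset_open_imp_cball_epsilon_subset[OF S(1)] by blast
  have \<phi>_ge: "norm (f x) \<le> \<phi> x" "norm (f' x) \<le> \<phi> x" "norm (f'' x) \<le> \<phi> x" for x
    using norm_ge_zero[of "f x"] norm_ge_zero[of "f' x"] norm_ge_zero[of "f'' x"]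
    unfolding \<phi>_def by linarith+
  have V: "norm (f x) \<le> K" "norm (f' x) \<le> K" "norm (f'' x) \<le> K" "x \<in> U" if "x \<in> V" for x
  proof -
    have "\<phi> x < \<phi> x1 + 1" "\<phi> x1 + 1 \<le> K" using that by (simp_all add: V_def K_def)
    with \<phi>_ge[of x] show "norm (f x) \<le> K" "norm (f' x) \<le> K" "norm (f'' x) \<le> K" by linarith+
    show "x \<in> U" using that by (simp add: V_def)
  qed
  have "reaction_ball U f f' x r K'" if x: "x \<in> S" and K': "K \<le> K'" for x K'
  proof
    have ball: "y \<in> V" if "y \<in> cball x r" for y using r(2) x that by blast
    show "0 < r" by (rule r(1))
    show "1 \<le> K'" using K' by (simp add: K_def)
    show "cball x r \<subseteq> U" using ball V(4) by blast
    fix y assume y: "y \<in> cball x r"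
    show "norm (f y) \<le> K'" "norm (f' y) \<le> K'" "(f has_derivative blinfun_apply (f' y)) (at y)"
      using V[OF ball[OF y]] K' df by auto
    fix z assume z: "z \<in> cball x r"
    have "norm (f' y - f' z) \<le> K * norm (y - z)"
    proof (rule differentiable_bound[of "cball x r" f' "\<lambda>x. blinfun_apply (f'' x)"])
      fix \<xi> assume \<xi>: "\<xi> \<in> cball x r"
      show "(f' has_derivative blinfun_apply (f'' \<xi>)) (at \<xi> within cball x r)"
        using V(4)[OF ball[OF \<xi>]] by (rule has_derivative_at_withinI[OF df'])
      show "onorm (blinfun_apply (f'' \<xi>)) \<le> K"
        using V(3)[OF ball[OF \<xi>]] by (simp add: norm_blinfun.rep_eq)
    qed (use y z in auto)
    also have "\<dots> \<le> K' * norm (y - z)" using K' by (intro mult_right_mono) auto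
    finally show "norm (f' y - f' z) \<le> K' * norm (y - z)" .
  qed
  moreover have "1 \<le> K" by (simp add: K_def)
  ultimately show thesis using r(1) df df' V(2,3) \<open>S \<subseteq> V\<close> by (intro that[of r K f' f'']) auto
qed

lemma second_order_taylor:
  fixes \<gamma> :: "real \<Rightarrow> 'a::real_normed_vector"
  assumes d1: "\<And>t. t \<in> {0..T} \<Longrightarrow> (\<gamma> has_vector_derivative \<gamma>' t) (at t within {0..T})"
    and d2: "\<And>t. t \<in> {0..T} \<Longrightarrow> (\<gamma>' has_vector_derivative \<gamma>'' t) (at t within {0..T})"
    and B: "\<And>t. t \<in> {0..T} \<Longrightarrow> norm (\<gamma>'' t) \<le> B"
    and ts: "0 \<le> t" "0 \<le> s" "t + s \<le> T"
  shows "norm (\<gamma> (t + s) - \<gamma> t - s *\<^sub>R \<gamma>' t) \<le> B * s\<^sup>2"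
proof -
  have shift: "((\<lambda>\<sigma>. p (t + \<sigma>)) has_vector_derivative p' (t + \<sigma>)) (at \<sigma> within {0..s'})"
    if p: "\<And>t. t \<in> {0..T} \<Longrightarrow> (p has_vector_derivative p' t) (at t within {0..T})"
      and s': "s' \<le> s" and \<sigma>: "\<sigma> \<in> {0..s'}" for p p' :: "real \<Rightarrow> 'a" and \<sigma> s'
  proof -
    have "((+) t has_vector_derivative 1) (at \<sigma> within {0..s'})" by (auto intro!: derivative_eq_intros)
    moreover have "(p has_vector_derivative p' (t + \<sigma>)) (at (t + \<sigma>) within (+) t ` {0..s'})"
      by (rule has_vector_derivative_within_subset[OF p]) (use ts s' \<sigma> in auto)
    ultimately show ?thesis
      using vector_diff_chain_within[of "(+) t" 1 \<sigma> "{0..s'}" p] by (simp add: o_def)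
  qed
  have 1: "norm (\<gamma>' (t + \<sigma>) - \<gamma>' (t + 0)) \<le> B * \<sigma>" if "\<sigma> \<in> {0..s}" for \<sigma>
    by (rule vector_increment_bound[where w' = "\<lambda>\<sigma>. \<gamma>'' (t + \<sigma>)"])
      (use that ts in \<open>auto intro!: shift[OF d2] B\<close>)
  have "0 \<le> B" using ts by (intro order_trans[OF norm_ge_zero B[of t]]) auto
  have "norm ((\<gamma> (t + s) - s *\<^sub>R \<gamma>' t) - (\<gamma> (t + 0) - 0 *\<^sub>R \<gamma>' t)) \<le> (B * s) * s"
  proof (rule vector_increment_bound[where w' = "\<lambda>\<sigma>. \<gamma>' (t + \<sigma>) - \<gamma>' t"])
    fix \<sigma> assume \<sigma>: "\<sigma> \<in> {0..s}"
    show "((\<lambda>\<sigma>. \<gamma> (t + \<sigma>) - \<sigma> *\<^sub>R \<gamma>' t) has_vector_derivative \<gamma>' (t + \<sigma>) - \<gamma>' t) (at \<sigma> within {0..s})"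
      by (intro has_vector_derivative_diff shift[OF d1 order_refl \<sigma>]) (auto intro!: derivative_eq_intros)
    have "B * \<sigma> \<le> B * s" using \<sigma> \<open>0 \<le> B\<close> by (intro mult_left_mono) auto
    then show "norm (\<gamma>' (t + \<sigma>) - \<gamma>' t) \<le> B * s" using 1[OF \<sigma>] by simp
  qed (rule ts(2))
  then show ?thesis by (simp add: power2_eq_square algebra_simps)
qed

theorem theorem2:
  fixes \<Omega> \<Gamma> :: "'d::euclidean_space set"
    and \<F> W :: "('d \<Rightarrow> 'v::euclidean_space) set"
    and q :: "('d \<Rightarrow> 'v) \<Rightarrow> 'x::banach"
    and A :: "('d \<Rightarrow> 'v) \<Rightarrow> 'd \<Rightarrow> 'v" and m :: nat
    and D0 :: "'x set" and A0 :: "'x \<Rightarrow> 'x" and E :: "real \<Rightarrow> 'x \<Rightarrow>\<^sub>L 'x"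
    and g :: "'d \<Rightarrow> 'v \<Rightarrow> 'v" and U :: "'x set" and f :: "'x \<Rightarrow> 'x"
    and b u0 :: "'d \<Rightarrow> 'v" and u :: "real \<Rightarrow> 'd \<Rightarrow> 'v" and T :: real
  assumes domain: "open \<Omega>" "connected \<Omega>" "\<Omega> \<noteq> {}" "\<Gamma> \<subseteq> frontier \<Omega>"
    and space: "banach_function_space \<Omega> \<F> q"
    and operator: "linear_diff_operator m \<Omega> A" "smooth_class m \<Omega> \<F> A W"
    and A0: "dirichlet_realization \<Gamma> q W A D0 A0" "generates_analytic_semigroup D0 A0 E"
    and reaction: "pointwise_reaction \<F> q g U f"
    and f_smooth: "open U" "C2_on U f"
    and horizon: "T > 0"
    and solution: "exact_solution \<Omega> \<Gamma> q W A f b u0 T u" "u0 \<in> W"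
    and near_solution: "\<forall>t\<in>{0..T}. q (u t) \<in> U"
    and smooth_solution: "C3_curve T (\<lambda>t. q (u t))"
    and smooth_reaction: "\<forall>t\<in>{0..T}. (\<lambda>x. g x (u t x)) \<in> W"
      "bounded ((\<lambda>t. q (A (\<lambda>x. g x (u t x)))) ` {0..T})"
  shows "\<exists>\<tau>0>0.
    (\<exists>C. \<forall>\<tau>\<in>{0<..\<tau>0}. \<forall>n. real n * \<tau> \<le> T \<longrightarrow>
       (\<exists>un. numerical_solution \<Gamma> q W A E g U f b u0 \<tau> n un) \<and>
       (\<forall>un. numerical_solution \<Gamma> q W A E g U f b u0 \<tau> n un \<longrightarrow>
          norm (un n - q (u (real n * \<tau>))) \<le> C * \<tau>\<^sup>2 * (1 + \<bar>ln \<tau>\<bar>))) \<and>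
    (\<forall>R. \<exists>C. \<forall>\<tau>>0. \<forall>n un. real n * \<tau> \<le> T \<longrightarrow>
       numerical_solution \<Gamma> q W A E g U f b u0 \<tau> n un \<longrightarrow> norm (un n) \<le> R \<longrightarrow>
          norm (un n - q (u (real n * \<tau>))) \<le> C * \<tau>\<^sup>2 * (1 + \<bar>ln \<tau>\<bar>))"
proof -
  let ?num = "numerical_solution \<Gamma> q W A E g U f b u0"
  define c where "c t = q (u t)" for t
  define F where "F t = (\<lambda>x. g x (u t x))" for t
  define a where "a t = q (A (F t))" for t

  have W: "fun_subspace W" "\<And>w. w \<in> W \<Longrightarrow> Ck_closure m \<Omega> w" "\<And>w. w \<in> W \<Longrightarrow> w \<in> \<F>"
    "\<And>w. w \<in> W \<Longrightarrow> A w \<in> \<F>"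
    using operator(2) by (auto simp: smooth_class_def)
  have \<F>: "fun_subspace \<F>"
    "\<And>w z. w \<in> \<F> \<Longrightarrow> z \<in> \<F> \<Longrightarrow> q (\<lambda>x. w x + z x) = q w + q z"
    "\<And>k w. w \<in> \<F> \<Longrightarrow> q (\<lambda>x. k *\<^sub>R w x) = k *\<^sub>R q w"
    "\<And>w z. w \<in> \<F> \<Longrightarrow> z \<in> \<F> \<Longrightarrow> q w = q z \<longleftrightarrow> negligible {x\<in>\<Omega>. w x \<noteq> z x}"
    using space by (simp_all add: banach_function_space_def)
  \<comment> \<open>Identities for \<open>A\<close> hold only on \<open>\<Omega>\<close>; they pass
    to \<open>X\<close> because its elements are classes of functions on
    \<open>\<Omega>\<close>.\<close>
  have q_eq: "q w = q z" if "w \<in> \<F>" "z \<in> \<F>" "\<And>x. x \<in> \<Omega> \<Longrightarrow> w x = z x" for w z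
  proof -
    have "{x\<in>\<Omega>. w x \<noteq> z x} = {}" using that by auto
    then have "negligible {x\<in>\<Omega>. w x \<noteq> z x}" by (simp only: negligible_empty)
    then show ?thesis using \<F>(4)[OF that(1,2)] by blast
  qed
  have q_linear: "q (\<lambda>x. w x + \<alpha> *\<^sub>R z x) = q w + \<alpha> *\<^sub>R q z" if "w \<in> \<F>" "z \<in> \<F>" for w z \<alpha>
  proof -
    have "(\<lambda>x. \<alpha> *\<^sub>R z x) \<in> \<F>" using \<F>(1) that by (simp add: fun_subspace_def)
    then show ?thesis using \<F>(2)[OF that(1)] \<F>(3)[OF that(2)] by simp
  qed
  have qA_linear: "q (A (\<lambda>x. w x + \<alpha> *\<^sub>R z x)) = q (A w) + \<alpha> *\<^sub>R q (A z)" if w: "w \<in> W" "z \<in> W" for w z \<alpha>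
  proof -
    have wz: "(\<lambda>x. w x + \<alpha> *\<^sub>R z x) \<in> W" by (rule fun_subspace_linear[OF W(1) w])
    have "q (A (\<lambda>x. w x + \<alpha> *\<^sub>R z x)) = q (\<lambda>x. A w x + \<alpha> *\<^sub>R A z x)"
      using w wz by (intro q_eq W fun_subspace_linear[OF \<F>(1)] linear_diff_operator_linear[OF domain(1) operator(1)])
    then show ?thesis using q_linear W(4) w by simp
  qed

  obtain E' M where smoothing: "smoothing_semigroup E E' T M"
    and E': "\<And>x t. x \<in> D0 \<Longrightarrow> 0 < t \<Longrightarrow> E' t x = E t (A0 x)"
    using generates_analytic_semigroup_smoothing[OF A0(2) horizon] by blast
  interpret D: dirichlet_problem E E' T M \<Gamma> q W A
  proof (intro dirichlet_problem.intro dirichlet_problem_axioms.intro smoothing)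
    show "E' t (q w) = E t (q (A w))" if "w \<in> W" "\<And>x. x \<in> \<Gamma> \<Longrightarrow> w x = 0" "0 < t" for w t
      using A0(1) E'[of "q w" t] that by (simp add: dirichlet_realization_def)
  qed (use W q_linear qA_linear in auto)

  have u: "u t \<in> W" "\<And>x. x \<in> \<Gamma> \<Longrightarrow> u t x = b x"
    "(c has_vector_derivative q (A (u t)) + f (c t)) (at t within {0..T})" if "t \<in> {0..T}" for t
    using solution(1) that by (auto simp: exact_solution_def c_def[abs_def])
  have cU: "c t \<in> U" if "t \<in> {0..T}" for t using near_solution that by (simp add: c_def)
  have F: "F t \<in> W" and fc: "f (c t) = q (F t)" if t: "t \<in> {0..T}" for t
    using smooth_reaction(1) reaction t cU[OF t] W(3)[OF u(1)[OF t]]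
    by (auto simp: F_def pointwise_reaction_def c_def)
  obtain c1 c2 c3 where c1: "\<And>t. t \<in> {0..T} \<Longrightarrow> (c has_vector_derivative c1 t) (at t within {0..T})"
    and c2: "\<And>t. t \<in> {0..T} \<Longrightarrow> (c1 has_vector_derivative c2 t) (at t within {0..T})"
    and c3: "\<And>t. t \<in> {0..T} \<Longrightarrow> (c2 has_vector_derivative c3 t) (at t within {0..T})"
    using smooth_solution unfolding C3_curve_def c_def[abs_def] by blast
  \<comment> \<open>The derivative provided by \<open>C3_curve\<close> is an unspecified witness;
    uniqueness on a nondegenerate interval identifies it with the right hand side of the
    equation.\<close>
  have c1_eq: "c1 t = q (A (u t)) + f (c t)" if t: "t \<in> {0..T}" for t
    by (rule vector_derivative_unique_within_closed_interval[of 0 T t c])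
      (use horizon t c1[OF t] u(3)[OF t] in \<open>auto simp: box_real\<close>)
  have cont: "continuous_on {0..T} c" "continuous_on {0..T} c1" "continuous_on {0..T} c2"
    using has_vector_derivative_continuous[OF c1] has_vector_derivative_continuous[OF c2]
      has_vector_derivative_continuous[OF c3]
    by (simp_all add: continuous_on_eq_continuous_within)
  have bound: "\<exists>B. \<forall>t\<in>{0..T}. norm (p t) \<le> B" if "continuous_on {0..T} p" for p :: "real \<Rightarrow> 'x"
    using compact_imp_bounded[OF compact_continuous_image[OF that compact_Icc]] by (auto simp: bounded_iff)
  obtain Bc B1 B2 where Bc: "\<And>t. t \<in> {0..T} \<Longrightarrow> norm (c t) \<le> Bc"
    and B1: "\<And>t. t \<in> {0..T} \<Longrightarrow> norm (c1 t) \<le> B1"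
    and B2: "\<And>t. t \<in> {0..T} \<Longrightarrow> norm (c2 t) \<le> B2"
    using bound[OF cont(1)] bound[OF cont(2)] bound[OF cont(3)] by blast
  obtain Ba where Ba: "\<And>t. t \<in> {0..T} \<Longrightarrow> norm (a t) \<le> Ba"
    using smooth_reaction(2) unfolding bounded_iff a_def F_def by blast

  have trajectory: "compact (c ` {0..T})" "c ` {0..T} \<subseteq> U" "c ` {0..T} \<noteq> {}"
    using compact_continuous_image[OF cont(1)] cU horizon by auto
  obtain f' f'' r K0 where f': "0 < r" "1 \<le> K0"
    "\<And>x K. x \<in> c ` {0..T} \<Longrightarrow> K0 \<le> K \<Longrightarrow> reaction_ball U f f' x r K"
    "\<And>x. x \<in> U \<Longrightarrow> (f has_derivative blinfun_apply (f' x)) (at x)"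
    "\<And>x. x \<in> U \<Longrightarrow> (f' has_derivative blinfun_apply (f'' x)) (at x)"
    "\<And>x. x \<in> c ` {0..T} \<Longrightarrow> norm (f' x) \<le> K0" "\<And>x. x \<in> c ` {0..T} \<Longrightarrow> norm (f'' x) \<le> K0"
  proof -
    show thesis by (rule C2_on_compact[OF f_smooth trajectory]) (rule that)
  qed
  \<comment> \<open>The second derivative of \<open>f\<close> along the trajectory, by the chain and
    product rules; its bound yields the quadratic remainder \<open>fc_taylor\<close>.\<close>
  define r2 where "r2 t = f' (c t) (c2 t) + f'' (c t) (c1 t) (c1 t)" for t
  have r1: "((\<lambda>t. f (c t)) has_vector_derivative f' (c t) (c1 t)) (at t within {0..T})" if t: "t \<in> {0..T}" for t
    using has_derivative_compose[OF c1[OF t, unfolded has_vector_derivative_def] f'(4)[OF cU[OF t]]]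
    by (simp add: has_vector_derivative_def blinfun.scaleR_right)
  have r2: "((\<lambda>t. f' (c t) (c1 t)) has_vector_derivative r2 t) (at t within {0..T})" if t: "t \<in> {0..T}" for t
  proof -
    have "((\<lambda>t. f' (c t)) has_vector_derivative f'' (c t) (c1 t)) (at t within {0..T})"
      using has_derivative_compose[OF c1[OF t, unfolded has_vector_derivative_def] f'(5)[OF cU[OF t]]]
      by (simp add: has_vector_derivative_def blinfun.scaleR_right)
    from blinfun.has_vector_derivative[OF this c2[OF t]] show ?thesis by (simp add: r2_def)
  qed
  have B1': "0 \<le> B1" by (rule order_trans[OF norm_ge_zero B1[of 0]]) (use horizon in simp)
  have r2_bound: "norm (r2 t) \<le> K0 * B2 + K0 * B1 * B1" if t: "t \<in> {0..T}" for t
  proof -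
    have "norm (f' (c t) (c2 t)) \<le> K0 * B2"
      using f'(6)[of "c t"] B2[OF t] t f'(2) by (intro order_trans[OF norm_blinfun mult_mono]) auto
    moreover have "norm (f'' (c t) (c1 t)) \<le> K0 * B1"
      using f'(7)[of "c t"] B1[OF t] t f'(2) by (intro order_trans[OF norm_blinfun mult_mono]) auto
    then have "norm (f'' (c t) (c1 t) (c1 t)) \<le> K0 * B1 * B1"
      by (rule order_trans[OF norm_blinfun mult_mono]) (use B1[OF t] f'(2) B1' in auto)
    ultimately show ?thesis unfolding r2_def by (intro norm_triangle_mono)
  qed

  define K where "K = Max {K0, B1, B2, Ba, K0 * B2 + K0 * B1 * B1}"
  have K: "K0 \<le> K" "B1 \<le> K" "B2 \<le> K" "Ba \<le> K" "K0 * B2 + K0 * B1 * B1 \<le> K"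
    unfolding K_def by (rule Max_ge; simp)+
  have du: "((\<lambda>s. q (u s)) has_vector_derivative q (A (u t)) + f (c t)) (at t within {0..T})"
    if "t \<in> {0..T}" for t
    using u(3)[OF that] by (simp add: c_def[abs_def])
  interpret P: parabolic_problem E E' T M U f f' r K c c1 a
  proof (intro parabolic_problem.intro parabolic_problem_axioms.intro smoothing)
    show "reaction_ball U f f' (c t) r K" if "t \<in> {0..T}" for t using that K(1) by (intro f'(3)) auto
    show "continuous_on {0..T} c" by (rule cont)
    show "norm (c1 t) \<le> K" if "t \<in> {0..T}" for t using B1[OF that] K by simp
    show "norm (a t) \<le> K" if "t \<in> {0..T}" for t using Ba[OF that] K by simp
    fix t s assume ts: "0 \<le> t" "0 \<le> s" "t + s \<le> T"
    show "norm (c (t + s) - c t - s *\<^sub>R c1 t) \<le> K * s\<^sup>2"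
      using B2 K(3) by (intro second_order_taylor[OF c1 c2 _ ts]) (auto intro: order_trans)
    show "norm (f (c (t + s)) - f (c t) - s *\<^sub>R f' (c t) (c1 t)) \<le> K * s\<^sup>2"
      using r2_bound K(5) by (intro second_order_taylor[OF r1 r2 _ ts]) (auto intro: order_trans)
    show "c (t + s) = c t + integral {0..s} (\<lambda>\<sigma>. E (s - \<sigma>) (c1 t + (f (c (t + \<sigma>)) - f (c t))))"
      using D.exact_mild[where \<phi> = "\<lambda>t. f (c t)", OF ts u(1,2) du]
        c1_eq[of t] ts
      by (simp add: c_def)
  qed

  \<comment> \<open>The existential choice in the definition of the flow is replaced by functions
    built from \<open>u t\<close>. This makes the flow single valued and links the scheme to the
    abstract step at any reference time.\<close>
  have flow_A: "flow_A \<Gamma> q W A E g b h v0 v1 \<longleftrightarrow> v1 = P.parabolic_step t h v0"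
    if h: "0 < h" and t: "0 \<le> t" "t + h \<le> T" for t h v0 v1
  proof -
    have tT: "t \<in> {0..T}" and hT: "h \<le> T" using h t by auto
    define \<sigma>0 where "\<sigma>0 x = u t x + (h / 2) *\<^sub>R F t x" for x
    define \<sigma>1 where "\<sigma>1 x = (-1) *\<^sub>R F t x" for x
    \<comment> \<open>Negation is written as \<open>F + (-2) F\<close>, the shape to which the
      linearity facts for \<open>w + \<alpha> z\<close> apply.\<close>
    have "\<sigma>1 = (\<lambda>x. F t x + (-2) *\<^sub>R F t x)" by (simp add: \<sigma>1_def fun_eq_iff scaleR_2)
    then have \<sigma>: "\<sigma>0 \<in> W" "\<sigma>1 \<in> W" "q \<sigma>0 = c t + (h / 2) *\<^sub>R f (c t)" "q \<sigma>1 = - f (c t)"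
      "q (A \<sigma>0) = q (A (u t)) + (h / 2) *\<^sub>R a t" "q (A \<sigma>1) = - a t"
      using D.W_linear[OF u(1)[OF tT] F[OF tT], of "h/2"] D.W_linear[OF F[OF tT] F[OF tT], of "-2"]
        q_linear[OF W(3)[OF u(1)[OF tT]] W(3)[OF F[OF tT]], of "h/2"]
        q_linear[OF W(3)[OF F[OF tT]] W(3)[OF F[OF tT]], of "-2"]
        qA_linear[OF u(1)[OF tT] F[OF tT], of "h/2"] qA_linear[OF F[OF tT] F[OF tT], of "-2"]
      by (simp_all add: \<sigma>0_def[abs_def] c_def a_def fc[OF tT, unfolded c_def] scaleR_2)
    have bc: "\<sigma>0 x + s *\<^sub>R \<sigma>1 x = b x + (h / 2 - s) *\<^sub>R g x (b x)" if "x \<in> \<Gamma>" for s x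
      using u(2)[OF tT that] by (simp add: \<sigma>0_def \<sigma>1_def F_def algebra_simps)
    have step: "q \<sigma>0 + h *\<^sub>R q \<sigma>1
        + mild_solution_at E (\<lambda>s. (q (A \<sigma>0) + s *\<^sub>R q (A \<sigma>1)) - q \<sigma>1) (v0 - q \<sigma>0) h = P.parabolic_step t h v0"
    proof -
      have "(q (A \<sigma>0) + s *\<^sub>R q (A \<sigma>1)) - q \<sigma>1 = c1 t + (h / 2 - s) *\<^sub>R a t" for s
        unfolding \<sigma> c1_eq[OF tT] by (simp add: algebra_simps)
      moreover have "q \<sigma>0 + h *\<^sub>R q \<sigma>1 = c t - (h / 2) *\<^sub>R f (c t)"
      proof -
        have "h *\<^sub>R f (c t) = (h / 2) *\<^sub>R f (c t) + (h / 2) *\<^sub>R f (c t)"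
          by (simp add: scaleR_left_distrib[symmetric])
        then show ?thesis unfolding \<sigma> by simp
      qed
      ultimately show ?thesis
        by (simp add: mild_solution_at_def P.parabolic_step_def \<sigma>(3) diff_diff_eq)
    qed
    show ?thesis
    proof
      assume "flow_A \<Gamma> q W A E g b h v0 v1"
      then obtain \<rho>0 \<rho>1 where \<rho>: "\<rho>0 \<in> W" "\<rho>1 \<in> W"
        "\<And>s x. s \<in> {0..h} \<Longrightarrow> x \<in> \<Gamma> \<Longrightarrow> \<rho>0 x + s *\<^sub>R \<rho>1 x = b x + (h / 2 - s) *\<^sub>R g x (b x)"
        "v1 = q \<rho>0 + h *\<^sub>R q \<rho>1
          + mild_solution_at E (\<lambda>s. (q (A \<rho>0) + s *\<^sub>R q (A \<rho>1)) - q \<rho>1) (v0 - q \<rho>0) h"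
        unfolding flow_A_def by blast
      show "v1 = P.parabolic_step t h v0"
        unfolding \<rho>(4) step[symmetric]
        using \<rho>(3) bc by (intro D.homogenization_independent h hT \<rho>(1,2) \<sigma>(1,2)) simp
    next
      assume "v1 = P.parabolic_step t h v0"
      then show "flow_A \<Gamma> q W A E g b h v0 v1"
        unfolding flow_A_def using \<sigma>(1,2) bc step by (intro bexI[of _ \<sigma>0] bexI[of _ \<sigma>1]) auto
    qed
  qed
  \<comment> \<open>\<open>u 0\<close> and \<open>u0\<close> are known to agree only on the closure
    of \<open>\<Omega>\<close>; this suffices for equality of their classes.\<close>
  have init: "q u0 = c 0"
  proof -
    have "u 0 x = u0 x" if "x \<in> \<Omega>" for x
      using solution(1) closure_subset that by (auto simp: exact_solution_def)
    then show ?thesis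
      unfolding c_def using W(3) u(1)[of 0] solution(2) horizon by (intro q_eq[symmetric]) auto
  qed
  have num: "?num h n un \<longleftrightarrow> P.trajectory h n un" if h: "0 < h" and n: "real n * h \<le> T" for h n un
  proof -
    have "strang_step \<Gamma> q W A E g U f b h v v' \<longleftrightarrow> P.splitting_step (real k * h) h v v'" if k: "k < n" for k v v'
    proof -
      have "real k * h + h = real (Suc k) * h" by (simp add: algebra_simps)
      also have "\<dots> \<le> real n * h" using k h by (intro mult_right_mono) auto
      finally have "real k * h + h \<le> T" using n by simp
      then show ?thesis
        using flow_A[OF h, of "real k * h"] h by (auto simp: strang_step_def P.splitting_step_def)
    qed
    then show ?thesis by (auto simp: numerical_solution_def P.trajectory_def init)
  qed

  obtain h1 C where h1: "0 < h1" and C: "0 \<le> C"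
    and exist: "\<And>h n. h \<in> {0<..h1} \<Longrightarrow> real n * h \<le> T \<Longrightarrow> \<exists>un. P.trajectory h n un"
    and error: "\<And>h n un. h \<in> {0<..h1} \<Longrightarrow> real n * h \<le> T \<Longrightarrow> P.trajectory h n un \<Longrightarrow>
      norm (un n - c (real n * h)) \<le> C * h\<^sup>2 * (1 + \<bar>ln h\<bar>)"
    using P.convergence by blast
  \<comment> \<open>Above \<open>h1\<close> nothing controls the iterates, so their bound
    \<open>R\<close> enters: an error of at most \<open>R + Bc\<close> is trivially of order
    \<open>h\<^sup>2\<close>, because \<open>h\<close> exceeds the fixed \<open>h1\<close>.\<close>
  have "\<exists>C'. \<forall>h>0. \<forall>n un. real n * h \<le> T \<longrightarrow> ?num h n un \<longrightarrow> norm (un n) \<le> R \<longrightarrow>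
      norm (un n - c (real n * h)) \<le> C' * h\<^sup>2 * (1 + \<bar>ln h\<bar>)" for R
  proof (intro exI allI impI)
    fix h :: real and n and un :: "nat \<Rightarrow> 'x"
    assume h: "0 < h" and n: "real n * h \<le> T" and un: "?num h n un" and R: "norm (un n) \<le> R"
    let ?C = "C + \<bar>R + Bc\<bar> / h1\<^sup>2"
    show "norm (un n - c (real n * h)) \<le> ?C * h\<^sup>2 * (1 + \<bar>ln h\<bar>)"
    proof (cases "h \<le> h1")
      case True
      then have "norm (un n - c (real n * h)) \<le> C * h\<^sup>2 * (1 + \<bar>ln h\<bar>)"
        using h n un num[OF h n] by (intro error) auto
      also have "\<dots> \<le> ?C * h\<^sup>2 * (1 + \<bar>ln h\<bar>)" by (intro mult_right_mono) auto
      finally show ?thesis .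
    next
      case False
      have "real n * h \<in> {0..T}" using h n by simp
      then have "norm (un n - c (real n * h)) \<le> R + Bc"
        using R Bc norm_triangle_ineq4[of "un n" "c (real n * h)"] by (smt (verit))
      also have "\<dots> \<le> \<bar>R + Bc\<bar> / h1\<^sup>2 * h1\<^sup>2" using h1 by simp
      also have "\<dots> \<le> ?C * h\<^sup>2"
        using False h1 C by (intro mult_mono power_mono) auto
      also have "\<dots> = ?C * h\<^sup>2 * 1" by simp
      also have "\<dots> \<le> ?C * h\<^sup>2 * (1 + \<bar>ln h\<bar>)"
        using C by (intro mult_left_mono) auto
      finally show ?thesis .
    qed
  qed
  moreover have "\<forall>h\<in>{0<..h1}. \<forall>n. real n * h \<le> T \<longrightarrow> (\<exists>un. ?num h n un) \<and>
      (\<forall>un. ?num h n un \<longrightarrow> norm (un n - c (real n * h)) \<le> C * h\<^sup>2 * (1 + \<bar>ln h\<bar>))"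
    using num exist error by auto
  ultimately show ?thesis using h1 unfolding c_def by blast
qed

end
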